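(* Let $p,q,r,s\ge0$ be integers, and let $a_1|a_1',\dots,a_q|a_q'$, $b_1|b_1',\dots,b_p|b_p'$, $c_1|c_1',\dots,c_s|c_s'$, $d_1|d_1',\dots,d_r|d_r'\in\Lambda_{\mathbb C}$ satisfy $$\operatorname{Re}(a_\alpha+a_\alpha')>0,\quad \operatorname{Re}(b_\beta+b_\beta')>0,\quad \operatorname{Re}(c_\gamma+c_\gamma')>0,\quad \operatorname{Re}(d_\delta+d_\delta')>0\quad\text{for all indices},$$ $$\sum_\alpha\operatorname{Re}(a_\alpha+a_\alpha')+\sum_\beta\operatorname{Re}(b_\beta+b_\beta')<p+q,\qquad \sum_\gamma\operatorname{Re}(c_\gamma+c_\gamma')+\sum_\delta\operatorname{Re}(d_\delta+d_\delta')<r+s,$$ so that the functions below are defined. Suppose that the two functions of $z$ $${}_pG_q^{\mathbb C}\Big[{(a|a')\atop (b|b')};z\Big],\qquad {}_rG_s^{\mathbb C}\Big[{(c|c')\atop (d|d')};z\Big]$$ are contained in $L^2(\mathbb C,|z|^{-2}\,d^2z)$. Then for $t\in\mathbb C\setminus\{0\}$ $$\frac1{2\pi}\int_{\mathbb C}{}_pG_q^{\mathbb C}\Big[{(a|a')\atop (b|b')};z\Big]\cdot{}_rG_s^{\mathbb C}\Big[{(c|c')\atop (d|d')};\frac tz\Big]\frac{d^2z}{|z|^2}={}_{p+r}G_{q+s}^{\mathbb C}\Big[{(a|a'),(c|c')\atop (b|b'),(d|d')};t\Big].$$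
   Context: $d^2z=d\operatorname{Re}z\,d\operatorname{Im}z$ is Lebesgue measure on $\mathbb C$. $\Lambda_{\mathbb C}$ is the set of pairs $a|a'$ with $a,a'\in\mathbb C$ and $a-a'\in\mathbb Z$. For $z\in\mathbb C\setminus\{0\}$ and $a|a'\in\Lambda_{\mathbb C}$ put $z^{a|a'}:=z^a\bar z^{\,a'}:=(z/|z|)^{a-a'}|z|^{a+a'}$. In particular $z^{\frac{-k-\sigma}2|\frac{k-\sigma}2}=(z/|z|)^{-k}|z|^{-\sigma}$ for $k\in\mathbb Z$, $\sigma\in\mathbb C$. The Gamma function of the complex field is the meromorphic function on $\Lambda_{\mathbb C}$ given by $\Gamma^{\mathbb C}(a|a')=\dfrac{\Gamma(a)}{\Gamma(1-a')}$. For integers $p,q\ge0$ and $a_1|a_1',\dots,a_q|a_q'$, $b_1|b_1',\dots,b_p|b_p'\in\Lambda_{\mathbb C}$ with $\operatorname{Re}(a_\alpha+a_\alpha')>0$, $\operatorname{Re}(b_\beta+b_\beta')>0$ and $\sum_\alpha\operatorname{Re}(a_\alpha+a_\alpha')+\sum_\beta\operatorname{Re}(b_\beta+b_\beta')<p+q$, put for $k\in\mathbb Z$, $\sigma\in\mathbb C$ $${}_p\mathcal K_q^{\mathbb C}\Big[{(a|a')\atop (b|b')};\tfrac{k+\sigma}2\Big|\tfrac{-k+\sigma}2\Big]:=\prod_{\alpha=1}^q\Gamma^{\mathbb C}\big(a_\alpha+\tfrac{k+\sigma}2\big|a_\alpha'+\tfrac{-k+\sigma}2\big)\prod_{\beta=1}^p\Gamma^{\mathbb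 C}\big(b_\beta+\tfrac{-k-\sigma}2\big|b_\beta'+\tfrac{k-\sigma}2\big)$$ and $${}_pG_q^{\mathbb C}\Big[{(a|a')\atop (b|b')};z\Big]:=\frac1{2\pi i}\sum_{k\in\mathbb Z}\int_{i\mathbb R}{}_p\mathcal K_q^{\mathbb C}\Big[{(a|a')\atop (b|b')};\tfrac{k+\sigma}2\Big|\tfrac{-k+\sigma}2\Big]\,z^{\frac{-k-\sigma}2|\frac{k-\sigma}2}\,d\sigma ,$$ the integrals over the imaginary axis (taken upward) being conditionally convergent improper integrals. For $p=q$ the circle $|z|=1$, a set of measure zero, may have to be excluded from the domain of definition. In ${}_pG_q^{\mathbb C}$ the upper list $(a|a')$ has $q$ entries and the lower list $(b|b')$ has $p$ entries. *)

theory Defs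
  imports "HOL-Complex_Analysis.Complex_Analysis"
begin

definition Lambda_C :: "(complex \<times> complex) set" where
  "Lambda_C = {(a, a'). a - a' \<in> \<int>}"

text \<open>
  \<open>cpower z (a, a')\<close> is $z^{a|a'} = (z/|z|)^{a-a'} |z|^{a+a'}$, for $z \neq 0$ and
  \<open>(a, a') \<in> Lambda_C\<close>. There the floor is just the integer $a - a'$.
\<close>

definition cpower :: "complex \<Rightarrow> complex \<times> complex \<Rightarrow> complex" where
  "cpower z = (\<lambda>(a, a').
     (z / of_real (cmod z)) powi \<lfloor>Re (a - a')\<rfloor> * of_real (cmod z) powr (a + a'))"

text \<open>
  On \<open>Lambda_C\<close> the quotient $\Gamma(a)/\Gamma(1-a')$ has removable singularities where
  \<open>a\<close> and \<open>1 - a'\<close> are both poles of the Gamma function; there the value of a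
  meromorphic function is its limit along the component of \<open>Lambda_C\<close>, that is, along
  \<open>(a + h, a' + h)\<close>. As usual in the library, the value at a genuine pole is \<open>0\<close>.
\<close>

definition Gamma_C :: "complex \<times> complex \<Rightarrow> complex" where
  "Gamma_C = (\<lambda>(a, a'). remove_sings (\<lambda>h. Gamma (a + h) / Gamma (1 - (a' + h))) 0)"

lemma Gamma_C_eq:
  assumes "a \<notin> \<int>\<^sub>\<le>\<^sub>0"
  shows "Gamma_C (a, a') = Gamma a / Gamma (1 - a')"
proof -
  have *: "(\<lambda>h. Gamma (a + h) * rGamma (1 - (a' + h))) analytic_on {0}"
    using assms by (auto intro!: analytic_intros analytic_on_compose_gen)
  have "(\<lambda>h. Gamma (a + h) / Gamma (1 - (a' + h))) = (\<lambda>h. Gamma (a + h) * rGamma (1 - (a' + h)))"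
    by (simp add: rGamma_inverse_Gamma field_simps)
  then show ?thesis
    using remove_sings_at_analytic[OF *]
    by (simp add: Gamma_C_def rGamma_inverse_Gamma field_simps)
qed

text \<open>
  The list \<open>a\<close> has $q$ entries and the list \<open>b\<close> has $p$ entries.
\<close>

definition K_C ::
  "(complex \<times> complex) list \<Rightarrow> (complex \<times> complex) list \<Rightarrow> int \<Rightarrow> complex \<Rightarrow> complex" where
  "K_C a b k \<sigma> =
     (\<Prod>(u, u')\<leftarrow>a. Gamma_C (u + (of_int k + \<sigma>) / 2, u' + (- of_int k + \<sigma>) / 2)) *
     (\<Prod>(v, v')\<leftarrow>b. Gamma_C (v + (- of_int k - \<sigma>) / 2, v' + (of_int k - \<sigma>) / 2))"

text \<open>
  The integral over the imaginary axis is parametrised by $\sigma = i\tau$. The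
  Henstock--Kurzweil \<open>integral UNIV\<close> on the real line is the limit of the integrals over
  $[-A, B]$ as $A, B \to \infty$ independently, so it covers conditionally convergent
  improper integrals.
\<close>

definition G_C ::
  "(complex \<times> complex) list \<Rightarrow> (complex \<times> complex) list \<Rightarrow> complex \<Rightarrow> complex" where
  "G_C a b z = 1 / (2 * of_real pi * \<i>) *
     (\<Sum>\<^sub>\<infinity>k\<in>(UNIV :: int set). integral (UNIV :: real set) (\<lambda>\<tau>. let \<sigma> = \<i> * of_real \<tau> in
        K_C a b k \<sigma> * cpower z ((- of_int k - \<sigma>) / 2, (of_int k - \<sigma>) / 2) * \<i>))"

text \<open>The measure $|z|^{-2}\,d^2z$ on the complex plane.\<close>

definition mult_measure :: "complex measure" where
  "mult_measure = density lborel (\<lambda>z. ennreal (1 / (cmod z)\<^sup>2))"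

definition L2 :: "'a measure \<Rightarrow> ('a \<Rightarrow> complex) \<Rightarrow> bool" where
  "L2 M f \<longleftrightarrow> f \<in> borel_measurable M \<and> integrable M (\<lambda>x. (cmod (f x))\<^sup>2)"

end

theory Submission
  imports Defs "HOL-Probability.Probability" "HOL-Real_Asymp.Real_Asymp"
begin

text \<open>
  Put \<open>z = exp (x + \<i> * \<theta>)\<close>. Then \<open>G_C a b\<close> is the inverse Fourier transform of \<open>K_C a b\<close> on the
  group of integers times reals, and the integral is a convolution on the multiplicative group, so
  the claim is Parseval's identity. Since the integrals converge only conditionally, three points
  need care. First, Stirling-type estimates show that the logarithmic derivative in \<open>\<tau>\<close> of the
  kernel is \<open>\<i> * (q - p) * ln (rho k \<tau> / 2)\<close> up to \<open>O(1 / rho k \<tau>)\<close>, where \<open>rho k \<tau> = cmod (k + \<i> * \<tau>)\<close>.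
  Hence for \<open>cmod z \<noteq> 1\<close> there is no stationary phase far out; integrating by parts twice, the
  \<open>\<tau>\<close>-integrals converge and are absolutely summable over \<open>k\<close>. Secondly, Fourier series on circles
  turn square integrability of \<open>G_C a b\<close> into square integrability of each of these \<open>\<tau>\<close>-integrals as
  a function of \<open>x\<close>, with summable norms. Thirdly, Gaussian regularisation on both sides proves that a
  conditionally convergent Fourier integral with square integrable value has a square integrable
  integrand, together with Parseval's identity for a pair of such integrals.
\<close>

section \<open>A Parseval identity for improper Fourier integrals\<close>

text \<open>The hypotheses give only \<open>\<eta> > 0\<close> for the order of decay
  \<open>\<eta>\<close>, which is p + q minus the sum of all real parts. The kernel is therefore not
  known beforehand to be integrable or square integrable in \<open>\<tau>\<close>; its square
  integrability has to be extracted from the assumption on \<open>G_C\<close>. What makes the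
  estimates work is that \<open>\<nu> = q - p\<close> is an integer. If it is 0, the logarithmic
  derivative tends to 0 and only x = ln |z| = 0 is stationary at infinity. Otherwise the logarithm
  outgrows every fixed x, but only beyond a radius of order exp |x|. For each k the partial
  integrals are thus bounded by a multiple of exp |x| + |x| powr (-1/(1 + \<eta>)); a Gaussian in x
  absorbs this growth, and the singularity at 0 is integrable. The second integration by parts is
  there for the sum over k: it leaves a remainder O(rho powr (-2 - \<eta>)), whose integral over
  \<open>\<tau>\<close> is the summable O(|k| powr (-1 - \<eta>)).\<close>

lemma L2_cmult: "L2 M f \<Longrightarrow> L2 M (\<lambda>x. c * f x)"
  by (auto simp: L2_def norm_mult power_mult_distrib)

lemma L2_diff:
  assumes "L2 M f" "L2 M g"
  shows "L2 M (\<lambda>x. f x - g x)"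
  unfolding L2_def
proof
  have [measurable]: "f \<in> borel_measurable M" "g \<in> borel_measurable M"
    using assms by (auto simp: L2_def)
  show "(\<lambda>x. f x - g x) \<in> borel_measurable M" by measurable
  show "integrable M (\<lambda>x. (cmod (f x - g x))\<^sup>2)"
  proof (rule Bochner_Integration.integrable_bound)
    show "integrable M (\<lambda>x. 2 * (cmod (f x))\<^sup>2 + 2 * (cmod (g x))\<^sup>2)"
      using assms by (auto simp: L2_def)
    have "(cmod (f x - g x))\<^sup>2 \<le> 2 * (cmod (f x))\<^sup>2 + 2 * (cmod (g x))\<^sup>2" for x
    proof -
      have "(cmod (f x - g x))\<^sup>2 \<le> (cmod (f x) + cmod (g x))\<^sup>2"
        by (intro power_mono norm_triangle_ineq4) auto
      also have "\<dots> \<le> 2 * (cmod (f x))\<^sup>2 + 2 * (cmod (g x))\<^sup>2"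
        using zero_le_power2[of "cmod (f x) - cmod (g x)"]
        by (simp add: power2_eq_square algebra_simps)
      finally show ?thesis .
    qed
    then show "AE x in M. norm ((cmod (f x - g x))\<^sup>2) \<le> norm (2 * (cmod (f x))\<^sup>2 + 2 * (cmod (g x))\<^sup>2)"
      by simp
  qed measurable
qed

text \<open>Cauchy-Schwarz for the bilinear pairing, without conjugate, because that is the pairing
  that occurs in a convolution.\<close>

lemma L2_mult:
  assumes "L2 M f" "L2 M g"
  shows "integrable M (\<lambda>x. f x * g x)"
    and "(cmod (\<integral>x. f x * g x \<partial>M))\<^sup>2 \<le> (\<integral>x. (cmod (f x))\<^sup>2 \<partial>M) * (\<integral>x. (cmod (g x))\<^sup>2 \<partial>M)"
proof -
  have [measurable]: "f \<in> borel_measurable M" "g \<in> borel_measurable M"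
    using assms by (auto simp: L2_def)
  have if2: "integrable M (\<lambda>x. (cmod (f x))\<^sup>2)" and ig2: "integrable M (\<lambda>x. (cmod (g x))\<^sup>2)"
    using assms by (auto simp: L2_def)
  show int: "integrable M (\<lambda>x. f x * g x)"
  proof (rule Bochner_Integration.integrable_bound)
    show "integrable M (\<lambda>x. (cmod (f x))\<^sup>2 + (cmod (g x))\<^sup>2)"
      using assms by (auto simp: L2_def)
    have "cmod (f x) * cmod (g x) \<le> (cmod (f x))\<^sup>2 + (cmod (g x))\<^sup>2" for x
      using zero_le_power2[of "cmod (f x) - cmod (g x)"] zero_le_power2[of "cmod (f x)"]
        zero_le_power2[of "cmod (g x)"]
      unfolding power2_diff by linarith
    then show "AE x in M. cmod (f x * g x) \<le> norm ((cmod (f x))\<^sup>2 + (cmod (g x))\<^sup>2)"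
      by (simp add: norm_mult)
  qed measurable
  have "ennreal ((cmod (\<integral>x. f x * g x \<partial>M))\<^sup>2) = (ennreal (cmod (\<integral>x. f x * g x \<partial>M)))\<^sup>2"
    by (simp add: ennreal_power)
  also have "\<dots> \<le> (\<integral>\<^sup>+x. ennreal (cmod (f x * g x)) \<partial>M)\<^sup>2"
    by (intro power_mono integral_norm_bound_ennreal int) auto
  also have "\<dots> = (\<integral>\<^sup>+x. ennreal (cmod (f x)) * ennreal (cmod (g x)) \<partial>M)\<^sup>2"
    by (simp add: norm_mult ennreal_mult)
  also have "\<dots> \<le> (\<integral>\<^sup>+x. (ennreal (cmod (f x)))\<^sup>2 \<partial>M) * (\<integral>\<^sup>+x. (ennreal (cmod (g x)))\<^sup>2 \<partial>M)"
    by (intro Cauchy_Schwarz_nn_integral) measurable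
  also have "\<dots> = ennreal (\<integral>x. (cmod (f x))\<^sup>2 \<partial>M) * ennreal (\<integral>x. (cmod (g x))\<^sup>2 \<partial>M)"
    using if2 ig2 by (simp add: ennreal_power nn_integral_eq_integral)
  also have "\<dots> = ennreal ((\<integral>x. (cmod (f x))\<^sup>2 \<partial>M) * (\<integral>x. (cmod (g x))\<^sup>2 \<partial>M))"
    by (simp add: ennreal_mult)
  finally show "(cmod (\<integral>x. f x * g x \<partial>M))\<^sup>2 \<le> (\<integral>x. (cmod (f x))\<^sup>2 \<partial>M) * (\<integral>x. (cmod (g x))\<^sup>2 \<partial>M)"
    by (subst (asm) ennreal_le_iff) auto
qed

text \<open>Expanding around the limits, uv - u'v' = (u - u')(v - v') + (u - u')v' + u'(v - v'),
  reduces everything to Cauchy-Schwarz and avoids a separate bound for the norms of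
  \<open>v n\<close>.\<close>

lemma L2_tendsto_integral_mult:
  assumes "\<And>n::nat. L2 M (u n)" "\<And>n. L2 M (v n)" "L2 M u'" "L2 M v'"
    and u: "(\<lambda>n. \<integral>x. (cmod (u n x - u' x))\<^sup>2 \<partial>M) \<longlonglongrightarrow> 0"
    and v: "(\<lambda>n. \<integral>x. (cmod (v n x - v' x))\<^sup>2 \<partial>M) \<longlonglongrightarrow> 0"
  shows "(\<lambda>n. \<integral>x. u n x * v n x \<partial>M) \<longlonglongrightarrow> (\<integral>x. u' x * v' x \<partial>M)"
proof -
  have *: "(\<lambda>n. \<integral>x. f n x * g n x \<partial>M) \<longlonglongrightarrow> 0"
    if L: "\<And>n. L2 M (f n)" "\<And>n. L2 M (g n)"
      and l: "(\<lambda>n. (\<integral>x. (cmod (f n x))\<^sup>2 \<partial>M) * (\<integral>x. (cmod (g n x))\<^sup>2 \<partial>M))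
          \<longlonglongrightarrow> 0" for f g :: "nat \<Rightarrow> _ \<Rightarrow> complex"
  proof -
    have "(\<lambda>n. (cmod (\<integral>x. f n x * g n x \<partial>M))\<^sup>2) \<longlonglongrightarrow> 0"
      by (rule tendsto_sandwich[OF _ _ tendsto_const l])
          (use L in \<open>auto intro!: always_eventually L2_mult(2)\<close>)
    then have "(\<lambda>n. sqrt ((cmod (\<integral>x. f n x * g n x \<partial>M))\<^sup>2)) \<longlonglongrightarrow> sqrt 0"
      by (rule tendsto_real_sqrt)
    then show ?thesis by (simp add: tendsto_norm_zero_iff)
  qed
  note d = L2_diff[OF assms(1,3)] L2_diff[OF assms(2,4)]
  have "(\<lambda>n. (\<integral>x. (u n x - u' x) * (v n x - v' x) \<partial>M) + (\<integral>x. (u n x - u' x) * v' x \<partial>M)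
      + (\<integral>x. u' x * (v n x - v' x) \<partial>M) + (\<integral>x. u' x * v' x \<partial>M)) \<longlonglongrightarrow> 0 + 0 + 0 + (\<integral>x. u' x * v' x \<partial>M)"
  proof (intro tendsto_add * tendsto_const)
    show "(\<lambda>n. (\<integral>x. (cmod (u n x - u' x))\<^sup>2 \<partial>M) * (\<integral>x. (cmod (v n x - v' x))\<^sup>2 \<partial>M)) \<longlonglongrightarrow> 0"
      using tendsto_mult[OF u v] by simp
    show "(\<lambda>n. (\<integral>x. (cmod (u n x - u' x))\<^sup>2 \<partial>M) * (\<integral>x. (cmod (v' x))\<^sup>2 \<partial>M)) \<longlonglongrightarrow> 0"
      using tendsto_mult[OF u tendsto_const] by simp
    show "(\<lambda>n. (\<integral>x. (cmod (u' x))\<^sup>2 \<partial>M) * (\<integral>x. (cmod (v n x - v' x))\<^sup>2 \<partial>M)) \<longlonglongrightarrow> 0"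
      using tendsto_mult[OF tendsto_const v] by simp
  qed (use d assms in auto)
  also have "(\<lambda>n. (\<integral>x. (u n x - u' x) * (v n x - v' x) \<partial>M) + (\<integral>x. (u n x - u' x) * v' x \<partial>M)
      + (\<integral>x. u' x * (v n x - v' x) \<partial>M) + (\<integral>x. u' x * v' x \<partial>M)) = (\<lambda>n. \<integral>x. u n x * v n x \<partial>M)"
  proof
    fix n
    note i = L2_mult(1)[OF d] L2_mult(1)[OF d(1) assms(4)] L2_mult(1)[OF assms(3) d(2)]
        L2_mult(1)[OF assms(3,4)]
    show "(\<integral>x. (u n x - u' x) * (v n x - v' x) \<partial>M) + (\<integral>x. (u n x - u' x) * v' x \<partial>M)
      + (\<integral>x. u' x * (v n x - v' x) \<partial>M) + (\<integral>x. u' x * v' x \<partial>M) = (\<integral>x. u n x * v n x \<partial>M)"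
      by (simp only: Bochner_Integration.integral_add[symmetric] i Bochner_Integration.integrable_add)
        (simp add: algebra_simps)
  qed
  finally show ?thesis by simp
qed

text \<open>Stands in for completeness of L2: the limit is always known pointwise beforehand, so
  only its norm has to be controlled. The bounds \<open>c n\<close> may vary because one application
  has the norm of a difference on the right.\<close>

lemma L2_Fatou:
  assumes "\<And>n::nat. L2 M (w n)" "w' \<in> borel_measurable M" "AE x in M. (\<lambda>n. w n x) \<longlonglongrightarrow> w' x"
    and b: "\<And>n. (\<integral>x. (cmod (w n x))\<^sup>2 \<partial>M) \<le> c n" and c: "c \<longlonglongrightarrow> C"
  shows "L2 M w'" "(\<integral>x. (cmod (w' x))\<^sup>2 \<partial>M) \<le> C"
proof -
  have [measurable]: "w n \<in> borel_measurable M" "w' \<in> borel_measurable M" for n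
    using assms by (auto simp: L2_def)
  have c0: "c n \<ge> 0" for n using b[of n] by (rule order_trans[rotated]) simp
  then have C0: "C \<ge> 0" by (intro LIMSEQ_le_const[OF c]) auto
  have "(\<integral>\<^sup>+x. ennreal ((cmod (w' x))\<^sup>2) \<partial>M) = (\<integral>\<^sup>+x. liminf (\<lambda>n. ennreal ((cmod (w n x))\<^sup>2)) \<partial>M)"
  proof (rule nn_integral_cong_AE)
    show "AE x in M. ennreal ((cmod (w' x))\<^sup>2) = liminf (\<lambda>n. ennreal ((cmod (w n x))\<^sup>2))"
      using assms(3)
    proof eventually_elim
      fix x assume "(\<lambda>n. w n x) \<longlonglongrightarrow> w' x"
      then have "(\<lambda>n. ennreal ((cmod (w n x))\<^sup>2)) \<longlonglongrightarrow> ennreal ((cmod (w' x))\<^sup>2)"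
        by (intro tendsto_ennrealI tendsto_intros)
      then show "ennreal ((cmod (w' x))\<^sup>2) = liminf (\<lambda>n. ennreal ((cmod (w n x))\<^sup>2))"
        by (intro lim_imp_Liminf[symmetric]) simp
    qed
  qed
  also have "\<dots> \<le> liminf (\<lambda>n. \<integral>\<^sup>+x. ennreal ((cmod (w n x))\<^sup>2) \<partial>M)"
    by (rule nn_integral_liminf) measurable
  also have "\<dots> \<le> liminf (\<lambda>n. ennreal (c n))"
  proof (rule Liminf_mono, rule always_eventually, rule allI)
    fix n show "(\<integral>\<^sup>+x. ennreal ((cmod (w n x))\<^sup>2) \<partial>M) \<le> ennreal (c n)"
      using assms(1)[of n] b[of n] by (simp add: nn_integral_eq_integral L2_def ennreal_leI)
  qed
  also have "\<dots> = ennreal C"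
    by (rule lim_imp_Liminf) (auto intro: tendsto_ennrealI c)
  finally have *: "(\<integral>\<^sup>+x. ennreal ((cmod (w' x))\<^sup>2) \<partial>M) \<le> ennreal C" .
  then have "integrable M (\<lambda>x. (cmod (w' x))\<^sup>2)"
    by (intro integrableI_bounded) (auto simp: less_top[symmetric] top_unique intro: le_less_trans)
  then show "L2 M w'" "(\<integral>x. (cmod (w' x))\<^sup>2 \<partial>M) \<le> C"
    using * C0 by (auto simp: L2_def nn_integral_eq_integral)
qed

section \<open>Gaussian integrals and the L2 bound for Fourier transforms\<close>

lemma borel_measurable_cis [measurable (raw)]:
  assumes "g \<in> borel_measurable M"
  shows "(\<lambda>x. cis (g x)) \<in> borel_measurable M"
proof -
  have [measurable]: "cis \<in> borel_measurable borel"
    by (intro borel_measurable_continuous_onI continuous_intros)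
  show ?thesis using assms by measurable
qed

text \<open>A rescaled form of the characteristic function of the standard normal
  distribution.\<close>

lemma gaussian_fourier:
  fixes e u :: real
  assumes "e > 0"
  shows "integrable lborel (\<lambda>x::real. exp (- e * x\<^sup>2 / 2) *\<^sub>R cis (u * x))"
    and "(\<integral>x. exp (- e * x\<^sup>2 / 2) *\<^sub>R cis (u * x) \<partial>lborel)
        = of_real (sqrt (2 * pi / e) * exp (- u\<^sup>2 / (2 * e)))"
proof -
  have i: "integrable lborel std_normal_density"
    by (intro integrable_normal_density) simp
  have i': "integrable lborel (\<lambda>x::real. std_normal_density x *\<^sub>R cis (t * x))" for t :: real
    by (rule Bochner_Integration.integrable_bound[OF i]) auto
  have c: "(\<integral>x. std_normal_density x *\<^sub>R cis (t * x) \<partial>lborel) = of_real (exp (- t\<^sup>2 / 2))" for t :: real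
  proof -
    have "(\<integral>x. std_normal_density x *\<^sub>R cis (t * x) \<partial>lborel)
        = (\<integral>x. cis (t * x) \<partial>density lborel std_normal_density)"
      by (intro integral_density[symmetric]) auto
    also have "\<dots> = char std_normal_distribution t"
      by (simp add: char_def cis_conv_exp)
    finally show ?thesis by (simp add: char_std_normal_distribution)
  qed
  \<comment> \<open>The summand 0 gives the argument the shape of an affine substitution with factor
    \<open>sqrt e\<close>.\<close>
  have eq: "exp (- e * x\<^sup>2 / 2) *\<^sub>R cis (u * x) =
      sqrt (2 * pi) *\<^sub>R (std_normal_density (0 + sqrt e * x) *\<^sub>R cis ((u / sqrt e)
          * (0 + sqrt e * x)))" for x
    using assms by (simp add: std_normal_density_def power_mult_distrib real_sqrt_mult)
  show "integrable lborel (\<lambda>x::real. exp (- e * x\<^sup>2 / 2) *\<^sub>R cis (u * x))"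
    unfolding eq by (intro integrable_scaleR_right lborel_integrable_real_affine[OF i'])
        (use assms in auto)
  have "(\<integral>x. exp (- e * x\<^sup>2 / 2) *\<^sub>R cis (u * x) \<partial>lborel) =
     sqrt (2 * pi) *\<^sub>R (\<integral>x. std_normal_density (0 + sqrt e * x) *\<^sub>R cis ((u / sqrt e)
         * (0 + sqrt e * x)) \<partial>lborel)"
    unfolding eq by (rule integral_scaleR_right)
  also have "(\<integral>x. std_normal_density (0 + sqrt e * x) *\<^sub>R cis ((u / sqrt e) * (0 + sqrt e * x)) \<partial>lborel)
     = (1 / sqrt e) *\<^sub>R (\<integral>x. std_normal_density x *\<^sub>R cis ((u / sqrt e) * x) \<partial>lborel)"
    using assms by (subst (2) lborel_integral_real_affine[where c="sqrt e" and t=0]) auto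
  finally show "(\<integral>x. exp (- e * x\<^sup>2 / 2) *\<^sub>R cis (u * x) \<partial>lborel)
      = of_real (sqrt (2 * pi / e) * exp (- u\<^sup>2 / (2 * e)))"
    unfolding c using assms
    by (simp add: real_sqrt_divide power_divide scaleR_conv_of_real)
qed

lemma gaussian_integral:
  fixes e :: real
  assumes e: "e > 0" and s: "s = 1 \<or> s = -1"
  shows "integrable lborel (\<lambda>x::real. exp (- e * (c + s * x)\<^sup>2 / 2))"
    and "(\<integral>x. exp (- e * (c + s * x)\<^sup>2 / 2) \<partial>lborel) = sqrt (2 * pi / e)"
proof -
  have 1: "integrable lborel (\<lambda>x::real. exp (- e * x\<^sup>2 / 2))"
    using integrable_norm[OF gaussian_fourier(1)[OF e, of 0]] by simp
  have "of_real (\<integral>x. exp (- e * x\<^sup>2 / 2) \<partial>lborel) = (of_real (sqrt (2 * pi / e)) :: complex)"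
    using gaussian_fourier(2)[OF e, of 0]
    by (simp add: scaleR_conv_of_real)
  then have 2: "(\<integral>x. exp (- e * x\<^sup>2 / 2) \<partial>lborel) = sqrt (2 * pi / e)"
    using of_real_eq_iff by blast
  show "integrable lborel (\<lambda>x::real. exp (- e * (c + s * x)\<^sup>2 / 2))"
    using lborel_integrable_real_affine[OF 1, of s c] s by auto
  show "(\<integral>x. exp (- e * (c + s * x)\<^sup>2 / 2) \<partial>lborel) = sqrt (2 * pi / e)"
    using lborel_integral_real_affine[of s "\<lambda>x. exp (- e * x\<^sup>2 / 2)" c] s 2 by auto
qed

lemma integrable_times_pair:
  fixes f :: "'a \<Rightarrow> complex" and g :: "'b \<Rightarrow> complex"
  assumes "sigma_finite_measure M" "sigma_finite_measure N" "integrable M f" "integrable N g"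
  shows "integrable (M \<Otimes>\<^sub>M N) (\<lambda>(x, y). f x * g y)"
proof -
  interpret pair_sigma_finite M N
    using assms by (simp add: pair_sigma_finite_def)
  have [measurable]: "f \<in> borel_measurable M" "g \<in> borel_measurable N"
    using assms by auto
  show ?thesis
    by (rule Fubini_integrable) (use assms in \<open>auto simp: norm_mult\<close>)
qed

lemma integrable_times_cis:
  assumes "integrable M f" "g \<in> borel_measurable M"
  shows "integrable M (\<lambda>x. f x * cis (g x))"
proof (rule Bochner_Integration.integrable_bound[OF assms(1)])
  have [measurable]: "f \<in> borel_measurable M" using assms by auto
  have [measurable]: "cis \<in> borel_measurable borel"
    by (intro borel_measurable_continuous_onI continuous_intros)
  show "(\<lambda>x. f x * cis (g x)) \<in> borel_measurable M" using assms(2) by measurable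
qed (simp add: norm_mult)

text \<open>The factor \<open>exp (- d * t\<^sup>2 / 2)\<close> makes the triple integral absolutely convergent; carrying out
  the \<open>t\<close>-integration first leaves a convolution with a Gaussian of mass \<open>2 * pi\<close>.\<close>

lemma fourier_L2_bound_regularised:
  fixes h :: "real \<Rightarrow> complex"
  assumes h: "integrable lborel h" "L2 lborel h" and s: "s = 1 \<or> s = -1" and d: "d > 0"
  shows "(\<integral>\<^sup>+t. ennreal ((cmod (\<integral>x. h x * cis (s * t * x) \<partial>lborel))\<^sup>2 * exp (- d * t\<^sup>2 / 2)) \<partial>lborel)
     \<le> ennreal (2 * pi * (\<integral>x. (cmod (h x))\<^sup>2 \<partial>lborel))"
proof -
  define H where "H t = (\<integral>x. h x * cis (s * t * x) \<partial>lborel)" for t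
  define P where "P = (\<lambda>(x, y). h x * cnj (h y))"
  have [measurable]: "h \<in> borel_measurable lborel" using h by auto
  have [measurable]: "H \<in> borel_measurable lborel" unfolding H_def by measurable
  have hc: "integrable lborel (\<lambda>x. cnj (h x))" using h(1) by simp
  have P: "integrable (lborel \<Otimes>\<^sub>M lborel) P"
    unfolding P_def by (rule integrable_times_pair) (use h hc lborel.sigma_finite_measure_axioms in
        auto)
  have [measurable]: "P \<in> borel_measurable (lborel \<Otimes>\<^sub>M lborel)" using P by auto
  have HH: "H t * cnj (H t) = (\<integral>p. P p * cis (s * t * (fst p - snd p)) \<partial>(lborel \<Otimes>\<^sub>M lborel))" for t
  proof -
    have i1: "integrable lborel (\<lambda>x. h x * cis (s * t * x))"
      by (intro integrable_times_cis h) simp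
    have i2: "integrable lborel (\<lambda>x. cnj (h x * cis (s * t * x)))" using i1
        by (simp del: complex_cnj_mult)
    have "(\<integral>p. P p * cis (s * t * (fst p - snd p)) \<partial>(lborel \<Otimes>\<^sub>M lborel))
      = (\<integral>p. (case p of (x, y) \<Rightarrow> (h x * cis (s * t * x)) * cnj (h y * cis (s * t * y)))
          \<partial>(lborel \<Otimes>\<^sub>M lborel))"
      by (intro Bochner_Integration.integral_cong) (auto simp: P_def cis_cnj cis_mult[symmetric]
          algebra_simps cis_divide[symmetric] divide_inverse)
    also have "\<dots> = (\<integral>x. \<integral>y. (h x * cis (s * t * x)) * cnj (h y * cis (s * t * y)) \<partial>lborel \<partial>lborel)"
      using lborel_pair.integral_fst'[OF integrable_times_pair[OF lborel.sigma_finite_measure_axioms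
        lborel.sigma_finite_measure_axioms i1 i2]] by simp
    also have "\<dots> = H t * cnj (H t)"
      using i2 by (simp add: H_def del: complex_cnj_mult)
    finally show ?thesis by simp
  qed
  have e1: "integrable lborel (\<lambda>t. of_real (exp (- d * t\<^sup>2 / 2)) :: complex)"
    using gaussian_integral(1)[OF d, of 1 0] by (simp)
  have sg: "sigma_finite_measure (lborel \<Otimes>\<^sub>M lborel :: (real \<times> real) measure)"
    by (simp add: lborel_prod lborel.sigma_finite_measure_axioms)
  interpret pp: pair_sigma_finite "lborel \<Otimes>\<^sub>M lborel :: (real \<times> real) measure" "lborel :: real measure"
    using sg by (simp add: pair_sigma_finite_def lborel.sigma_finite_measure_axioms)
  let ?Q = "\<lambda>p t. P p * cis (s * t * (fst p - snd p)) * of_real (exp (- d * t\<^sup>2 / 2))"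
  have Q: "integrable ((lborel \<Otimes>\<^sub>M lborel) \<Otimes>\<^sub>M lborel) (\<lambda>(p, t). ?Q p t)"
  proof -
    have "integrable ((lborel \<Otimes>\<^sub>M lborel) \<Otimes>\<^sub>M lborel)
        (\<lambda>z. (case z of (p, t) \<Rightarrow> P p * of_real (exp (- d * t\<^sup>2 / 2)))
        * cis (case z of (p, t) \<Rightarrow> s * t * (fst p - snd p)))"
      by (intro integrable_times_cis integrable_times_pair P e1 sg
          lborel.sigma_finite_measure_axioms) measurable
    also have "(\<lambda>z. (case z of (p, t) \<Rightarrow> P p * of_real (exp (- d * t\<^sup>2 / 2)))
        * cis (case z of (p, t) \<Rightarrow> s * t * (fst p - snd p))) = (\<lambda>(p, t). ?Q p t)"
      by (auto simp: fun_eq_iff)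
    finally show ?thesis .
  qed
  have int: "integrable lborel (\<lambda>t. H t * cnj (H t) * of_real (exp (- d * t\<^sup>2 / 2)))"
    using pp.integrable_snd[OF Q] by (simp add: HH)
  \<comment> \<open>The Fourier transform of the Gaussian in \<open>t\<close>: a bump of width
    \<open>sqrt d\<close> whose mass \<open>2 * pi\<close> does not depend on \<open>d\<close>,
    which makes the final bound uniform in \<open>d\<close>.\<close>
  define g where "g x y = sqrt (2 * pi / d) * exp (- (1 / d) * (x + (-1) * y)\<^sup>2 / 2)" for x y :: real
  have inner: "(\<integral>t. ?Q p t \<partial>lborel) = P p * of_real (g (fst p) (snd p))" for p
  proof -
    have "(\<integral>t. ?Q p t \<partial>lborel)
        = P p * (\<integral>t. exp (- d * t\<^sup>2 / 2) *\<^sub>R cis (s * (fst p - snd p) * t) \<partial>lborel)"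
      by (subst integral_mult_right_zero[symmetric]) (simp add: scaleR_conv_of_real mult_ac)
    also have "\<dots> = P p * of_real (sqrt (2 * pi / d) * exp (- (s * (fst p - snd p))\<^sup>2 / (2 * d)))"
      by (subst gaussian_fourier(2)[OF d]) simp
    also have "(s * (fst p - snd p))\<^sup>2 = (fst p - snd p)\<^sup>2" using s by (auto simp: power_mult_distrib)
    finally show ?thesis by (simp add: g_def mult_ac)
  qed
  have nng: "g x y \<ge> 0" for x y using d by (simp add: g_def)
  have [measurable]: "(\<lambda>p. g (fst p) (snd p)) \<in> borel_measurable (lborel \<Otimes>\<^sub>M lborel)"
    unfolding g_def by measurable
  have mass: "(\<integral>\<^sup>+y. ennreal (g x y) \<partial>lborel) = ennreal (2 * pi)" for x
  proof -
    have "(\<integral>\<^sup>+y. ennreal (g x y) \<partial>lborel) = ennreal (\<integral>y. g x y \<partial>lborel)"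
      unfolding g_def using d gaussian_integral(1)[of "1 / d" "-1" x] nng[unfolded g_def]
          by (intro nn_integral_eq_integral) auto
    also have "(\<integral>y. g x y \<partial>lborel) = sqrt (2 * pi / d) * sqrt (2 * pi * d)"
      unfolding g_def using d gaussian_integral(2)[of "1 / d" "-1" x] by simp
    also have "\<dots> = sqrt ((2 * pi)\<^sup>2)" using d by (simp add: real_sqrt_mult[symmetric] power2_eq_square)
    also have "\<dots> = 2 * pi" by (subst real_sqrt_abs) simp
    finally show ?thesis .
  qed
  have gsym: "g x y = g y x" for x y unfolding g_def by (simp add: power2_commute)
  have eh: "ennreal (1/2 * (a * b))
      = ennreal (1/2) * (ennreal a * ennreal b)" if "a \<ge> 0" "b \<ge> 0" for a b
    using that by (subst ennreal_mult, simp, simp, subst ennreal_mult) auto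
  have half: "ennreal (1/2) * X + ennreal (1/2) * X = X" for X
  proof -
    have "ennreal (1/2) * X + ennreal (1/2) * X = (ennreal (1/2) + ennreal (1/2)) * X"
      by (rule distrib_right[symmetric])
    also have "ennreal (1/2) + ennreal (1/2) = 1"
      by (subst ennreal_plus[symmetric]) auto
    finally show ?thesis by simp
  qed
  have [measurable]: "g x \<in> borel_measurable borel" "(\<lambda>x. g x y) \<in> borel_measurable borel" for x y
    unfolding g_def by measurable
  let ?N = "\<integral>\<^sup>+x. ennreal ((cmod (h x))\<^sup>2) \<partial>lborel"
  have N: "?N = ennreal (\<integral>x. (cmod (h x))\<^sup>2 \<partial>lborel)"
    using h(2) by (simp add: L2_def nn_integral_eq_integral)
  have nonneg: "ennreal ((cmod (H t))\<^sup>2 * exp (- d * t\<^sup>2 / 2))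
      = ennreal (cmod (H t * cnj (H t) * of_real (exp (- d * t\<^sup>2 / 2))))" for t
    by (simp add: norm_mult power2_eq_square)
  have "integrable lborel (\<lambda>t. (cmod (H t))\<^sup>2 * exp (- d * t\<^sup>2 / 2))"
    using integrable_norm[OF int] by (simp add: norm_mult power2_eq_square mult_ac)
  then have "(\<integral>\<^sup>+t. ennreal ((cmod (H t))\<^sup>2 * exp (- d * t\<^sup>2 / 2)) \<partial>lborel)
     = ennreal (\<integral>t. (cmod (H t))\<^sup>2 * exp (- d * t\<^sup>2 / 2) \<partial>lborel)"
    by (intro nn_integral_eq_integral) auto
  also have "(\<integral>t. (cmod (H t))\<^sup>2 * exp (- d * t\<^sup>2 / 2) \<partial>lborel)
      = cmod (of_real (\<integral>t. (cmod (H t))\<^sup>2 * exp (- d * t\<^sup>2 / 2) \<partial>lborel))"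
    by (simp add: integral_nonneg_AE)
  also have "of_real (\<integral>t. (cmod (H t))\<^sup>2 * exp (- d * t\<^sup>2 / 2) \<partial>lborel) =
      (\<integral>t. H t * cnj (H t) * of_real (exp (- d * t\<^sup>2 / 2)) \<partial>lborel)"
    by (subst integral_complex_of_real[symmetric], intro Bochner_Integration.integral_cong)
      (simp_all add: complex_norm_square[symmetric])
  also have "\<dots> = (\<integral>t. \<integral>p. ?Q p t \<partial>(lborel \<Otimes>\<^sub>M lborel) \<partial>lborel)"
    by (simp add: HH)
  also have "\<dots> = (\<integral>p. \<integral>t. ?Q p t \<partial>lborel \<partial>(lborel \<Otimes>\<^sub>M lborel))"
    by (rule pp.Fubini_integral[OF Q])
  also have "\<dots> = (\<integral>p. P p * of_real (g (fst p) (snd p)) \<partial>(lborel \<Otimes>\<^sub>M lborel))"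
    by (simp only: inner)
  also have "ennreal (cmod \<dots>)
      \<le> (\<integral>\<^sup>+p. ennreal (cmod (P p * of_real (g (fst p) (snd p)))) \<partial>(lborel \<Otimes>\<^sub>M lborel))"
    by (rule integral_norm_bound_ennreal) (use pp.integrable_fst[OF Q] in \<open>simp only: inner\<close>)
  also have "\<dots> \<le> (\<integral>\<^sup>+p. ennreal (1/2) * (ennreal ((cmod (h (fst p)))\<^sup>2) * ennreal (g (fst p) (snd p))) 
      + ennreal (1/2) * (ennreal ((cmod (h (snd p)))\<^sup>2) * ennreal (g (fst p) (snd p)))
          \<partial>(lborel \<Otimes>\<^sub>M lborel))"
  proof (rule nn_integral_mono)
    fix p :: "real \<times> real"
    \<comment> \<open>Schur test: the product is split by 2ab \<le> a^2 + b^2; in each half one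
      variable occurs only in the symmetric kernel \<open>g\<close> and integrates to
      \<open>2 * pi\<close>.\<close>
    have "cmod (h (fst p)) * cmod (h (snd p)) \<le> 1/2 * (cmod (h (fst p)))\<^sup>2 + 1/2 * (cmod (h (snd p)))\<^sup>2"
      using zero_le_power2[of "cmod (h (fst p)) - cmod (h (snd p))"] unfolding power2_diff by linarith
    then have "cmod (h (fst p)) * cmod (h (snd p)) * g (fst p) (snd p)
        \<le> (1/2 * (cmod (h (fst p)))\<^sup>2 + 1/2 * (cmod (h (snd p)))\<^sup>2) * g (fst p) (snd p)"
      using nng by (intro mult_right_mono) auto
    then have "cmod (P p * of_real (g (fst p) (snd p)))
        \<le> 1/2 * ((cmod (h (fst p)))\<^sup>2 * g (fst p) (snd p)) + 1/2
            * ((cmod (h (snd p)))\<^sup>2 * g (fst p) (snd p))"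
      using nng[of "fst p" "snd p"] by (cases p) (simp add: P_def norm_mult algebra_simps)
    then have "ennreal (cmod (P p * of_real (g (fst p) (snd p))))
        \<le> ennreal (1/2 * ((cmod (h (fst p)))\<^sup>2 * g (fst p) (snd p)) + 1/2
            * ((cmod (h (snd p)))\<^sup>2 * g (fst p) (snd p)))"
      by (rule ennreal_leI)
    also have "\<dots> = ennreal (1/2) * (ennreal ((cmod (h (fst p)))\<^sup>2) * ennreal (g (fst p) (snd p))) 
      + ennreal (1/2) * (ennreal ((cmod (h (snd p)))\<^sup>2) * ennreal (g (fst p) (snd p)))"
      using nng[of "fst p" "snd p"]
          by (subst ennreal_plus) (simp_all only: eh zero_le_power2 mult_nonneg_nonneg
              zero_le_divide_1_iff zero_le_numeral)
    finally show "ennreal (cmod (P p * of_real (g (fst p) (snd p)))) \<le> \<dots>" .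
  qed
  also have "\<dots> = ennreal (1/2) * (\<integral>\<^sup>+p. ennreal ((cmod (h (fst p)))\<^sup>2)
      * ennreal (g (fst p) (snd p)) \<partial>(lborel \<Otimes>\<^sub>M lborel))
      + ennreal (1/2) * (\<integral>\<^sup>+p. ennreal ((cmod (h (snd p)))\<^sup>2)
          * ennreal (g (fst p) (snd p)) \<partial>(lborel \<Otimes>\<^sub>M lborel))"
    by (subst nn_integral_add) (auto simp: nn_integral_cmult)
  also have "(\<integral>\<^sup>+p. ennreal ((cmod (h (fst p)))\<^sup>2)
      * ennreal (g (fst p) (snd p)) \<partial>(lborel \<Otimes>\<^sub>M lborel)) = ?N * ennreal (2 * pi)"
    by (subst lborel.nn_integral_fst[symmetric]) (auto simp: nn_integral_cmult mass nn_integral_multc)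
  also have "(\<integral>\<^sup>+p. ennreal ((cmod (h (snd p)))\<^sup>2)
      * ennreal (g (fst p) (snd p)) \<partial>(lborel \<Otimes>\<^sub>M lborel)) = ?N * ennreal (2 * pi)"
    by (subst lborel_pair.nn_integral_snd[symmetric]) (auto simp: nn_integral_cmult gsym[of _
        "_::real"] mass nn_integral_multc)
  also have "ennreal (1/2) * (?N * ennreal (2 * pi)) + ennreal (1/2) * (?N * ennreal (2 * pi))
      = ennreal (2 * pi * (\<integral>x. (cmod (h x))\<^sup>2 \<partial>lborel))"
    unfolding half N by (simp add: ennreal_mult'[symmetric] mult_ac)
  finally show ?thesis unfolding H_def .
qed

abbreviation gauss :: "nat \<Rightarrow> real \<Rightarrow> real" where
  "gauss n x \<equiv> exp (- (1 / real (Suc n)) * x\<^sup>2 / 2)"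

text \<open>Fatou removes the Gaussian from the regularised bound. Only this inequality half of
  Plancherel is established for integrable \<open>h\<close>; the limit arguments below are built on
  it.\<close>

lemma fourier_L2_bound:
  fixes h :: "real \<Rightarrow> complex"
  assumes h: "integrable lborel h" "L2 lborel h" and s: "s = 1 \<or> s = -1"
  shows "L2 lborel (\<lambda>t. \<integral>x. h x * cis (s * t * x) \<partial>lborel)"
    and "(\<integral>t. (cmod (\<integral>x. h x * cis (s * t * x) \<partial>lborel))\<^sup>2 \<partial>lborel)
        \<le> 2 * pi * (\<integral>x. (cmod (h x))\<^sup>2 \<partial>lborel)"
proof -
  define H where "H t = (\<integral>x. h x * cis (s * t * x) \<partial>lborel)" for t
  define C where "C = 2 * pi * (\<integral>x. (cmod (h x))\<^sup>2 \<partial>lborel)"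
  \<comment> \<open>The exponent is divided by 4 so that the square of \<open>w n\<close> carries
    exactly the factor \<open>gauss n\<close>.\<close>
  define w where "w n t = H t * of_real (exp (- (1 / real (Suc n)) * t\<^sup>2 / 4))" for n t
  have [measurable]: "h \<in> borel_measurable lborel" using h by auto
  have Hm[measurable]: "H \<in> borel_measurable lborel" unfolding H_def by measurable
  have wm[measurable]: "w n \<in> borel_measurable lborel" for n unfolding w_def by measurable
  have wsq: "(cmod (w n t))\<^sup>2 = (cmod (H t))\<^sup>2 * gauss n t" for n t
    by (simp add: w_def norm_mult power_mult_distrib exp_of_nat_mult[symmetric] field_simps del:
        of_nat_Suc)
  have b: "(\<integral>\<^sup>+t. ennreal ((cmod (w n t))\<^sup>2) \<partial>lborel) \<le> ennreal C" for n
    unfolding wsq H_def C_def by (rule fourier_L2_bound_regularised[OF h s]) simp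
  have C0: "C \<ge> 0" by (simp add: C_def)
  have i: "integrable lborel (\<lambda>t. (cmod (w n t))\<^sup>2)" for n
    using b[of n] by (intro integrableI_bounded) (auto intro: le_less_trans)
  have L: "L2 lborel (w n)" for n using i[of n] by (simp add: L2_def)
  have bb: "(\<integral>t. (cmod (w n t))\<^sup>2 \<partial>lborel) \<le> C" for n
    using b[of n] i[of n] C0 by (simp add: nn_integral_eq_integral)
  have lim: "(\<lambda>n. w n t) \<longlonglongrightarrow> H t" for t
  proof -
    have "(\<lambda>n. 1 / real (Suc n)) \<longlonglongrightarrow> 0"
      using LIMSEQ_inverse_real_of_nat by (simp add: inverse_eq_divide)
    then have "(\<lambda>n. w n t) \<longlonglongrightarrow> H t * of_real (exp (- 0 * t\<^sup>2 / 4))"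
      unfolding w_def by (intro tendsto_intros) auto
    then show ?thesis by simp
  qed
  show "L2 lborel (\<lambda>t. \<integral>x. h x * cis (s * t * x) \<partial>lborel)"
    "(\<integral>t. (cmod (\<integral>x. h x * cis (s * t * x) \<partial>lborel))\<^sup>2 \<partial>lborel) \<le> 2 * pi * (\<integral>x. (cmod (h x))\<^sup>2 \<partial>lborel)"
    using L2_Fatou[where w=w and w'=H and c="\<lambda>_. C" and C=C and M=lborel] L Hm lim bb
    by (simp_all add: H_def[symmetric] C_def[symmetric])
qed

text \<open>Continuity of the pairing, applied to \<open>v n\<close> and its conjugate.\<close>

lemma L2_tendsto_norm:
  assumes "\<And>n::nat. L2 M (v n)" "L2 M v'" and v: "(\<lambda>n. \<integral>x. (cmod (v n x - v' x))\<^sup>2 \<partial>M) \<longlonglongrightarrow> 0"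
  shows "(\<lambda>n. \<integral>x. (cmod (v n x))\<^sup>2 \<partial>M) \<longlonglongrightarrow> (\<integral>x. (cmod (v' x))\<^sup>2 \<partial>M)"
proof -
  have c: "L2 M (\<lambda>x. cnj (f x))" if "L2 M f" for f
    using that measurable_compose[of f M borel cnj borel]
    by (simp add: L2_def borel_measurable_continuous_onI continuous_intros)
  have e: "(\<integral>x. f x * cnj (f x) \<partial>M) = of_real (\<integral>x. (cmod (f x))\<^sup>2 \<partial>M)" for f
    by (subst integral_complex_of_real[symmetric], intro Bochner_Integration.integral_cong)
        (simp_all only: complex_norm_square)
  have "(\<lambda>n. \<integral>x. v n x * cnj (v n x) \<partial>M) \<longlonglongrightarrow> (\<integral>x. v' x * cnj (v' x) \<partial>M)"
    using assms by (intro L2_tendsto_integral_mult c) (simp_all flip: complex_cnj_diff)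
  then show ?thesis unfolding e by (simp only: tendsto_of_real_iff)
qed

text \<open>Extends the Fourier transform from integrable functions to an L2 limit. The limit of the
  transforms is not constructed but identified with a pointwise limit \<open>\<psi>\<close> known by
  other means; this is what later turns conditional convergence into L2 convergence.\<close>

lemma fourier_L2_limit:
  fixes \<phi> :: "nat \<Rightarrow> real \<Rightarrow> complex"
  assumes \<phi>: "\<And>n. integrable lborel (\<phi> n)" "\<And>n. L2 lborel (\<phi> n)" "L2 lborel \<phi>'"
    and l: "(\<lambda>n. \<integral>x. (cmod (\<phi> n x - \<phi>' x))\<^sup>2 \<partial>lborel) \<longlonglongrightarrow> 0"
    and s: "s = 1 \<or> s = -1"
    and \<psi>: "AE t in lborel. (\<lambda>n. \<integral>x. \<phi> n x * cis (s * t * x) \<partial>lborel)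
        \<longlonglongrightarrow> \<psi> t" "\<psi> \<in> borel_measurable lborel"
  shows "L2 lborel \<psi>"
    and "(\<lambda>n. \<integral>t. (cmod ((\<integral>x. \<phi> n x * cis (s * t * x) \<partial>lborel) - \<psi> t))\<^sup>2 \<partial>lborel) \<longlonglongrightarrow> 0"
proof -
  define T where "T h t = (\<integral>x. h x * cis (s * t * x) \<partial>lborel)" for h :: "real \<Rightarrow> complex" and t
  have TL: "L2 lborel (T (\<phi> n))" for n
    unfolding T_def by (rule fourier_L2_bound(1)[OF \<phi>(1,2) s])
  have Td: "T (\<lambda>x. \<phi> n x - \<phi> m x) t = T (\<phi> n) t - T (\<phi> m) t" for n m t
    unfolding T_def left_diff_distrib
    by (intro Bochner_Integration.integral_diff integrable_times_cis \<phi>) simp_all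
  have lm: "(\<lambda>m. \<integral>x. (cmod (\<phi> n x - \<phi> m x))\<^sup>2 \<partial>lborel) \<longlonglongrightarrow> (\<integral>x. (cmod (\<phi> n x - \<phi>' x))\<^sup>2 \<partial>lborel)" for n
    using l by (intro L2_tendsto_norm L2_diff \<phi>) (simp add: norm_minus_commute)
  have F: "L2 lborel (\<lambda>t. T (\<phi> n) t - \<psi> t)"
     "(\<integral>t. (cmod (T (\<phi> n) t - \<psi> t))\<^sup>2 \<partial>lborel) \<le> 2 * pi * (\<integral>x. (cmod (\<phi> n x - \<phi>' x))\<^sup>2 \<partial>lborel)" for n
  proof -
    have 1: "L2 lborel (\<lambda>t. T (\<phi> n) t - T (\<phi> m) t)" for m by (intro L2_diff TL)
    have [measurable]: "T (\<phi> n) \<in> borel_measurable lborel" "\<psi> \<in> borel_measurable lborel"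
        using TL[of n] \<psi> by (auto simp: L2_def)
    have 2: "(\<lambda>t. T (\<phi> n) t - \<psi> t) \<in> borel_measurable lborel" by measurable
    have 3: "AE t in lborel. (\<lambda>m. T (\<phi> n) t - T (\<phi> m) t) \<longlonglongrightarrow> T (\<phi> n) t - \<psi> t"
      using \<psi>(1) by eventually_elim (auto simp: T_def intro!: tendsto_intros)
    \<comment> \<open>The bound is applied to the difference of two approximants, which is
      integrable; then m tends to infinity with n fixed, and Fatou replaces the second transform by
      \<open>\<psi>\<close>.\<close>
    have 4: "(\<integral>t. (cmod (T (\<phi> n) t - T (\<phi> m) t))\<^sup>2 \<partial>lborel)
        \<le> 2 * pi * (\<integral>x. (cmod (\<phi> n x - \<phi> m x))\<^sup>2 \<partial>lborel)" for m
      unfolding Td[symmetric] unfolding T_def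
          by (intro fourier_L2_bound s L2_diff \<phi> Bochner_Integration.integrable_diff)
    show "L2 lborel (\<lambda>t. T (\<phi> n) t - \<psi> t)"
     "(\<integral>t. (cmod (T (\<phi> n) t - \<psi> t))\<^sup>2 \<partial>lborel) \<le> 2 * pi * (\<integral>x. (cmod (\<phi> n x - \<phi>' x))\<^sup>2 \<partial>lborel)"
      using L2_Fatou[OF 1 2 3 4 tendsto_mult[OF tendsto_const lm]] by auto
  qed
  show "L2 lborel \<psi>"
    using L2_diff[OF TL F(1), of 0 0] by simp
  show "(\<lambda>n. \<integral>t. (cmod ((\<integral>x. \<phi> n x * cis (s * t * x) \<partial>lborel) - \<psi> t))\<^sup>2 \<partial>lborel) \<longlonglongrightarrow> 0"
    unfolding T_def[symmetric]
    by (rule tendsto_sandwich[OF _ _ tendsto_const tendsto_mult_right_zero[OF l, of "2 * pi"]])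
      (auto intro!: always_eventually F(2))
qed

lemma L2_gauss_cutoff:
  fixes f :: "real \<Rightarrow> complex"
  assumes "L2 lborel f"
  shows "L2 lborel (\<lambda>x. f x * of_real (gauss n x))"
    and "(\<lambda>n. \<integral>x. (cmod (f x * of_real (gauss n x) - f x))\<^sup>2 \<partial>lborel) \<longlonglongrightarrow> 0"
proof -
  have [measurable]: "f \<in> borel_measurable lborel" using assms by (simp add: L2_def)
  have i: "integrable lborel (\<lambda>x. (cmod (f x))\<^sup>2)" using assms by (simp add: L2_def)
  have e: "gauss n x \<le> 1" for n x by simp
  show "L2 lborel (\<lambda>x. f x * of_real (gauss n x))"
    unfolding L2_def
  proof
    show "integrable lborel (\<lambda>x. (cmod (f x * of_real (gauss n x)))\<^sup>2)"
    proof (rule Bochner_Integration.integrable_bound[OF i])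
      show "AE x in lborel. norm ((cmod (f x * of_real (gauss n x)))\<^sup>2) \<le> norm ((cmod (f x))\<^sup>2)"
        using e by (auto intro!: AE_I2 power_mono mult_left_le simp: norm_mult)
    qed measurable
  qed measurable
  have z: "(\<lambda>n. 1 / real (Suc n)) \<longlonglongrightarrow> 0"
    using LIMSEQ_inverse_real_of_nat by (simp add: inverse_eq_divide)
  have "(\<lambda>n. \<integral>x. (cmod (f x * of_real (gauss n x) - f x))\<^sup>2 \<partial>lborel)
      \<longlonglongrightarrow> (\<integral>x. (cmod (f x * of_real (exp (- 0 * (x::real)\<^sup>2 / 2)) - f x))\<^sup>2 \<partial>lborel)"
  proof (rule integral_dominated_convergence[where w="\<lambda>x. (cmod (f x))\<^sup>2"])
    show "AE x in lborel. (\<lambda>n. (cmod (f x * of_real (gauss n x) - f x))\<^sup>2)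
        \<longlonglongrightarrow> (cmod (f x * of_real (exp (- 0 * x\<^sup>2 / 2)) - f x))\<^sup>2"
      by (intro AE_I2 tendsto_intros z) auto
    show "AE x in lborel. norm ((cmod (f x * of_real (gauss n x) - f x))\<^sup>2) \<le> (cmod (f x))\<^sup>2" for n
    proof (rule AE_I2)
      fix x
      have "cmod (f x * of_real (gauss n x) - f x) = cmod (f x * of_real (gauss n x - 1))"
        by (simp add: algebra_simps)
      also have "\<dots> = cmod (f x) * \<bar>gauss n x - 1\<bar>"
        unfolding norm_mult norm_of_real by simp
      also have "\<dots> \<le> cmod (f x)"
      proof (rule mult_left_le)
        have "gauss n x \<ge> 0" by (rule exp_ge_zero)
        then show "\<bar>gauss n x - 1\<bar> \<le> 1" using e[of n x] by (intro abs_leI) linarith+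
      qed simp
      finally show "norm ((cmod (f x * of_real (gauss n x) - f x))\<^sup>2) \<le> (cmod (f x))\<^sup>2"
        by (simp add: power_mono)
    qed
  qed (use i in measurable)
  then show "(\<lambda>n. \<integral>x. (cmod (f x * of_real (gauss n x) - f x))\<^sup>2 \<partial>lborel) \<longlonglongrightarrow> 0"
    by simp
qed

section \<open>Conditionally convergent Fourier integrals with square integrable value\<close>

text \<open>Nothing is assumed at x = 0, which corresponds to the circle |z| = 1. The majorant
  \<open>D\<close> of the partial integrals may be singular there and may grow like exp |x|, so its
  integrability is required only against Gaussians.\<close>

locale improper_fourier =
  fixes f J :: "real \<Rightarrow> complex" and D :: "real \<Rightarrow> real" and B :: real
  assumes cont: "continuous_on UNIV f"
    and bound: "cmod (f t) \<le> B"
    and lim: "x \<noteq> 0 \<Longrightarrow> ((\<lambda>T. \<integral>t. indicator {-T..T} t *\<^sub>R (f t * cis (- (t * x))) \<partial>lborel) \<longlongrightarrow> J x) at_top"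
    and dom: "x \<noteq> 0 \<Longrightarrow> T \<ge> 0 \<Longrightarrow> cmod (\<integral>t. indicator {-T..T} t *\<^sub>R (f t * cis (- (t * x))) \<partial>lborel) \<le> D x"
    and D_int: "e > 0 \<Longrightarrow> integrable lborel (\<lambda>x. D x * exp (- e * x\<^sup>2 / 2))"
    and L2J: "L2 lborel J"
begin

definition I where "I T x = (\<integral>t. indicator {-T..T} t *\<^sub>R (f t * cis (- (t * x))) \<partial>lborel)"

lemma f_meas [measurable]: "f \<in> borel_measurable borel"
  by (rule borel_measurable_continuous_onI[OF cont])

lemma J_meas [measurable]: "J \<in> borel_measurable borel"
  using L2J by (simp add: L2_def)

lemma integrable_f_ind: "integrable lborel (\<lambda>t. indicator {-T..T} t *\<^sub>R f t)"
proof (rule Bochner_Integration.integrable_bound)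
  show "integrable lborel (\<lambda>t. indicator {-T..T} t * B)"
    by (intro integrable_mult_left integrable_real_indicator) (auto simp: emeasure_lborel_Icc_eq)
  show "AE t in lborel. norm (indicator {-T..T} t *\<^sub>R f t) \<le> norm (indicator {-T..T} t * B)"
    using bound by (auto simp: indicator_def intro!: AE_I2 order_trans[OF bound])
qed measurable

lemma AE_nz: "AE x::real in lborel. x \<noteq> 0"
  by (rule AE_lborel_singleton)

lemma J_dom: "x \<noteq> 0 \<Longrightarrow> cmod (J x) \<le> D x"
  by (rule tendsto_upperbound[OF tendsto_norm[OF lim]])
    (auto intro!: eventually_mono[OF eventually_ge_at_top[of 0]] dom)

lemma J_gauss_integrable:
  assumes "e > 0"
  shows "integrable lborel (\<lambda>x. J x * of_real (exp (- e * x\<^sup>2 / 2)))"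
proof (rule Bochner_Integration.integrable_bound[OF D_int[OF assms]])
  show "AE x in lborel. norm (J x * of_real (exp (- e * x\<^sup>2 / 2))) \<le> norm (D x * exp (- e * x\<^sup>2 / 2))"
    using AE_nz
  proof eventually_elim
    fix x :: real assume "x \<noteq> 0"
    from J_dom[OF this] show "norm (J x * of_real (exp (- e * x\<^sup>2 / 2)))
        \<le> norm (D x * exp (- e * x\<^sup>2 / 2))"
      by (auto simp: norm_mult abs_mult intro!: mult_right_mono)
  qed
qed measurable

lemma f_gauss_integrable:
  assumes "e > 0" "b = 1 \<or> b = -1"
  shows "integrable lborel (\<lambda>u. f (c + r * u) * of_real (exp (- e * (a + b * u)\<^sup>2 / 2)))"
proof (rule Bochner_Integration.integrable_bound)
  show "integrable lborel (\<lambda>u. B * exp (- e * (a + b * u)\<^sup>2 / 2))"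
    by (intro integrable_mult_right gaussian_integral assms)
  show "AE u in lborel. norm (f (c + r * u) * of_real (exp (- e * (a + b * u)\<^sup>2 / 2)))
      \<le> norm (B * exp (- e * (a + b * u)\<^sup>2 / 2))"
    by (auto intro!: AE_I2 mult_right_mono order_trans[OF bound] simp: norm_mult abs_mult)
qed measurable

text \<open>Fourier inversion with a Gaussian summation factor: the right side is a Gaussian average
  of \<open>f\<close> around \<open>t\<close> of width \<open>sqrt e\<close>. The majorant
  \<open>D\<close> allows \<open>J\<close> to be replaced by its partial integrals, for which Fubini
  applies.\<close>

lemma fourier_J_gauss:
  assumes e: "e > 0"
  shows "(\<integral>x. (J x * of_real (exp (- e * x\<^sup>2 / 2))) * cis (t * x) \<partial>lborel)
       = (\<integral>u. f (t + u / sqrt (1 / e)) * of_real (sqrt (2 * pi) * exp (- u\<^sup>2 / 2)) \<partial>lborel)"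
proof -
  let ?g = "\<lambda>x. exp (- e * x\<^sup>2 / 2)"
  have "(\<lambda>n. \<integral>x. (I (real n) x * of_real (?g x)) * cis (t * x) \<partial>lborel)
      \<longlonglongrightarrow> (\<integral>x. (J x * of_real (?g x)) * cis (t * x) \<partial>lborel)"
  proof (rule integral_dominated_convergence[where w="\<lambda>x. D x * ?g x"])
    show "integrable lborel (\<lambda>x. D x * ?g x)" by (rule D_int[OF e])
    show "(\<lambda>x. (I (real n) x * of_real (?g x)) * cis (t * x)) \<in> borel_measurable lborel" for n
      unfolding I_def by measurable
    show "AE x in lborel. (\<lambda>n. (I (real n) x * of_real (?g x)) * cis (t * x))
        \<longlonglongrightarrow> (J x * of_real (?g x)) * cis (t * x)"
      using AE_nz
    proof eventually_elim
      fix x :: real assume "x \<noteq> 0"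
      from filterlim_compose[OF lim[OF this] filterlim_real_sequentially]
      show "(\<lambda>n. (I (real n) x * of_real (?g x)) * cis (t * x)) \<longlonglongrightarrow> (J x * of_real (?g x)) * cis (t * x)"
        unfolding I_def by (intro tendsto_mult tendsto_const)
    qed
    show "AE x in lborel. norm ((I (real n) x * of_real (?g x)) * cis (t * x)) \<le> D x * ?g x" for n
      using AE_nz
      by eventually_elim (auto simp: I_def norm_mult intro!: mult_right_mono dom)
  qed measurable
  moreover have "(\<integral>x. (I (real n) x * of_real (?g x)) * cis (t * x) \<partial>lborel)
      = (\<integral>u. indicator {-real n..real n} u *\<^sub>R (f u
          * of_real (sqrt (2 * pi / e) * exp (- (t - u)\<^sup>2 / (2 * e)))) \<partial>lborel)" for n
  proof -
    \<comment> \<open>With \<open>u\<close> confined to a bounded interval and a Gaussian in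
      \<open>x\<close>, the integrand is absolutely integrable in both variables.\<close>
    let ?Q = "\<lambda>x u. (indicator {-real n..real n} u *\<^sub>R f u) * of_real (?g x) * cis ((t - u) * x)"
    have Q: "integrable (lborel \<Otimes>\<^sub>M lborel) (\<lambda>(x, u). ?Q x u)"
    proof -
      have "integrable (lborel \<Otimes>\<^sub>M lborel) (\<lambda>z. (case z of (x, u) \<Rightarrow> of_real (?g x)
          * (indicator {-real n..real n} u *\<^sub>R f u))
          * cis ((t - snd z) * fst z))"
        using gaussian_integral(1)[OF e, of 1 0] integrable_f_ind
        by (intro integrable_times_cis integrable_times_pair lborel.sigma_finite_measure_axioms)
            simp_all
      also have "(\<lambda>z. (case z of (x, u) \<Rightarrow> of_real (?g x) * (indicator {-real n..real n} u *\<^sub>R f u))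
          * cis ((t - snd z) * fst z)) = (\<lambda>(x, u). ?Q x u)"
        by (auto simp: fun_eq_iff)
      finally show ?thesis .
    qed
    have "(\<integral>x. (I (real n) x * of_real (?g x)) * cis (t * x) \<partial>lborel)
        = (\<integral>x. \<integral>u. ?Q x u \<partial>lborel \<partial>lborel)"
    proof (intro Bochner_Integration.integral_cong refl)
      fix x :: real
      have "(I (real n) x * of_real (?g x)) * cis (t * x)
          = (\<integral>u. indicator {-real n..real n} u *\<^sub>R (f u * cis (- (u * x)))
              * (of_real (?g x) * cis (t * x)) \<partial>lborel)"
        unfolding I_def by (subst integral_mult_left_zero) (simp add: mult_ac)
      also have "\<dots> = (\<integral>u. ?Q x u \<partial>lborel)"
      proof (intro Bochner_Integration.integral_cong refl)
        fix u
        have "cis ((t - u) * x) = cis (- (u * x)) * cis (t * x)" by (simp add: cis_mult algebra_simps)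
        then show "indicator {-real n..real n} u *\<^sub>R (f u * cis (- (u * x)))
            * (of_real (?g x) * cis (t * x)) = ?Q x u"
          by (simp add: mult_ac)
      qed
      finally show "(I (real n) x * of_real (?g x)) * cis (t * x) = (\<integral>u. ?Q x u \<partial>lborel)" .
    qed
    also have "\<dots> = (\<integral>u. \<integral>x. ?Q x u \<partial>lborel \<partial>lborel)"
      by (rule lborel_pair.Fubini_integral[OF Q, symmetric])
    also have "\<dots> = (\<integral>u. indicator {-real n..real n} u *\<^sub>R (f u
        * of_real (sqrt (2 * pi / e) * exp (- (t - u)\<^sup>2 / (2 * e)))) \<partial>lborel)"
    proof (intro Bochner_Integration.integral_cong refl)
      fix u :: real
      have "(\<integral>x. ?Q x u \<partial>lborel) = (indicator {-real n..real n} u *\<^sub>R f u)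
          * (\<integral>x. ?g x *\<^sub>R cis ((t - u) * x) \<partial>lborel)"
        by (subst integral_mult_right_zero[symmetric]) (simp add: scaleR_conv_of_real mult_ac)
      then show "(\<integral>x. ?Q x u \<partial>lborel)
          = indicator {-real n..real n} u *\<^sub>R (f u
              * of_real (sqrt (2 * pi / e) * exp (- (t - u)\<^sup>2 / (2 * e))))"
        by (simp only: gaussian_fourier(2)[OF e] mult_scaleR_left)
    qed
    finally show ?thesis .
  qed
  moreover have "(\<lambda>n. \<integral>u. indicator {-real n..real n} u *\<^sub>R (f u
      * of_real (sqrt (2 * pi / e) * exp (- (t - u)\<^sup>2 / (2 * e)))) \<partial>lborel)
     \<longlonglongrightarrow> (\<integral>u. f u * of_real (sqrt (2 * pi / e) * exp (- (t - u)\<^sup>2 / (2 * e))) \<partial>lborel)"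
  proof (rule integral_dominated_convergence[where w="\<lambda>u. cmod (f u
      * of_real (sqrt (2 * pi / e) * exp (- (t - u)\<^sup>2 / (2 * e))))"])
    have "integrable lborel (\<lambda>u. of_real (sqrt (2 * pi / e))
        * (f (0 + 1 * u) * of_real (exp (- (1 / e) * (t + (-1) * u)\<^sup>2 / 2))))"
      using e by (intro integrable_mult_right f_gauss_integrable) auto
    then show "integrable lborel
        (\<lambda>u. cmod (f u * of_real (sqrt (2 * pi / e) * exp (- (t - u)\<^sup>2 / (2 * e)))))"
      by (intro integrable_norm) (simp add: mult_ac)
    show "AE u in lborel. (\<lambda>n. indicator {-real n..real n} u *\<^sub>R (f u
        * of_real (sqrt (2 * pi / e) * exp (- (t - u)\<^sup>2 / (2 * e)))))
       \<longlonglongrightarrow> f u * of_real (sqrt (2 * pi / e) * exp (- (t - u)\<^sup>2 / (2 * e)))"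
    proof (rule AE_I2, rule tendsto_eventually)
      fix u :: real
      show "\<forall>\<^sub>F n in sequentially. indicator {-real n..real n} u *\<^sub>R (f u
          * of_real (sqrt (2 * pi / e) * exp (- (t - u)\<^sup>2 / (2 * e))))
         = f u * of_real (sqrt (2 * pi / e) * exp (- (t - u)\<^sup>2 / (2 * e)))"
        using eventually_ge_at_top[of "nat \<lceil>\<bar>u\<bar>\<rceil>"]
        by eventually_elim (auto simp: indicator_def abs_le_iff nat_le_iff ceiling_le_iff)
    qed
    show "AE u in lborel. norm (indicator {-real n..real n} u *\<^sub>R (f u
        * of_real (sqrt (2 * pi / e) * exp (- (t - u)\<^sup>2 / (2 * e)))))
       \<le> cmod (f u * of_real (sqrt (2 * pi / e) * exp (- (t - u)\<^sup>2 / (2 * e))))" for n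
      by (auto intro!: AE_I2 simp: indicator_def)
  qed measurable
  ultimately have "(\<integral>x. (J x * of_real (?g x)) * cis (t * x) \<partial>lborel)
     = (\<integral>u. f u * of_real (sqrt (2 * pi / e) * exp (- (t - u)\<^sup>2 / (2 * e))) \<partial>lborel)"
    by (simp add: LIMSEQ_unique)
  \<comment> \<open>Rescaling moves \<open>e\<close> from the weight into the argument of
    \<open>f\<close>, so that the limit for small \<open>e\<close> can be taken under one fixed
    Gaussian weight.\<close>
  also have "\<dots> = sqrt e *\<^sub>R (\<integral>u. f (t + sqrt e * u)
      * of_real (sqrt (2 * pi / e) * exp (- (t - (t + sqrt e * u))\<^sup>2 / (2 * e))) \<partial>lborel)"
    using e by (subst lborel_integral_real_affine[where c="sqrt e" and t=t]) auto
  also have "\<dots> = (\<integral>u. f (t + u / sqrt (1 / e)) * of_real (sqrt (2 * pi) * exp (- u\<^sup>2 / 2)) \<partial>lborel)"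
    unfolding integral_scaleR_right[symmetric]
    using e by (intro Bochner_Integration.integral_cong)
       (auto simp: scaleR_conv_of_real real_sqrt_divide power_mult_distrib mult.commute[of _ "sqrt e"])
  finally show ?thesis .
qed

text \<open>The Gaussian averages form an approximate identity: continuity of \<open>f\<close> gives
  the pointwise limit and the bound \<open>B\<close> the majorant.\<close>

lemma fourier_J_gauss_tendsto:
  "(\<lambda>n. \<integral>x. (J x * of_real (gauss n x)) * cis (t * x) \<partial>lborel) \<longlonglongrightarrow> of_real (2 * pi) * f t"
proof -
  have "(\<lambda>n. \<integral>u. f (t + u / sqrt (1 / (1 / real (Suc n))))
      * of_real (sqrt (2 * pi) * exp (- u\<^sup>2 / 2)) \<partial>lborel)
     \<longlonglongrightarrow> (\<integral>u. f t * of_real (sqrt (2 * pi) * exp (- u\<^sup>2 / 2)) \<partial>lborel)"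
  proof (rule integral_dominated_convergence[where w="\<lambda>u. B * (sqrt (2 * pi) * exp (- u\<^sup>2 / 2))"])
    show "integrable lborel (\<lambda>u. B * (sqrt (2 * pi) * exp (- u\<^sup>2 / 2)))"
      using gaussian_integral(1)[of 1 1 0] by (intro integrable_mult_right) simp
    show "AE u in lborel. (\<lambda>n. f (t + u / sqrt (1 / (1 / real (Suc n))))
        * of_real (sqrt (2 * pi) * exp (- u\<^sup>2 / 2)))
       \<longlonglongrightarrow> f t * of_real (sqrt (2 * pi) * exp (- u\<^sup>2 / 2))"
    proof (intro AE_I2 tendsto_mult tendsto_const)
      fix u :: real
      have c: "isCont f t" using cont by (simp add: continuous_on_eq_continuous_at)
      have "filterlim (\<lambda>n. sqrt (real (Suc n))) at_top sequentially"
        by (rule filterlim_compose[OF sqrt_at_top])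
            (rule filterlim_compose[OF filterlim_real_sequentially filterlim_Suc])
      then have "(\<lambda>n. u / sqrt (real (Suc n))) \<longlonglongrightarrow> 0"
        by (intro tendsto_divide_0[OF tendsto_const] filterlim_at_top_imp_at_infinity)
      then have "(\<lambda>n. t + u / sqrt (real (Suc n))) \<longlonglongrightarrow> t + 0"
        by (intro tendsto_add tendsto_const)
      then show "(\<lambda>n. f (t + u / sqrt (1 / (1 / real (Suc n))))) \<longlonglongrightarrow> f t"
        using isCont_tendsto_compose[OF c] by simp
    qed
    show "AE u in lborel. norm (f (t + u / sqrt (1 / (1 / real (Suc n))))
        * of_real (sqrt (2 * pi) * exp (- u\<^sup>2 / 2)))
       \<le> B * (sqrt (2 * pi) * exp (- u\<^sup>2 / 2))" for n
      by (auto intro!: AE_I2 mult_right_mono bound simp: norm_mult abs_mult)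
  qed measurable
  also have "(\<integral>u. f t * of_real (sqrt (2 * pi) * exp (- (u::real)\<^sup>2 / 2)) \<partial>lborel)
      = f t * of_real (2 * pi)"
    using gaussian_integral(2)[of 1 1 0] by (simp add: integral_mult_right_zero flip: of_real_mult)
  finally show ?thesis
    by (subst fourier_J_gauss) (auto simp: mult_ac)
qed

text \<open>Square integrability passes from \<open>J\<close> to \<open>f\<close>: the functions
  \<open>J * gauss n\<close> converge to \<open>J\<close> in L2, and their transforms converge
  pointwise to \<open>2 * pi * f\<close>. No decay of \<open>f\<close> enters.\<close>

lemma L2_f: "L2 lborel f"
  and J_gauss_L2_limit: "(\<lambda>n. \<integral>t. (cmod ((\<integral>x. (J x * of_real (gauss n x)) * cis (t * x) \<partial>lborel)
       - of_real (2 * pi) * f t))\<^sup>2 \<partial>lborel) \<longlonglongrightarrow> 0"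
proof -
  have pos: "1 / real (Suc n) > 0" for n by simp
  note * = fourier_L2_limit[where \<phi>="\<lambda>n x. J x * of_real (gauss n x)" and \<phi>'=J and s=1
      and \<psi>="\<lambda>t. of_real (2 * pi) * f t", OF J_gauss_integrable[OF pos] L2_gauss_cutoff(1)[OF L2J]
          L2J L2_gauss_cutoff(2)[OF L2J]
        _ AE_I2]
  show "L2 lborel f"
    using L2_cmult[OF *(1), of "of_real (1 / (2 * pi))"] fourier_J_gauss_tendsto by simp
  show "(\<lambda>n. \<integral>t. (cmod ((\<integral>x. (J x * of_real (gauss n x)) * cis (t * x) \<partial>lborel)
       - of_real (2 * pi) * f t))\<^sup>2 \<partial>lborel) \<longlonglongrightarrow> 0"
    using *(2) fourier_J_gauss_tendsto by simp
qed

text \<open>The weight of the averaging argument below; for \<open>a = 0\<close> it shows that the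
  total mass is 1.\<close>

lemma has_bochner_integral_gauss_tail:
  fixes a :: real
  assumes "a \<ge> 0"
  shows "has_bochner_integral lborel (\<lambda>u. indicator {a..} u * (u * exp (- u\<^sup>2 / 2))) (exp (- a\<^sup>2 / 2))"
proof (rule has_bochner_integral_nn_integral)
  have "(\<integral>\<^sup>+x\<in>{a..}. ennreal (x * exp (- x\<^sup>2 / 2)) \<partial>lborel) = ennreal (0 - (- exp (- a\<^sup>2 / 2)))"
  proof (rule nn_integral_FTC_atLeast)
    show "((\<lambda>x. - exp (- x\<^sup>2 / 2)) has_real_derivative x * exp (- x\<^sup>2 / 2)) (at x)" for x :: real
      by (auto intro!: derivative_eq_intros)
    show "((\<lambda>x::real. - exp (- x\<^sup>2 / 2)) \<longlongrightarrow> 0) at_top"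
      by real_asymp
  qed (use assms in auto)
  also have "(\<integral>\<^sup>+x\<in>{a..}. ennreal (x * exp (- x\<^sup>2 / 2)) \<partial>lborel)
      = (\<integral>\<^sup>+x. ennreal (indicator {a..} x * (x * exp (- x\<^sup>2 / 2))) \<partial>lborel)"
    by (intro nn_integral_cong) (auto simp: indicator_def)
  finally show "(\<integral>\<^sup>+x. ennreal (indicator {a..} x * (x * exp (- x\<^sup>2 / 2))) \<partial>lborel)
      = ennreal (exp (- a\<^sup>2 / 2))"
    by simp
qed (use assms in \<open>auto simp: indicator_def\<close>)

text \<open>Abel summation: the Gaussian cutoff is an average of sharp cutoffs, since
  \<open>exp (- e * t\<^sup>2 / 2)\<close> is the integral of \<open>u * exp (- u\<^sup>2 / 2)\<close> over \<open>u \<ge> \<bar>t\<bar> * sqrt e\<close>.\<close>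

lemma gauss_cutoff_eq_average:
  assumes e: "e > 0"
  shows "(\<integral>t. (f t * of_real (exp (- e * t\<^sup>2 / 2))) * cis (- (t * x)) \<partial>lborel)
    = (\<integral>u. of_real (indicator {0..} u * (u * exp (- u\<^sup>2 / 2))) * I (u / sqrt e) x \<partial>lborel)"
proof -
  define Q where "Q t u = (f t * cis (- (t * x))) * of_real (indicator {\<bar>t\<bar> * sqrt e..} u
      * (u * exp (- u\<^sup>2 / 2)))" for t u
  note tail = has_bochner_integral_gauss_tail[of "\<bar>t\<bar> * sqrt e" for t]
  have sq: "(\<bar>t\<bar> * sqrt e)\<^sup>2 = e * t\<^sup>2" for t using e by (simp add: power_mult_distrib)
  have Q_int: "has_bochner_integral lborel (Q t) (f t * cis (- (t * x))
      * of_real (exp (- (e * t\<^sup>2) / 2)))" for t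
    unfolding Q_def using tail[of t] e unfolding sq
    by (intro has_bochner_integral_mult_right has_bochner_integral_of_real) simp
  have [measurable]: "Measurable.pred (borel \<Otimes>\<^sub>M borel) (\<lambda>x. snd x \<in> {\<bar>fst x\<bar> * sqrt e..})"
    unfolding atLeast_iff by measurable
  have Qm: "(\<lambda>(t, u). Q t u) \<in> borel_measurable (lborel \<Otimes>\<^sub>M lborel)"
    unfolding Q_def by measurable
  have Q: "integrable (lborel \<Otimes>\<^sub>M lborel) (\<lambda>(t, u). Q t u)"
  proof (rule lborel_pair.Fubini_integrable[OF Qm])
    have "(\<integral>u. norm (Q t u) \<partial>lborel) = cmod (f t * of_real (exp (- e * (0 + 1 * t)\<^sup>2 / 2)))" for t
    proof -
      have "(\<integral>u. norm (Q t u) \<partial>lborel)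
          = (\<integral>u. cmod (f t) * (indicator {\<bar>t\<bar> * sqrt e..} u * (u * exp (- u\<^sup>2 / 2))) \<partial>lborel)"
      proof (intro Bochner_Integration.integral_cong refl)
        fix u :: real
        have "indicator {\<bar>t\<bar> * sqrt e..} u * (u * exp (- u\<^sup>2 / 2)) \<ge> (0 :: real)"
          using e order_trans[of 0 "\<bar>t\<bar> * sqrt e" u] by (auto simp: indicator_def)
        then show "norm (Q t u) = cmod (f t) * (indicator {\<bar>t\<bar> * sqrt e..} u * (u * exp (- u\<^sup>2 / 2)))"
          unfolding Q_def norm_mult norm_of_real by simp
      qed
      also have "\<dots> = cmod (f t) * exp (- (e * t\<^sup>2) / 2)"
        using tail[of t] e unfolding sq by (simp add: has_bochner_integral_integral_eq)
      finally show ?thesis by (simp add: norm_mult)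
    qed
    then show "integrable lborel (\<lambda>t. \<integral>u. norm (case (t, u) of (t, u) \<Rightarrow> Q t u) \<partial>lborel)"
      using integrable_norm[OF f_gauss_integrable[OF e, of 1 0 1 0]] by simp
    show "AE t in lborel. integrable lborel (\<lambda>u. case (t, u) of (t, u) \<Rightarrow> Q t u)"
      using Q_int by (auto intro!: AE_I2 simp: has_bochner_integral_iff)
  qed
  have "(\<integral>t. (f t * of_real (exp (- e * t\<^sup>2 / 2))) * cis (- (t * x)) \<partial>lborel)
      = (\<integral>t. \<integral>u. Q t u \<partial>lborel \<partial>lborel)"
    using Q_int by (intro Bochner_Integration.integral_cong) (auto simp: has_bochner_integral_iff)
  also have "\<dots> = (\<integral>u. \<integral>t. Q t u \<partial>lborel \<partial>lborel)"
    by (rule lborel_pair.Fubini_integral[OF Q, symmetric])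
  also have "\<dots> = (\<integral>u. of_real (indicator {0..} u * (u * exp (- u\<^sup>2 / 2))) * I (u / sqrt e) x \<partial>lborel)"
  proof (intro Bochner_Integration.integral_cong refl)
    fix u :: real
    have "Q t u = of_real (indicator {0..} u * (u * exp (- u\<^sup>2 / 2)))
        * (indicator {-(u / sqrt e)..u / sqrt e} t *\<^sub>R (f t * cis (- (t * x))))" for t
    proof -
      have "indicator {\<bar>t\<bar> * sqrt e..} u
          = (indicator {0..} u * indicator {-(u / sqrt e)..u / sqrt e} t :: real)"
      proof -
        have "\<bar>t\<bar> * sqrt e \<le> u \<longleftrightarrow> \<bar>t\<bar> \<le> u / sqrt e" using e by (simp add: pos_le_divide_eq)
        also have "\<dots> \<longleftrightarrow> - (u / sqrt e) \<le> t \<and> t \<le> u / sqrt e" by (simp add: abs_le_iff) linarith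
        finally show ?thesis
          using e order_trans[of 0 "\<bar>t\<bar> * sqrt e" u] by (auto simp: indicator_def)
      qed
      then show ?thesis by (simp add: Q_def scaleR_conv_of_real)
    qed
    then show "(\<integral>t. Q t u \<partial>lborel) = of_real (indicator {0..} u * (u * exp (- u\<^sup>2 / 2)))
        * I (u / sqrt e) x"
      unfolding I_def by (simp only: integral_mult_right_zero)
  qed
  finally show ?thesis .
qed

text \<open>In the average over sharp cutoffs \<open>I (u / sqrt e) x\<close>, the radius tends to
  infinity for every u > 0 as \<open>e\<close> tends to 0, so each cutoff integral tends to
  \<open>J x\<close>, dominated by \<open>D x\<close>. Gaussian summation thus finds the value of
  the improper integral.\<close>

lemma gauss_cutoff_tendsto:
  assumes x: "x \<noteq> 0"
  shows "(\<lambda>n. \<integral>t. (f t * of_real (gauss n t)) * cis (- (t * x)) \<partial>lborel) \<longlonglongrightarrow> J x"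
proof -
  note tail = has_bochner_integral_gauss_tail[of 0]
  let ?k = "\<lambda>u::real. indicator {0..} u * (u * exp (- u\<^sup>2 / 2))"
  have k0: "?k u \<ge> 0" for u by (auto simp: indicator_def)
  have [measurable]: "(\<lambda>u. I (u / c) x) \<in> borel_measurable borel" for c
  proof -
    have [measurable]: "Measurable.pred (borel \<Otimes>\<^sub>M borel) (\<lambda>z. snd z \<in> {- (fst z / c)..fst z / c})"
      unfolding atLeastAtMost_iff by measurable
    show ?thesis unfolding I_def by measurable
  qed
  have "(\<lambda>n. \<integral>u. of_real (?k u) * I (u / sqrt (1 / real (Suc n))) x \<partial>lborel)
      \<longlonglongrightarrow> (\<integral>u. of_real (?k u) * J x \<partial>lborel)"
  proof (rule integral_dominated_convergence[where w="\<lambda>u. ?k u * D x"])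
    show "integrable lborel (\<lambda>u. ?k u * D x)"
      using tail by (simp add: has_bochner_integral_iff)
    show "AE u in lborel. (\<lambda>n. of_real (?k u) * I (u / sqrt (1 / real (Suc n))) x)
        \<longlonglongrightarrow> of_real (?k u) * J x"
    proof (rule AE_I2)
      fix u :: real
      show "(\<lambda>n. of_real (?k u) * I (u / sqrt (1 / real (Suc n))) x) \<longlonglongrightarrow> of_real (?k u) * J x"
      proof (cases "u > 0")
        case True
        have "filterlim (\<lambda>n. sqrt (real (Suc n))) at_top sequentially"
          by (rule filterlim_compose[OF sqrt_at_top])
              (rule filterlim_compose[OF filterlim_real_sequentially filterlim_Suc])
        then have "filterlim (\<lambda>n. u * sqrt (real (Suc n))) at_top sequentially"
          by (rule filterlim_tendsto_pos_mult_at_top[OF tendsto_const True])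
        then have "filterlim (\<lambda>n. u / sqrt (1 / real (Suc n))) at_top sequentially"
          by (simp add: real_sqrt_divide)
        from filterlim_compose[OF lim[OF x] this] show ?thesis
          unfolding I_def by (intro tendsto_mult tendsto_const)
      next
        case False
        then have "?k u = 0" by (auto simp: indicator_def)
        then show ?thesis by (simp only: of_real_0 mult_zero_left tendsto_const)
      qed
    qed
    show "AE u in lborel. norm (of_real (?k u) * I (u / sqrt (1 / real (Suc n))) x) \<le> ?k u * D x" for n
    proof (rule AE_I2)
      fix u :: real
      show "norm (of_real (?k u) * I (u / sqrt (1 / real (Suc n))) x) \<le> ?k u * D x"
      proof (cases "u \<ge> 0")
        case True
        then have "cmod (I (u / sqrt (1 / real (Suc n))) x) \<le> D x"
          unfolding I_def by (intro dom x) simp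
        then show ?thesis
          using mult_left_mono[OF _ k0[of u]] k0[of u] unfolding norm_mult norm_of_real by simp
      qed simp
    qed
  qed measurable
  also have "(\<integral>u. of_real (?k u) * J x \<partial>lborel) = J x"
    using tail by (simp only: integral_mult_left_zero integral_complex_of_real)
        (simp add: has_bochner_integral_integral_eq)
  finally show ?thesis
    by (subst gauss_cutoff_eq_average) auto
qed

text \<open>Now that \<open>f\<close> is known to be square integrable, the same limit argument runs
  in the opposite direction, from \<open>f\<close> to \<open>J\<close>.\<close>

lemma f_gauss_L2_limit:
  "(\<lambda>n. \<integral>x. (cmod ((\<integral>t. (f t * of_real (gauss n t)) * cis (- (t * x)) \<partial>lborel) - J x))\<^sup>2 \<partial>lborel) \<longlonglongrightarrow> 0"
proof -
  have i: "integrable lborel (\<lambda>t. f t * of_real (gauss n t))" for n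
    using f_gauss_integrable[of "1 / real (Suc n)" 1 0 1 0] by simp
  have l: "AE x in lborel. (\<lambda>n. \<integral>t. (f t * of_real (gauss n t)) * cis ((-1) * x * t) \<partial>lborel) \<longlonglongrightarrow> J x"
    using AE_nz by eventually_elim (use gauss_cutoff_tendsto in \<open>simp add: mult.commute\<close>)
  show ?thesis
    using fourier_L2_limit(2)[OF i L2_gauss_cutoff(1)[OF L2_f] L2_f L2_gauss_cutoff(2)[OF L2_f],
        where s="-1" and \<psi>=J] l
    by (simp add: mult.commute)
qed

end

text \<open>A Gaussian is put on \<open>J1\<close> and another on \<open>f2\<close>; then the
  multiplication formula is plain Fubini, and continuity of the L2 pairing removes both. The left
  pairing converges by \<open>J_gauss_L2_limit\<close> for the first integral, the right one by
  \<open>f_gauss_L2_limit\<close> for the second.\<close>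

theorem parseval_improper_fourier:
  assumes 1: "improper_fourier f1 J1 D1 B1" and 2: "improper_fourier f2 J2 D2 B2"
  shows "integrable lborel (\<lambda>t. f1 t * f2 t)"
    and "(\<integral>x. J1 x * J2 (y - x) \<partial>lborel)
        = of_real (2 * pi) * (\<integral>t. f1 t * f2 t * cis (- (t * y)) \<partial>lborel)"
proof -
  interpret A: improper_fourier f1 J1 D1 B1 by fact
  interpret B: improper_fourier f2 J2 D2 B2 by fact
  note [measurable] = A.f_meas B.f_meas A.J_meas B.J_meas
  show int: "integrable lborel (\<lambda>t. f1 t * f2 t)"
    by (intro L2_mult A.L2_f B.L2_f)
  define e where "e n = 1 / real (Suc n)" for n
  have e0: "e n > 0" for n by (simp add: e_def)
  define g where "g n x = exp (- e n * x\<^sup>2 / 2)" for n x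
  define F where "F n t = (\<integral>x. (J1 x * of_real (g n x)) * cis (t * x) \<partial>lborel)" for n t
  define G where "G n x = (\<integral>t. (f2 t * of_real (g n t)) * cis (- (t * x)) \<partial>lborel)" for n x
  have iJ: "integrable lborel (\<lambda>x. J1 x * of_real (g n x))" for n
    unfolding g_def by (rule A.J_gauss_integrable[OF e0])
  have if2: "integrable lborel (\<lambda>t. f2 t * of_real (g n t))" for n
    using B.f_gauss_integrable[OF e0[of n], of 1 0 1 0] by (simp add: g_def)
  have LF: "L2 lborel (F n)" for n
    using fourier_L2_bound(1)[OF iJ L2_gauss_cutoff(1)[OF A.L2J, folded e_def, folded g_def], of 1
        n] by (simp add: F_def[abs_def])
  have LG: "L2 lborel (G n)" for n
    using fourier_L2_bound(1)[OF if2 L2_gauss_cutoff(1)[OF B.L2_f, folded e_def, folded g_def], of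
        "-1" n] by (simp add: G_def[abs_def] mult.commute)
  \<comment> \<open>Reflection at \<open>y / 2\<close> and, in the next fact, modulation by a
    unimodular factor are isometries of L2.\<close>
  have refl: "L2 lborel (\<lambda>x. h (y - x))" "(\<integral>x. (cmod (h (y - x)))\<^sup>2 \<partial>lborel)
      = (\<integral>x. (cmod (h x))\<^sup>2 \<partial>lborel)" if "L2 lborel h" for h
    using lborel_integrable_real_affine[of "\<lambda>x. (cmod (h x))\<^sup>2" "-1" y]
      lborel_integral_real_affine[of "-1" "\<lambda>x. (cmod (h x))\<^sup>2" y] that
    by (auto simp: L2_def)
  have cisL: "L2 lborel (\<lambda>t. h t * cis (- (t * y)))" "(\<integral>t. (cmod (h t * cis (- (t * y))))\<^sup>2 \<partial>lborel)
      = (\<integral>x. (cmod (h x))\<^sup>2 \<partial>lborel)" if "L2 lborel h" for h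
    using that by (auto simp: L2_def norm_mult)
  \<comment> \<open>The transform is moved from \<open>J1\<close> onto \<open>f2\<close>; the
    modulation by \<open>cis (- (t * y))\<close> becomes the reflected argument
    \<open>y - x\<close>.\<close>
  have eq: "(\<integral>t. F n t * (f2 t * of_real (g n t) * cis (- (t * y))) \<partial>lborel)
      = (\<integral>x. (J1 x * of_real (g n x)) * G n (y - x) \<partial>lborel)" for n
  proof -
    let ?Q = "\<lambda>x t. (J1 x * of_real (g n x)) * (f2 t * of_real (g n t)) * cis (t * x - t * y)"
    have "integrable (lborel \<Otimes>\<^sub>M lborel) (\<lambda>z. (case z of (x, t) \<Rightarrow> (J1 x * of_real (g n x))
        * (f2 t * of_real (g n t))) * cis (snd z * fst z - snd z * y))"
      by (intro integrable_times_cis integrable_times_pair lborel.sigma_finite_measure_axioms iJ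
          if2) simp_all
    also have "(\<lambda>z. (case z of (x, t) \<Rightarrow> (J1 x * of_real (g n x)) * (f2 t * of_real (g n t)))
        * cis (snd z * fst z - snd z * y)) = (\<lambda>(x, t). ?Q x t)"
      by (auto simp: fun_eq_iff)
    finally have Q: "integrable (lborel \<Otimes>\<^sub>M lborel) (\<lambda>(x, t). ?Q x t)" .
    have c: "cis (t * x - t * y) = cis (t * x) * cis (- (t * y))" for t x by (simp add: cis_mult)
    have "(\<integral>t. F n t * (f2 t * of_real (g n t) * cis (- (t * y))) \<partial>lborel)
        = (\<integral>t. \<integral>x. ?Q x t \<partial>lborel \<partial>lborel)"
      unfolding F_def by (subst integral_mult_left_zero[symmetric]) (simp add: c mult_ac)
    also have "\<dots> = (\<integral>x. \<integral>t. ?Q x t \<partial>lborel \<partial>lborel)"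
      by (rule lborel_pair.Fubini_integral[OF Q])
    also have "\<dots> = (\<integral>x. (J1 x * of_real (g n x)) * G n (y - x) \<partial>lborel)"
      unfolding G_def by (subst integral_mult_right_zero[symmetric]) (simp add: algebra_simps)
    finally show ?thesis .
  qed
  have "(\<lambda>n. \<integral>t. F n t * (f2 t * of_real (g n t) * cis (- (t * y))) \<partial>lborel)
      \<longlonglongrightarrow> (\<integral>t. (of_real (2 * pi) * f1 t) * (f2 t * cis (- (t * y))) \<partial>lborel)"
  proof (rule L2_tendsto_integral_mult)
    show "L2 lborel (F n)" for n by (rule LF)
    show "L2 lborel (\<lambda>t. f2 t * of_real (g n t) * cis (- (t * y)))" for n
      by (intro cisL L2_gauss_cutoff(1)[OF B.L2_f, folded e_def, folded g_def])
    show "L2 lborel (\<lambda>t. of_real (2 * pi) * f1 t)" by (intro L2_cmult A.L2_f)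
    show "L2 lborel (\<lambda>t. f2 t * cis (- (t * y)))" by (intro cisL B.L2_f)
    show "(\<lambda>n. \<integral>t. (cmod (F n t - of_real (2 * pi) * f1 t))\<^sup>2 \<partial>lborel) \<longlonglongrightarrow> 0"
      using A.J_gauss_L2_limit unfolding F_def g_def e_def .
    have "(\<integral>t. (cmod (f2 t * of_real (g n t) * cis (- (t * y)) - f2 t * cis (- (t * y))))\<^sup>2 \<partial>lborel)
        = (\<integral>t. (cmod (f2 t * of_real (g n t) - f2 t))\<^sup>2 \<partial>lborel)" for n
      unfolding left_diff_distrib[symmetric]
      by (intro cisL L2_diff B.L2_f L2_gauss_cutoff(1)[OF B.L2_f, folded e_def, folded g_def])
    then show "(\<lambda>n. \<integral>t. (cmod (f2 t * of_real (g n t) * cis (- (t * y)) - f2 t * cis (- (t * y))))\<^sup>2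
        \<partial>lborel) \<longlonglongrightarrow> 0"
      using L2_gauss_cutoff(2)[OF B.L2_f, folded e_def, folded g_def] by simp
  qed
  moreover have "(\<lambda>n. \<integral>x. (J1 x * of_real (g n x)) * G n (y - x) \<partial>lborel)
      \<longlonglongrightarrow> (\<integral>x. J1 x * J2 (y - x) \<partial>lborel)"
  proof (rule L2_tendsto_integral_mult)
    show "L2 lborel (\<lambda>x. J1 x * of_real (g n x))" for n
      by (rule L2_gauss_cutoff(1)[OF A.L2J, folded e_def, folded g_def])
    show "L2 lborel (\<lambda>x. G n (y - x))" for n by (intro refl LG)
    show "L2 lborel J1" by (rule A.L2J)
    show "L2 lborel (\<lambda>x. J2 (y - x))" by (intro refl B.L2J)
    show "(\<lambda>n. \<integral>x. (cmod (J1 x * of_real (g n x) - J1 x))\<^sup>2 \<partial>lborel) \<longlonglongrightarrow> 0"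
      by (rule L2_gauss_cutoff(2)[OF A.L2J, folded e_def, folded g_def])
    have "(\<integral>x. (cmod (G n (y - x) - J2 (y - x)))\<^sup>2 \<partial>lborel)
        = (\<integral>x. (cmod (G n x - J2 x))\<^sup>2 \<partial>lborel)" for n
      by (rule refl(2)) (intro L2_diff LG B.L2J)
    then show "(\<lambda>n. \<integral>x. (cmod (G n (y - x) - J2 (y - x)))\<^sup>2 \<partial>lborel) \<longlonglongrightarrow> 0"
      using B.f_gauss_L2_limit unfolding G_def g_def e_def by simp
  qed
  ultimately have "(\<integral>x. J1 x * J2 (y - x) \<partial>lborel)
      = (\<integral>t. (of_real (2 * pi) * f1 t) * (f2 t * cis (- (t * y))) \<partial>lborel)"
    unfolding eq by (rule LIMSEQ_unique[rotated])
  also have "\<dots> = of_real (2 * pi) * (\<integral>t. f1 t * f2 t * cis (- (t * y)) \<partial>lborel)"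
    by (subst integral_mult_right_zero[symmetric]) (simp add: mult_ac)
  finally show "(\<integral>x. J1 x * J2 (y - x) \<partial>lborel)
      = of_real (2 * pi) * (\<integral>t. f1 t * f2 t * cis (- (t * y)) \<partial>lborel)" .
qed

section \<open>Polar coordinates\<close>

lemma lborel_complex_eq: "(lborel :: complex measure)
    = distr (lborel \<Otimes>\<^sub>M lborel) borel (\<lambda>(a, b). Complex a b)"
proof (rule lborel_eqI)
  have [measurable]: "(\<lambda>(a, b). Complex a b) \<in> borel_measurable (lborel \<Otimes>\<^sub>M lborel)"
  proof -
    have "(\<lambda>z. Complex (fst z) (snd z)) \<in> borel_measurable (lborel \<Otimes>\<^sub>M lborel)"
      unfolding Complex_eq by measurable
    then show ?thesis by (simp add: case_prod_beta')
  qed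
  fix l u :: complex
  assume le: "\<And>b. b \<in> Basis \<Longrightarrow> l \<bullet> b \<le> u \<bullet> b"
  have "(\<lambda>(a, b). Complex a b) -` box l u = box (Re l) (Re u) \<times> box (Im l) (Im u)"
    by (auto simp: box_def Basis_complex_def inner_complex_def)
  moreover have "Re l \<le> Re u" "Im l \<le> Im u" using le[of 1] le[of \<i>]
      by (auto simp: Basis_complex_def inner_complex_def)
  ultimately show "emeasure (distr (lborel \<Otimes>\<^sub>M lborel) borel (\<lambda>(a, b). Complex a b)) (box l u)
      = ennreal (\<Prod>b\<in>Basis. (u - l) \<bullet> b)"
    by (subst emeasure_distr)
      (auto simp: space_pair_measure lborel.emeasure_pair_measure_Times Basis_complex_def
          inner_complex_def
         ennreal_mult[symmetric] box_real)
qed simp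

text \<open>Substitution on compact intervals, extended by monotone convergence to increasing
  unions. The endpoints are free sequences because exp is used on the whole line and tan on an open
  interval.\<close>

lemma nn_integral_substitution_exhaust:
  fixes f :: "real \<Rightarrow> ennreal" and g g' :: "real \<Rightarrow> real" and a b :: "nat \<Rightarrow> real"
  assumes [measurable]: "f \<in> borel_measurable borel" "g \<in> borel_measurable borel" "g'
      \<in> borel_measurable borel"
    and d: "\<And>n x. x \<in> {a n..b n} \<Longrightarrow> (g has_real_derivative g' x) (at x)"
    and c: "\<And>n. continuous_on {a n..b n} g'"
    and nn: "\<And>n x. x \<in> {a n..b n} \<Longrightarrow> g' x \<ge> 0"
    and ab: "\<And>n. a n < b n" and a: "decseq a" and b: "incseq b"
  shows "(\<integral>\<^sup>+x. f x * indicator (\<Union>n. {g (a n)..g (b n)}) x \<partial>lborel)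
      = (\<integral>\<^sup>+x. f (g x) * g' x * indicator (\<Union>n. {a n..b n}) x \<partial>lborel)"
proof -
  have inc1: "incseq (\<lambda>n. {a n..b n})"
    using a b by (intro monoI) (auto simp: decseq_def incseq_def intro: order_trans)
  have inc2: "incseq (\<lambda>n. {g (a n)..g (b n)})"
  proof (rule incseq_SucI)
    fix n
    have le: "a (Suc n) \<le> a n" "b n \<le> b (Suc n)" using a b by (auto simp: decseq_Suc_iff incseq_Suc_iff)
    have mono: "g x \<le> g y" if "x \<le> y" "a (Suc n) \<le> x" "y \<le> b (Suc n)" for x y
      using that by (intro DERIV_nonneg_imp_nondecreasing[OF that(1)])
          (meson atLeastAtMost_iff d nn order_trans)
    show "{g (a n)..g (b n)} \<subseteq> {g (a (Suc n))..g (b (Suc n))}"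
      using mono[of "a (Suc n)" "a n"] mono[of "b n" "b (Suc n)"] le ab[of n] by auto
  qed
  have SI: "indicator (\<Union>n. S n) x = (SUP n. indicator (S n) x :: ennreal)" for S :: "nat \<Rightarrow> real set"
      and x
  proof (cases "x \<in> (\<Union>n. S n)")
    case True
    then obtain n where "x \<in> S n" by blast
    then show ?thesis
      by (intro antisym SUP_upper2[of n] SUP_least) (auto simp: indicator_def)
  qed simp
  have SUP: "(\<integral>\<^sup>+x. h x * indicator (\<Union>n. S n) x \<partial>lborel)
      = (SUP n. \<integral>\<^sup>+x. h x * indicator (S n) x \<partial>lborel)"
    if S: "incseq S" and [measurable]: "h \<in> borel_measurable borel" "\<And>n. S n \<in> sets borel" for h ::
        "real \<Rightarrow> ennreal" and S
  proof -
    have "(\<integral>\<^sup>+x. h x * indicator (\<Union>n. S n) x \<partial>lborel)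
        = (\<integral>\<^sup>+x. (SUP n. h x * indicator (S n) x) \<partial>lborel)"
      by (simp add: SI SUP_mult_left_ennreal)
    also have "\<dots> = (SUP n. \<integral>\<^sup>+x. h x * indicator (S n) x \<partial>lborel)"
      using S by (intro nn_integral_monotone_convergence_SUP monoI le_funI mult_left_mono)
        (auto simp: indicator_def incseq_def)
    finally show ?thesis .
  qed
  have "(\<integral>\<^sup>+x. f x * indicator (\<Union>n. {g (a n)..g (b n)}) x \<partial>lborel)
      = (SUP n. \<integral>\<^sup>+x. f x * indicator {g (a n)..g (b n)} x \<partial>lborel)"
    by (intro SUP inc2) auto
  also have "\<dots> = (SUP n. \<integral>\<^sup>+x. f (g x) * g' x * indicator {a n..b n} x \<partial>lborel)"
    by (intro SUP_cong refl nn_integral_substitution_aux) (use d c nn ab in auto)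
  also have "\<dots> = (\<integral>\<^sup>+x. f (g x) * g' x * indicator (\<Union>n. {a n..b n}) x \<partial>lborel)"
    by (intro SUP[symmetric] inc1) auto
  finally show ?thesis .
qed

text \<open>The measure da/a is invariant under scaling, which accounts for the free factor
  \<open>c\<close>. It will be \<open>cos \<theta>\<close>, the ratio of the real part to the
  modulus.\<close>

lemma nn_integral_substitution_exp:
  fixes f :: "real \<Rightarrow> ennreal"
  assumes [measurable]: "f \<in> borel_measurable borel" and c: "c > 0"
  shows "(\<integral>\<^sup>+a. f a * ennreal (1 / a) * indicator {0<..} a \<partial>lborel) = (\<integral>\<^sup>+x. f (c * exp x) \<partial>lborel)"
proof -
  have U: "(\<Union>n. {c * exp (- real (Suc n))..c * exp (real (Suc n))}) = {0<..}"
  proof (intro set_eqI iffI)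
    fix y assume "y \<in> (\<Union>n. {c * exp (- real (Suc n))..c * exp (real (Suc n))})"
    then show "y \<in> {0<..}" using c by (auto intro: less_le_trans[rotated])
  next
    fix y :: real assume "y \<in> {0<..}"
    then have y: "y / c > 0" using c by simp
    obtain n where n: "\<bar>ln (y / c)\<bar> \<le> real n" using real_arch_simple by blast
    have "exp (- real (Suc n)) \<le> exp (ln (y / c))" "exp (ln (y / c)) \<le> exp (real (Suc n))" using n
        by (auto simp: abs_le_iff)
    then have "y \<in> {c * exp (- real (Suc n))..c * exp (real (Suc n))}"
      using y c by (simp add: field_simps)
    then show "y \<in> (\<Union>n. {c * exp (- real (Suc n))..c * exp (real (Suc n))})" by blast
  qed
  have V: "(\<Union>n. {- real (Suc n)..real (Suc n)}) = UNIV"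
  proof (intro set_eqI iffI UNIV_I)
    fix y :: real
    obtain n where n: "\<bar>y\<bar> \<le> real n" using real_arch_simple by blast
    then have "y \<in> {- real (Suc n)..real (Suc n)}" by (auto simp: abs_le_iff)
    then show "y \<in> (\<Union>n. {- real (Suc n)..real (Suc n)})" by blast
  qed
  have "(\<integral>\<^sup>+a. (f a * ennreal (1 / a)) * indicator (\<Union>n. {c * exp (- real (Suc n))..c
      * exp (real (Suc n))}) a \<partial>lborel)
      = (\<integral>\<^sup>+x. f (c * exp x) * ennreal (1 / (c * exp x)) * ennreal (c * exp x)
          * indicator (\<Union>n. {- real (Suc n)..real (Suc n)}) x \<partial>lborel)"
    using c
    by (intro nn_integral_substitution_exhaust) (auto intro!: derivative_eq_intros continuous_intros
        simp: decseq_def incseq_def)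
  also have "\<dots> = (\<integral>\<^sup>+x. f (c * exp x) \<partial>lborel)"
    unfolding V using c by (intro nn_integral_cong) (simp add: mult.assoc ennreal_mult'[symmetric])
  finally show ?thesis unfolding U .
qed

lemma nn_integral_substitution_tan:
  fixes f :: "real \<Rightarrow> ennreal"
  assumes [measurable]: "f \<in> borel_measurable borel"
  shows "(\<integral>\<^sup>+m. f m * ennreal (1 / (1 + m\<^sup>2)) \<partial>lborel)
      = (\<integral>\<^sup>+x. f (tan x) * indicator {-pi/2<..<pi/2} x \<partial>lborel)"
proof -
  \<comment> \<open>Endpoints of the form \<open>arctan (real (Suc n))\<close> make the image
    intervals have integer endpoints, so they exhaust the line.\<close>
  have U: "(\<Union>n. {tan (- arctan (real (Suc n)))..tan (arctan (real (Suc n)))}) = UNIV"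
  proof (intro set_eqI iffI UNIV_I)
    fix y :: real
    obtain n where n: "\<bar>y\<bar> \<le> real n" using real_arch_simple by blast
    then have "y \<in> {tan (- arctan (real (Suc n)))..tan (arctan (real (Suc n)))}"
        by (auto simp: abs_le_iff tan_arctan)
    then show "y \<in> (\<Union>n. {tan (- arctan (real (Suc n)))..tan (arctan (real (Suc n)))})" by blast
  qed
  have ss: "- (pi/2) < x \<and> x < pi/2" if "x \<in> {- arctan (real (Suc n))..arctan (real (Suc n))}" for x n
    using that arctan_bounded[of "real (Suc n)"] by auto
  have V: "(\<Union>n. {- arctan (real (Suc n))..arctan (real (Suc n))}) = {-pi/2<..<pi/2}"
  proof (intro set_eqI iffI)
    fix y :: real assume "y \<in> {-pi/2<..<pi/2}"
    then have y: "arctan (tan y) = y" by (intro arctan_tan) auto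
    obtain n where n: "\<bar>tan y\<bar> \<le> real n" using real_arch_simple by blast
    then have "arctan (- real (Suc n)) \<le> arctan (tan y)" "arctan (tan y) \<le> arctan (real (Suc n))"
      unfolding arctan_le_iff by (auto simp: abs_le_iff)
    then have "y \<in> {- arctan (real (Suc n))..arctan (real (Suc n))}" unfolding y arctan_minus by simp
    then show "y \<in> (\<Union>n. {- arctan (real (Suc n))..arctan (real (Suc n))})" by blast
  qed (use ss in fastforce)
  have cosnz: "cos x \<noteq> 0" if "x \<in> {- arctan (real (Suc n))..arctan (real (Suc n))}" for x n
    using ss[OF that] cos_gt_zero_pi[of x] by auto
  have [measurable]: "(tan :: real \<Rightarrow> real) \<in> borel_measurable borel"
    unfolding tan_def[abs_def] by measurable
  have "(\<integral>\<^sup>+m. (f m * ennreal (1 / (1 + m\<^sup>2)))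
      * indicator (\<Union>n. {tan (- arctan (real (Suc n)))..tan (arctan (real (Suc n)))}) m \<partial>lborel)
     = (\<integral>\<^sup>+x. f (tan x) * ennreal (1 / (1 + (tan x)\<^sup>2)) * ennreal (1 + (tan x)\<^sup>2)
         * indicator (\<Union>n. {- arctan (real (Suc n))..arctan (real (Suc n))}) x \<partial>lborel)"
  proof (intro nn_integral_substitution_exhaust)
    fix n x assume x: "x \<in> {- arctan (real (Suc n))..arctan (real (Suc n))}"
    have "(tan has_real_derivative inverse ((cos x)\<^sup>2)) (at x)" using cosnz[OF x] by (rule DERIV_tan)
    then show "(tan has_real_derivative 1 + (tan x)\<^sup>2) (at x)"
      using cosnz[OF x] by (simp add: tan_sec power_inverse)
  next
    fix n show "continuous_on {- arctan (real (Suc n))..arctan (real (Suc n))} (\<lambda>x. 1 + (tan x)\<^sup>2)"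
      using cosnz by (intro continuous_intros) auto
  next
    show "decseq (\<lambda>n. - arctan (real (Suc n)))" "incseq (\<lambda>n. arctan (real (Suc n)))"
      by (auto simp: decseq_def incseq_def arctan_le_iff)
    show "- arctan (real (Suc n)) < arctan (real (Suc n))" for n
      using zero_less_arctan_iff[of "real (Suc n)"] by (simp del: of_nat_Suc)
  qed (auto simp: add_nonneg_nonneg)
  also have "\<dots> = (\<integral>\<^sup>+x. f (tan x) * indicator {-pi/2<..<pi/2} x \<partial>lborel)"
  proof (unfold V, intro nn_integral_cong)
    fix x :: real
    have "1 + (tan x)\<^sup>2 > 0" by (simp add: add_pos_nonneg)
    then have "ennreal (1 / (1 + (tan x)\<^sup>2)) * ennreal (1 + (tan x)\<^sup>2) = 1"
      by (simp add: ennreal_mult'[symmetric] del: ennreal_plus)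
    then show "f (tan x) * ennreal (1 / (1 + (tan x)\<^sup>2)) * ennreal (1 + (tan x)\<^sup>2)
        * indicator {- pi / 2<..<pi / 2} x = f (tan x) * indicator {- pi / 2<..<pi / 2} x"
      by (simp add: mult.assoc del: ennreal_plus)
  qed
  finally show ?thesis unfolding U by simp
qed

lemma borel_measurable_Complex [measurable (raw)]:
  assumes "f \<in> borel_measurable M" "g \<in> borel_measurable M"
  shows "(\<lambda>x. Complex (f x) (g x)) \<in> borel_measurable M"
  using assms unfolding Complex_eq by measurable

lemma borel_measurable_complex_exp [measurable]: "(exp :: complex \<Rightarrow> complex) \<in> borel_measurable borel"
  by (intro borel_measurable_continuous_onI continuous_intros)

text \<open>Half of the plane at a time, write \<open>a + b * \<i>\<close> first as \<open>a * (1 + m * \<i>)\<close> and then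
  with \<open>m = tan \<theta>\<close> and \<open>\<bar>a\<bar> = exp x * cos \<theta>\<close>; only one-dimensional substitutions are needed.\<close>

lemma nn_integral_mult_measure:
  assumes [measurable]: "F \<in> borel_measurable borel"
  shows "(\<integral>\<^sup>+z. F z \<partial>mult_measure)
    = (\<integral>\<^sup>+\<theta>. (\<integral>\<^sup>+x. F (exp (Complex x \<theta>)) \<partial>lborel) * indicator {-pi/2<..<3*pi/2} \<theta> \<partial>lborel)"
proof -
  define \<Phi> where "\<Phi> m = (\<integral>\<^sup>+a. F (Complex a (a * m)) * ennreal (1 / \<bar>a\<bar>) \<partial>lborel)" for m
  define \<Psi> where "\<Psi> \<theta> = (\<integral>\<^sup>+x. F (exp (Complex x \<theta>)) \<partial>lborel)" for \<theta>
  have [measurable]: "\<Phi> \<in> borel_measurable borel" "\<Psi> \<in> borel_measurable borel"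
    unfolding \<Phi>_def \<Psi>_def by measurable
  have nz: "AE a in lborel. a \<noteq> (c :: real)" for c by (rule AE_lborel_singleton)
  have "(\<integral>\<^sup>+z. F z \<partial>mult_measure) = (\<integral>\<^sup>+z. F z * ennreal (1 / (cmod z)\<^sup>2) \<partial>lborel)"
    unfolding mult_measure_def by (subst nn_integral_density) (auto simp: mult.commute)
  also have "\<dots> = (\<integral>\<^sup>+z. F (Complex (fst z) (snd z))
      * ennreal (1 / (cmod (Complex (fst z) (snd z)))\<^sup>2) \<partial>(lborel \<Otimes>\<^sub>M lborel))"
    by (subst lborel_complex_eq, subst nn_integral_distr) (auto simp: case_prod_beta' simp del:
        complex_norm)
  also have "\<dots> = (\<integral>\<^sup>+a. \<integral>\<^sup>+b. F (Complex a b) * ennreal (1 / (cmod (Complex a b))\<^sup>2) \<partial>lborel \<partial>lborel)"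
    by (subst lborel.nn_integral_fst[symmetric]) (auto simp del: complex_norm)
  also have "\<dots> = (\<integral>\<^sup>+a. \<integral>\<^sup>+m. F (Complex a (a * m)) * ennreal (1 / \<bar>a\<bar>)
      * ennreal (1 / (1 + m\<^sup>2)) \<partial>lborel \<partial>lborel)"
  proof (rule nn_integral_cong_AE, use nz[of 0] in eventually_elim)
    fix a :: real assume a: "a \<noteq> 0"
    have aux: "b * (1 / (b\<^sup>2 * q)) = (1 / b) * (1 / q)" if "b \<noteq> 0" for b q :: real
      using that by (simp add: power2_eq_square)
    have "(\<integral>\<^sup>+b. F (Complex a b) * ennreal (1 / (cmod (Complex a b))\<^sup>2) \<partial>lborel)
       = ennreal \<bar>a\<bar>
           * (\<integral>\<^sup>+m. F (Complex a (0 + a * m)) * ennreal (1 / (cmod (Complex a (0 + a * m)))\<^sup>2) \<partial>lborel)"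
      using a by (intro nn_integral_real_affine) measurable
    also have "\<dots> = (\<integral>\<^sup>+m. ennreal \<bar>a\<bar>
        * (F (Complex a (0 + a * m)) * ennreal (1 / (cmod (Complex a (0 + a * m)))\<^sup>2)) \<partial>lborel)"
      by (rule nn_integral_cmult[symmetric]) measurable
    also have "\<dots> = (\<integral>\<^sup>+m. F (Complex a (a * m)) * ennreal (1 / \<bar>a\<bar>) * ennreal (1 / (1 + m\<^sup>2)) \<partial>lborel)"
    proof (intro nn_integral_cong)
      fix m :: real
      have "(cmod (Complex a (0 + a * m)))\<^sup>2
          = \<bar>a\<bar>\<^sup>2 * (1 + m\<^sup>2)" by (simp add: cmod_def power_mult_distrib algebra_simps)
      then have "\<bar>a\<bar> * (1 / (cmod (Complex a (0 + a * m)))\<^sup>2) = (1 / \<bar>a\<bar>) * (1 / (1 + m\<^sup>2))"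
        using aux[of "\<bar>a\<bar>"] a by simp
      then have "ennreal \<bar>a\<bar> * ennreal (1 / (cmod (Complex a (0 + a * m)))\<^sup>2)
          = ennreal (1 / \<bar>a\<bar>) * ennreal (1 / (1 + m\<^sup>2))"
        by (simp add: ennreal_mult[symmetric] del: complex_norm)
      then show "ennreal \<bar>a\<bar>
          * (F (Complex a (0 + a * m)) * ennreal (1 / (cmod (Complex a (0 + a * m)))\<^sup>2))
         = F (Complex a (a * m)) * ennreal (1 / \<bar>a\<bar>) * ennreal (1 / (1 + m\<^sup>2))"
        by (simp only: mult.left_commute[of "ennreal \<bar>a\<bar>"] mult.assoc add_0)
    qed
    finally show "(\<integral>\<^sup>+b. F (Complex a b) * ennreal (1 / (cmod (Complex a b))\<^sup>2) \<partial>lborel)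
      = (\<integral>\<^sup>+m. F (Complex a (a * m)) * ennreal (1 / \<bar>a\<bar>) * ennreal (1 / (1 + m\<^sup>2)) \<partial>lborel)" .
  qed
  also have "\<dots> = (\<integral>\<^sup>+m. \<integral>\<^sup>+a. F (Complex a (a * m)) * ennreal (1 / \<bar>a\<bar>)
      * ennreal (1 / (1 + m\<^sup>2)) \<partial>lborel \<partial>lborel)"
    by (rule lborel_pair.Fubini'[symmetric]) measurable
  also have "\<dots> = (\<integral>\<^sup>+m. \<Phi> m * ennreal (1 / (1 + m\<^sup>2)) \<partial>lborel)"
    unfolding \<Phi>_def by (intro nn_integral_cong nn_integral_multc) measurable
  also have "\<dots> = (\<integral>\<^sup>+\<theta>. \<Phi> (tan \<theta>) * indicator {-pi/2<..<pi/2} \<theta> \<partial>lborel)"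
    by (rule nn_integral_substitution_tan) measurable
  also have "\<dots> = (\<integral>\<^sup>+\<theta>. \<Psi> \<theta> * indicator {-pi/2<..<pi/2} \<theta> + \<Psi> (\<theta> + pi)
      * indicator {-pi/2<..<pi/2} \<theta> \<partial>lborel)"
  proof (intro nn_integral_cong)
    fix \<theta> :: real
    show "\<Phi> (tan \<theta>) * indicator {-pi/2<..<pi/2} \<theta> = \<Psi> \<theta> * indicator {-pi/2<..<pi/2} \<theta> + \<Psi> (\<theta> + pi)
        * indicator {-pi/2<..<pi/2} \<theta>"
    proof (cases "\<theta> \<in> {-pi/2<..<pi/2}")
      case True
      then have c: "cos \<theta> > 0" by (intro cos_gt_zero_pi) auto
      let ?h = "\<lambda>a. F (Complex a (a * tan \<theta>)) * ennreal (1 / \<bar>a\<bar>)"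
      \<comment> \<open>A line of slope \<open>tan \<theta>\<close> through the origin consists of
        two rays: a > 0 has the angle \<open>\<theta>\<close>, a < 0 the angle
        \<open>\<theta> + pi\<close>.\<close>
      have "\<Phi> (tan \<theta>) = (\<integral>\<^sup>+a. ?h a * indicator {0<..} a + ?h a * indicator {..<0} a \<partial>lborel)"
        unfolding \<Phi>_def
        by (rule nn_integral_cong_AE, use nz[of 0] in eventually_elim) (auto simp: indicator_def)
      also have "\<dots> = (\<integral>\<^sup>+a. ?h a * indicator {0<..} a \<partial>lborel)
          + (\<integral>\<^sup>+a. ?h a * indicator {..<0} a \<partial>lborel)"
        by (intro nn_integral_add) measurable
      also have "(\<integral>\<^sup>+a. ?h a * indicator {..<0} a \<partial>lborel)
          = (\<integral>\<^sup>+a. ?h (- a) * indicator {0<..} a \<partial>lborel)"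
        by (subst nn_integral_real_affine[where c="-1" and t=0])
            (auto simp: indicator_def intro!: nn_integral_cong)
      also have "(\<integral>\<^sup>+a. ?h a * indicator {0<..} a \<partial>lborel)
          = (\<integral>\<^sup>+a. F (Complex a (a * tan \<theta>)) * ennreal (1 / a) * indicator {0<..} a \<partial>lborel)"
        by (intro nn_integral_cong) (auto simp: indicator_def)
      also have "\<dots> = (\<integral>\<^sup>+x. F (Complex (cos \<theta> * exp x) ((cos \<theta> * exp x) * tan \<theta>)) \<partial>lborel)"
        by (rule nn_integral_substitution_exp[OF _ c]) measurable
      also have "\<dots> = \<Psi> \<theta>"
      proof (unfold \<Psi>_def, intro nn_integral_cong arg_cong[of _ _ F])
        fix x show "Complex (cos \<theta> * exp x) ((cos \<theta> * exp x) * tan \<theta>) = exp (Complex x \<theta>)"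
          using c by (auto simp: complex_eq_iff exp_eq_polar tan_def Re_exp Im_exp)
      qed
      also have "(\<integral>\<^sup>+a. ?h (- a) * indicator {0<..} a \<partial>lborel)
          = (\<integral>\<^sup>+a. F (Complex (- a) (- a * tan \<theta>)) * ennreal (1 / a) * indicator {0<..} a \<partial>lborel)"
        by (intro nn_integral_cong) (auto simp: indicator_def)
      also have "\<dots> = (\<integral>\<^sup>+x. F (Complex (- (cos \<theta> * exp x)) (- (cos \<theta> * exp x) * tan \<theta>)) \<partial>lborel)"
        by (rule nn_integral_substitution_exp[OF _ c]) measurable
      also have "\<dots> = \<Psi> (\<theta> + pi)"
      proof (unfold \<Psi>_def, intro nn_integral_cong arg_cong[of _ _ F])
        fix x show "Complex (- (cos \<theta> * exp x)) (- (cos \<theta> * exp x) * tan \<theta>) = exp (Complex x (\<theta> + pi))"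
          using c by (auto simp: complex_eq_iff tan_def Re_exp Im_exp)
      qed
      finally show ?thesis using True by simp
    qed simp
  qed
  also have "\<dots> = (\<integral>\<^sup>+\<theta>. \<Psi> \<theta> * indicator {-pi/2<..<pi/2} \<theta> \<partial>lborel)
      + (\<integral>\<^sup>+\<theta>. \<Psi> (\<theta> + pi) * indicator {-pi/2<..<pi/2} \<theta> \<partial>lborel)"
    by (intro nn_integral_add) measurable
  also have "(\<integral>\<^sup>+\<theta>. \<Psi> (\<theta> + pi) * indicator {-pi/2<..<pi/2} \<theta> \<partial>lborel)
      = (\<integral>\<^sup>+\<theta>. \<Psi> \<theta> * indicator {pi/2<..<3*pi/2} \<theta> \<partial>lborel)"
    by (subst (2) nn_integral_real_affine[where c=1 and t=pi])
      (auto simp: indicator_def add.commute intro!: nn_integral_cong)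
  also have "(\<integral>\<^sup>+\<theta>. \<Psi> \<theta> * indicator {-pi/2<..<pi/2} \<theta> \<partial>lborel)
      + (\<integral>\<^sup>+\<theta>. \<Psi> \<theta> * indicator {pi/2<..<3*pi/2} \<theta> \<partial>lborel)
    = (\<integral>\<^sup>+\<theta>. \<Psi> \<theta> * indicator {-pi/2<..<pi/2} \<theta> + \<Psi> \<theta> * indicator {pi/2<..<3*pi/2} \<theta> \<partial>lborel)"
    by (intro nn_integral_add[symmetric]) measurable
  also have "\<dots> = (\<integral>\<^sup>+\<theta>. \<Psi> \<theta> * indicator {-pi/2<..<3*pi/2} \<theta> \<partial>lborel)"
    by (rule nn_integral_cong_AE, use nz[of "pi/2"] in eventually_elim) (auto simp: indicator_def)
  finally show ?thesis unfolding \<Psi>_def .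
qed

text \<open>The interval begins at -pi/2 because the right half plane supplies the angles up to pi/2
  and the left half plane those from pi/2 to 3*pi/2.\<close>

definition circle_measure :: "real measure" where
  "circle_measure = restrict_space lborel {-pi/2<..<3*pi/2}"

lemma measurable_circle_measure: "(\<lambda>x. x) \<in> circle_measure \<rightarrow>\<^sub>M borel"
  unfolding circle_measure_def by (rule measurable_restrict_space1) simp

lemma finite_circle_measure: "finite_measure circle_measure"
  unfolding circle_measure_def
  by (rule finite_measureI) (simp add: emeasure_restrict_space)

lemma mult_measure_polar:
  "mult_measure = distr (lborel \<Otimes>\<^sub>M circle_measure) borel (\<lambda>(x, \<theta>). exp (Complex x \<theta>))"
proof (rule measure_eqI)
  show "sets mult_measure = sets (distr (lborel \<Otimes>\<^sub>M circle_measure) borel (\<lambda>(x, \<theta>). exp (Complex x \<theta>)))"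
    by (simp add: mult_measure_def)
  interpret finite_measure circle_measure by (rule finite_circle_measure)
  interpret pair_sigma_finite lborel circle_measure ..
  have [measurable]: "(\<lambda>p. exp (Complex (fst p) (snd p)))
      \<in> borel_measurable (lborel \<Otimes>\<^sub>M circle_measure)"
  proof -
    have [measurable]: "snd \<in> (lborel :: real measure) \<Otimes>\<^sub>M circle_measure \<rightarrow>\<^sub>M borel"
      by (rule measurable_compose[OF measurable_snd measurable_circle_measure])
    show ?thesis by measurable
  qed
  fix A assume "A \<in> sets mult_measure"
  then have [measurable]: "A \<in> sets borel" by (simp add: mult_measure_def)
  have "emeasure mult_measure A = (\<integral>\<^sup>+z. indicator A z \<partial>mult_measure)"
    by (simp add: mult_measure_def)
  also have "\<dots> = (\<integral>\<^sup>+\<theta>. (\<integral>\<^sup>+x. indicator A (exp (Complex x \<theta>)) \<partial>lborel)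
      * indicator {-pi/2<..<3*pi/2} \<theta> \<partial>lborel)"
    by (rule nn_integral_mult_measure) measurable
  also have "\<dots> = (\<integral>\<^sup>+\<theta>. (\<integral>\<^sup>+x. indicator A (exp (Complex x \<theta>)) \<partial>lborel) \<partial>circle_measure)"
    unfolding circle_measure_def by (rule nn_integral_restrict_space[symmetric]) simp
  also have "\<dots> = (\<integral>\<^sup>+p. indicator A (exp (Complex (fst p) (snd p))) \<partial>(lborel \<Otimes>\<^sub>M circle_measure))"
    by (subst nn_integral_snd[symmetric]) (auto simp: case_prod_beta')
  also have "\<dots> = emeasure (distr (lborel \<Otimes>\<^sub>M circle_measure) borel (\<lambda>(x, \<theta>). exp (Complex x \<theta>))) A"
    by (subst nn_integral_indicator[symmetric], simp, subst nn_integral_distr)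
        (auto simp: case_prod_beta')
  finally show "emeasure mult_measure A = \<dots>" .
qed

section \<open>Asymptotics of the Gamma function of the complex field\<close>

text \<open>\<open>s\<close> may lie in the left half plane, but only by a small fraction of its
  modulus, so the cross term 2 n Re s costs at most n |s| / 2, which the squares absorb.\<close>

lemma norm_add_of_nat_ge:
  fixes s :: complex
  assumes "Re s \<ge> -B" "cmod s \<ge> 4 * B" "B \<ge> 0"
  shows "cmod (s + of_nat n) \<ge> (cmod s + real n) / 2"
proof -
  \<comment> \<open>To be read with S = |s|^2, N = n^2, p = n |s| and q = n Re s; \<open>X\<close>
    and \<open>Y\<close> are the two squared sides.\<close>
  have key: "X \<le> Y" if "Y = S + 2 * q + N" "q \<ge> - (p / 4)" "p \<le> (N + S) / 2" "X = (S + 2 * p + N) / 4"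
      "0 \<le> S" "0 \<le> N" for X Y S N p q :: real
    using that by simp
  have "(cmod (s + of_nat n))\<^sup>2 = (cmod s)\<^sup>2 + 2 * (real n * Re s) + (real n)\<^sup>2"
    unfolding cmod_power2 by (simp add: power2_eq_square algebra_simps)
  moreover have "real n * Re s \<ge> - (real n * cmod s / 4)"
  proof -
    have "real n * Re s \<ge> real n * (- (cmod s / 4))" using assms by (intro mult_left_mono) auto
    then show ?thesis by simp
  qed
  moreover have "real n * cmod s \<le> ((real n)\<^sup>2 + (cmod s)\<^sup>2) / 2"
    using zero_le_power2[of "real n - cmod s"] unfolding power2_diff by simp
  moreover have "((cmod s + real n) / 2)\<^sup>2 = ((cmod s)\<^sup>2 + 2 * (real n * cmod s) + (real n)\<^sup>2) / 4"
    by (simp add: power2_eq_square algebra_simps add_divide_distrib)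
  ultimately have "((cmod s + real n) / 2)\<^sup>2 \<le> (cmod (s + of_nat n))\<^sup>2" 
    by (rule key) simp_all
  then show ?thesis by (rule power2_le_imp_le) simp
qed

lemma not_nonpos_Reals_far:
  fixes s :: complex
  assumes "Re s \<ge> -B" "cmod s > B"
  shows "s \<notin> \<real>\<^sub>\<le>\<^sub>0"
proof
  assume "s \<in> \<real>\<^sub>\<le>\<^sub>0"
  then have "Re s \<le> 0" "Im s = 0" by (auto simp: complex_nonpos_Reals_iff)
  then have "cmod s = - Re s" by (simp add: cmod_def)
  then show False using assms by simp
qed

lemma not_nonpos_Ints_far:
  fixes s :: complex
  assumes "Re s \<ge> -B" "cmod s > B"
  shows "s \<notin> \<int>\<^sub>\<le>\<^sub>0"
  using not_nonpos_Reals_far[OF assms] nonpos_Ints_subset_nonpos_Reals by blast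

text \<open>Comparison with a telescoping series: 1/y^2 is at most twice 1/y - 1/(y + 1) once y
  \<ge> 1, hence the 2 in the bound.\<close>

lemma sums_inverse_square_bound:
  fixes f :: "nat \<Rightarrow> complex"
  assumes f: "f sums l" and b: "\<And>n. cmod (f n) \<le> K / (r + real n)\<^sup>2" and r: "r \<ge> 1" and K: "K \<ge> 0"
  shows "cmod l \<le> 2 * K / r"
proof -
  define g where "g n = - (2 * K / (r + real n))" for n
  have "g \<longlonglongrightarrow> 0" unfolding g_def using r by real_asymp
  then have tel: "(\<lambda>n. g (Suc n) - g n) sums (0 - g 0)" by (rule telescope_sums)
  have le: "cmod (f n) \<le> g (Suc n) - g n" for n
  proof -
    define y where "y = r + real n"
    have y: "y \<ge> 1" using r by (simp add: y_def)
    have "K / y\<^sup>2 \<le> 2 * K / (y * (y + 1))"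
    proof -
      have "K / y\<^sup>2 = 2 * K / (2 * y\<^sup>2)" by simp
      also have "y * (y + 1) \<le> 2 * y\<^sup>2"
        using y by (simp add: power2_eq_square algebra_simps)
      then have "2 * K / (2 * y\<^sup>2) \<le> 2 * K / (y * (y + 1))"
        using y K by (intro divide_left_mono) auto
      finally show ?thesis .
    qed
    also have "\<dots> = g (Suc n) - g n"
      using y unfolding g_def y_def by (simp add: field_simps)
    finally show ?thesis using b[of n] by (simp add: y_def)
  qed
  have "cmod l = cmod (suminf f)" using f by (simp add: sums_iff)
  also have "\<dots> \<le> (\<Sum>n. g (Suc n) - g n)"
    by (rule norm_suminf_le[OF le sums_summable[OF tel]])
  also have "\<dots> = 2 * K / r" using tel by (simp add: sums_iff g_def)
  finally show ?thesis .
qed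

lemma Polygamma_1_bound:
  fixes s :: complex
  assumes "Re s \<ge> -B" "cmod s \<ge> 4 * B" "B \<ge> 0" "cmod s \<ge> 1"
  shows "cmod (Polygamma 1 s) \<le> 8 / cmod s"
proof -
  have s: "(\<lambda>k. inverse ((s + of_nat k) ^ Suc 1)) sums ((-1) ^ Suc 1 * Polygamma 1 s / fact 1)"
    using assms by (intro Polygamma_LIMSEQ) auto
  have "cmod ((-1) ^ Suc 1 * Polygamma 1 s / fact 1) \<le> 2 * 4 / cmod s"
  proof (rule sums_inverse_square_bound[OF s])
    fix n
    have "((cmod s + real n) / 2)\<^sup>2 \<le> (cmod (s + of_nat n))\<^sup>2"
      by (intro power_mono norm_add_of_nat_ge[of B]) (use assms in auto)
    moreover have "((cmod s + real n) / 2)\<^sup>2 > 0" using assms by simp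
    ultimately have "inverse ((cmod (s + of_nat n))\<^sup>2) \<le> inverse (((cmod s + real n) / 2)\<^sup>2)"
      by (intro le_imp_inverse_le)
    then show "cmod (inverse ((s + of_nat n) ^ Suc 1)) \<le> 4 / (cmod s + real n)\<^sup>2"
      by (simp add: norm_inverse norm_mult norm_power power_divide flip: power2_eq_square)
  qed (use assms in auto)
  then show ?thesis by simp
qed

text \<open>The general term is cubic; one of its three factors is estimated by 1 / |s|, so that the
  comparison for inverse squares applies to the remaining two.\<close>

lemma Polygamma_2_bound:
  fixes s :: complex
  assumes "Re s \<ge> -B" "cmod s \<ge> 4 * B" "B \<ge> 0" "cmod s \<ge> 1"
  shows "cmod (Polygamma 2 s) \<le> 32 / (cmod s)\<^sup>2"
proof -
  have s: "(\<lambda>k. inverse ((s + of_nat k) ^ Suc 2)) sums ((-1) ^ Suc 2 * Polygamma 2 s / fact 2)"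
    using assms by (intro Polygamma_LIMSEQ) auto
  have "cmod ((-1) ^ Suc 2 * Polygamma 2 s / fact 2) \<le> 2 * (8 / cmod s) / cmod s"
  proof (rule sums_inverse_square_bound[OF s])
    fix n
    have "((cmod s + real n) / 2) ^ 3 \<le> (cmod (s + of_nat n)) ^ 3"
      by (intro power_mono norm_add_of_nat_ge[of B]) (use assms in auto)
    moreover have "((cmod s + real n) / 2) ^ 3 > 0" using assms by simp
    ultimately have "inverse ((cmod (s + of_nat n)) ^ 3) \<le> inverse (((cmod s + real n) / 2) ^ 3)"
      by (intro le_imp_inverse_le)
    also have "\<dots> = 8 / (cmod s + real n) / (cmod s + real n)\<^sup>2"
      by (simp add: power_divide power2_eq_square power3_eq_cube)
    also have "\<dots> \<le> 8 / cmod s / (cmod s + real n)\<^sup>2"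
    proof -
      have "cmod s > 0" using assms by linarith
      then show ?thesis by (intro divide_right_mono divide_left_mono)
          (auto intro!: mult_pos_pos add_pos_nonneg)
    qed
    finally show "cmod (inverse ((s + of_nat n) ^ Suc 2)) \<le> 8 / cmod s / (cmod s + real n)\<^sup>2"
      by (simp add: norm_inverse norm_mult power3_eq_cube power2_eq_square)
  qed (use assms in auto)
  then show ?thesis by (simp add: norm_divide norm_mult power2_eq_square field_simps)
qed

text \<open>Telescoping Ln (s + n) against the harmonic-type sum that defines Digamma leaves terms
  \<open>a n\<close> of size O(1/(|s| + n)^2). The 2 in 4 * B + 2 leaves room to move by up to 1
  along the segments from s + n to s + n + 1.\<close>

lemma Digamma_Ln_bound:
  fixes s :: complex
  assumes B: "B \<ge> 0" and s: "Re s \<ge> -B" "cmod s \<ge> 4 * B + 2"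
  shows "cmod (Digamma s - Ln s) \<le> 16 / cmod s"
proof -
  define a where "a n = Ln (s + of_nat (Suc n)) - Ln (s + of_nat n) - inverse (s + of_nat n)" for n
  have far: "cmod (s + of_nat n + of_real t) \<ge> (cmod s + real n) / 4" "Re (s + of_nat n + of_real t)
      \<ge> -B"
    "s + of_nat n + of_real t \<notin> \<real>\<^sub>\<le>\<^sub>0"
    if t: "0 \<le> t" "t \<le> 1" for t n
  proof -
    have "cmod s \<le> cmod (s + of_real t) + 1" using norm_triangle_ineq4[of "s
        + of_real t" "of_real t"] t by simp
    then have 1: "cmod (s + of_real t) \<ge> cmod s - 1" by simp
    have 2: "Re (s + of_real t) \<ge> -B" using s t by simp
    have "cmod (s + of_real t + of_nat n) \<ge> (cmod (s + of_real t) + real n) / 2"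
      by (rule norm_add_of_nat_ge[of B]) (use 1 2 s B in auto)
    moreover have "(cmod (s + of_real t) + real n) / 2 \<ge> (cmod s - 1 + real n) / 2" using 1 by simp
    moreover have "(cmod s - 1 + real n) / 2 \<ge> (cmod s + real n) / 4" using s B by simp
    ultimately show 3: "cmod (s + of_nat n + of_real t) \<ge> (cmod s + real n) / 4" by (simp add: add_ac)
    show 4: "Re (s + of_nat n + of_real t) \<ge> -B" using s t by simp
    show "s + of_nat n + of_real t \<notin> \<real>\<^sub>\<le>\<^sub>0"
    proof (rule not_nonpos_Reals_far[of B, OF 4])
      have "(cmod s + real n) / 4 > B" using s B by simp
      then show "B < cmod (s + of_nat n + of_real t)" using 3 by linarith
    qed
  qed
  have b: "cmod (a n) \<le> 8 / (cmod s + real n)\<^sup>2" for n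
  proof -
    define w where "w = s + of_nat n"
    have wn: "cmod w \<ge> (cmod s + real n) / 2" unfolding w_def
      by (rule norm_add_of_nat_ge[of B]) (use s B in auto)
    have pos: "cmod s + real n > 0" using s B by simp
    \<comment> \<open>The increment of Ln u - u / w over the segment from \<open>w\<close> to
      \<open>w + 1\<close> is exactly \<open>a n\<close>, and its derivative 1/u - 1/w is already
      quadratically small.\<close>
    have "cmod ((Ln (w + 1) - (w + 1) / w) - (Ln w - w / w)) \<le> 8 / (cmod s + real n)\<^sup>2
        * cmod ((w + 1) - w)"
    proof (rule field_differentiable_bound[where S="closed_segment w (w + 1)"])
      fix u assume "u \<in> closed_segment w (w + 1)"
      then obtain t where t: "0 \<le> t" "t \<le> 1" "u = w + of_real t"
        by (auto simp: closed_segment_def algebra_simps scaleR_conv_of_real)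
      have un: "cmod u \<ge> (cmod s + real n) / 4" and u0: "u \<notin> \<real>\<^sub>\<le>\<^sub>0"
        using far[OF t(1,2)] by (auto simp: t(3) w_def)
      have nz: "u \<noteq> 0" "w \<noteq> 0" using un wn pos by auto
      show "((\<lambda>u. Ln u - u / w) has_field_derivative (inverse u - 1 / w))
          (at u within closed_segment w (w + 1))"
        using u0 nz by (auto intro!: derivative_eq_intros simp: field_simps)
      have "inverse u - 1 / w = - of_real t / (u * w)" using nz t(3) by (simp add: field_simps)
      then have "cmod (inverse u - 1 / w) = t / (cmod u * cmod w)" using t
          by (simp add: norm_divide norm_mult)
      also have "\<dots> \<le> 1 / (((cmod s + real n) / 4) * ((cmod s + real n) / 2))"
        using t un wn pos by (intro frac_le mult_mono mult_pos_pos) auto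
      finally show "cmod (inverse u - 1 / w) \<le> 8 / (cmod s + real n)\<^sup>2" by (simp add: power2_eq_square)
    qed auto
    moreover have "w \<noteq> 0" using wn pos by auto
    ultimately show ?thesis by (simp add: a_def w_def field_simps)
  qed
  have sums: "a sums (Digamma s - Ln s)"
  proof -
    \<comment> \<open>The limit formula for Digamma contains ln m whereas the telescoping produces
      Ln (s + m).\<close>
    have "(\<lambda>m. Ln (s + of_nat m) - of_real (ln (real m))) \<longlonglongrightarrow> 0"
    proof -
      have "(\<lambda>m. s / of_nat m + 1) \<longlonglongrightarrow> 0 + 1"
        by (intro tendsto_add tendsto_const tendsto_divide_0[OF tendsto_const] tendsto_of_nat)
      then have "(\<lambda>m. Ln (s / of_nat m + 1)) \<longlonglongrightarrow> Ln 1"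
        by (intro tendsto_Ln) auto
      moreover have "\<forall>\<^sub>F m in sequentially. Ln (s / of_nat m + 1)
          = Ln (s + of_nat m) - of_real (ln (real m))"
        using eventually_gt_at_top[of 0]
      proof eventually_elim
        fix m :: nat assume m: "m > 0"
        have "s + of_nat m \<noteq> 0" using far(1)[of 0 m] s B by auto
        then have "Ln ((s + of_nat m) / of_real (real m)) = Ln (s + of_nat m) - of_real (ln (real m))"
          using m by (intro Ln_divide_of_real) auto
        then show "Ln (s / of_nat m + 1) = Ln (s + of_nat m) - of_real (ln (real m))"
          using m by (simp add: add_divide_distrib)
      qed
      ultimately show ?thesis by (simp add: tendsto_cong)
    qed
    moreover have "(\<lambda>m. of_real (ln (real m)) - (\<Sum>n<m. inverse (s + of_nat n))) \<longlonglongrightarrow> Digamma s"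
      using s B by (intro Digamma_LIMSEQ) auto
    ultimately have "(\<lambda>m. (Ln (s + of_nat m) - of_real (ln (real m)))
        + (of_real (ln (real m)) - (\<Sum>n<m. inverse (s + of_nat n))) - Ln s) \<longlonglongrightarrow> 0 + Digamma s - Ln s"
      by (intro tendsto_intros)
    moreover have "(\<Sum>n<m. a n) = (Ln (s + of_nat m) - of_real (ln (real m)))
        + (of_real (ln (real m)) - (\<Sum>n<m. inverse (s + of_nat n))) - Ln s" for m
      using sum_lessThan_telescope[of "\<lambda>n. Ln (s + of_nat n)" m]
      by (simp add: a_def sum_subtractf)
    ultimately show ?thesis by (simp add: sums_def)
  qed
  show ?thesis
    using sums_inverse_square_bound[OF sums b] s B by simp
qed

section \<open>Quotients of Gamma values at a bounded distance\<close>

text \<open>The whole segment satisfies the hypotheses of the Digamma bound with B = |\<delta>| and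
  avoids both the poles and the branch cut, even if \<open>\<alpha> + \<delta>\<close> leaves the
  right half plane.\<close>

lemma segment_far:
  fixes \<alpha> \<delta> :: complex
  assumes \<alpha>: "Re \<alpha> > 0" "cmod \<alpha> \<ge> 8 * cmod \<delta> + 8" and z: "z \<in> closed_segment \<alpha> (\<alpha> + \<delta>)"
  shows "cmod z \<ge> cmod \<alpha> / 2" "Re z \<ge> - cmod \<delta>" "cmod z \<ge> 4 * cmod \<delta> + 4" "z \<notin> \<real>\<^sub>\<le>\<^sub>0" "z \<notin> \<int>\<^sub>\<le>\<^sub>0"
proof -
  from z obtain t where t: "0 \<le> t" "t \<le> 1" "z = \<alpha> + t *\<^sub>R \<delta>"
    by (auto simp: closed_segment_def algebra_simps)
  have n: "cmod (t *\<^sub>R \<delta>) \<le> cmod \<delta>" using t mult_right_mono[of t 1 "cmod \<delta>"] by simp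
  have "cmod \<alpha> \<le> cmod z + cmod (t *\<^sub>R \<delta>)" using norm_triangle_ineq4[of z "t *\<^sub>R \<delta>"] t by simp
  then have 1: "cmod z \<ge> cmod \<alpha> - cmod \<delta>" using n by linarith
  then show "cmod z \<ge> cmod \<alpha> / 2" using \<alpha> norm_ge_zero[of \<delta>] by linarith
  show 2: "cmod z \<ge> 4 * cmod \<delta> + 4" using 1 \<alpha> norm_ge_zero[of \<delta>] by linarith
  have "\<bar>Re (t *\<^sub>R \<delta>)\<bar> \<le> cmod \<delta>" using abs_Re_le_cmod[of "t *\<^sub>R \<delta>"] n by linarith
  then show 3: "Re z \<ge> - cmod \<delta>" using \<alpha> t by (auto simp: abs_le_iff)
  have "cmod z > cmod \<delta>" using 2 norm_ge_zero[of \<delta>] by linarith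
  with 3 show "z \<notin> \<real>\<^sub>\<le>\<^sub>0" "z \<notin> \<int>\<^sub>\<le>\<^sub>0"
    using not_nonpos_Reals_far not_nonpos_Ints_far by auto
qed

lemma Ln_diff_bound:
  fixes \<alpha> \<delta> :: complex
  assumes \<alpha>: "Re \<alpha> > 0" "cmod \<alpha> \<ge> 8 * cmod \<delta> + 8" and z: "z \<in> closed_segment \<alpha> (\<alpha> + \<delta>)"
  shows "cmod (Ln z - Ln \<alpha>) \<le> 2 * cmod \<delta> / cmod \<alpha>"
proof -
  have a0: "cmod \<alpha> > 0" using \<alpha>(1) by (intro zero_less_norm_iff[THEN iffD2]) auto
  have "cmod (Ln z - Ln \<alpha>) \<le> 2 / cmod \<alpha> * cmod (z - \<alpha>)"
  proof (rule field_differentiable_bound[where S="closed_segment \<alpha> (\<alpha> + \<delta>)"])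
    fix w assume w: "w \<in> closed_segment \<alpha> (\<alpha> + \<delta>)"
    show "(Ln has_field_derivative inverse w) (at w within closed_segment \<alpha> (\<alpha> + \<delta>))"
      using segment_far(4)[OF \<alpha> w] by (auto intro!: derivative_eq_intros)
    have "cmod (inverse w) \<le> inverse (cmod \<alpha> / 2)"
      using segment_far(1)[OF \<alpha> w] a0 unfolding norm_inverse by (intro le_imp_inverse_le) auto
    then show "cmod (inverse w) \<le> 2 / cmod \<alpha>" by (simp add: field_simps)
  qed (use z in auto)
  also have "\<dots> \<le> 2 / cmod \<alpha> * cmod \<delta>"
    using segment_bound(1)[OF z] a0 by (intro mult_left_mono) auto
  finally show ?thesis by simp
qed

text \<open>Gamma \<alpha> / Gamma (\<alpha> + \<delta>) behaves like \<alpha> powr (- \<delta>). In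
  the quotient the exponential factors of Stirling's formula cancel, so a mean value estimate for
  ln_Gamma z - z Ln \<alpha> along the segment suffices; its derivative Digamma z - Ln \<alpha> is
  bounded. The term with \<open>pi\<close> comes from Im \<delta> times the argument of
  \<alpha>.\<close>

lemma Gamma_quotient_bound:
  fixes \<alpha> \<delta> :: complex
  assumes \<alpha>: "Re \<alpha> > 0" "cmod \<alpha> \<ge> 8 * cmod \<delta> + 8"
  shows "cmod (Gamma \<alpha> * rGamma (\<alpha> + \<delta>)) \<le> exp ((32 + 2 * cmod \<delta>) * cmod \<delta> + pi * cmod \<delta>)
      * cmod \<alpha> powr (- Re \<delta>)"
proof -
  let ?S = "closed_segment \<alpha> (\<alpha> + \<delta>)"
  have a0: "\<alpha> \<noteq> 0" using \<alpha>(1) by auto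
  have a1: "cmod \<alpha> \<ge> 1" using \<alpha>(2) norm_ge_zero[of \<delta>] by linarith
  have nz: "\<alpha> \<notin> \<int>\<^sub>\<le>\<^sub>0" "\<alpha> + \<delta> \<notin> \<int>\<^sub>\<le>\<^sub>0" using segment_far(5)[OF \<alpha>] by auto
  have "cmod ((ln_Gamma \<alpha> - \<alpha> * Ln \<alpha>) - (ln_Gamma (\<alpha> + \<delta>) - (\<alpha> + \<delta>) * Ln \<alpha>))
      \<le> (32 + 2 * cmod \<delta>) * cmod (\<alpha> - (\<alpha> + \<delta>))"
  proof (rule field_differentiable_bound[where S="?S"])
    fix z assume z: "z \<in> ?S"
    note far = segment_far[OF \<alpha> z]
    show "((\<lambda>z. ln_Gamma z - z * Ln \<alpha>) has_field_derivative (Digamma z - Ln \<alpha>)) (at z within ?S)"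
      using far by (auto intro!: derivative_eq_intros has_field_derivative_at_within[OF
          has_field_derivative_ln_Gamma_complex])
    have "cmod (Digamma z - Ln z) \<le> 16 / cmod z"
      by (rule Digamma_Ln_bound[of "cmod \<delta>"]) (use far in auto)
    also have "\<dots> \<le> 16 / (1/2)" using far(1) a1 by (intro divide_left_mono mult_pos_pos) auto
    finally have 1: "cmod (Digamma z - Ln z) \<le> 32" by simp
    have "cmod (Ln z - Ln \<alpha>) \<le> 2 * cmod \<delta> / cmod \<alpha>" by (rule Ln_diff_bound[OF \<alpha> z])
    also have "\<dots> \<le> 2 * cmod \<delta> / 1" using a1 by (intro divide_left_mono) auto
    finally have 2: "cmod (Ln z - Ln \<alpha>) \<le> 2 * cmod \<delta>" by simp
    show "cmod (Digamma z - Ln \<alpha>) \<le> 32 + 2 * cmod \<delta>"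
      using norm_triangle_ineq[of "Digamma z - Ln z" "Ln z - Ln \<alpha>"] 1 2 by simp
  qed auto
  then have b: "cmod (ln_Gamma \<alpha> - ln_Gamma (\<alpha> + \<delta>) + \<delta> * Ln \<alpha>) \<le> (32 + 2 * cmod \<delta>) * cmod \<delta>"
    by (simp add: algebra_simps)
  have "Gamma \<alpha> * rGamma (\<alpha> + \<delta>) = exp (ln_Gamma \<alpha> - ln_Gamma (\<alpha> + \<delta>))"
    using nz by (simp add: rGamma_inverse_Gamma Gamma_complex_altdef exp_diff field_simps)
  then have "cmod (Gamma \<alpha> * rGamma (\<alpha> + \<delta>)) = exp (Re (ln_Gamma \<alpha> - ln_Gamma (\<alpha> + \<delta>)))"
    by simp
  also have "\<dots> \<le> exp ((32 + 2 * cmod \<delta>) * cmod \<delta> + pi * cmod \<delta> + (- Re \<delta>) * ln (cmod \<alpha>))"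
  proof -
    have "Re (ln_Gamma \<alpha> - ln_Gamma (\<alpha> + \<delta>) + \<delta> * Ln \<alpha>) \<le> (32 + 2 * cmod \<delta>) * cmod \<delta>"
      by (rule order_trans[OF complex_Re_le_cmod b])
    moreover have "Re (\<delta> * Ln \<alpha>) = Re \<delta> * ln (cmod \<alpha>) - Im \<delta> * Im (Ln \<alpha>)"
      using a0 by simp
    moreover have "Im \<delta> * Im (Ln \<alpha>) \<le> pi * cmod \<delta>"
    proof -
      have "\<bar>Im (Ln \<alpha>)\<bar> \<le> pi" using mpi_less_Im_Ln[OF a0] Im_Ln_le_pi[OF a0] by auto
      then have "\<bar>Im \<delta>\<bar> * \<bar>Im (Ln \<alpha>)\<bar> \<le> cmod \<delta> * pi"
        by (intro mult_mono abs_Im_le_cmod) auto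
      then show ?thesis by (simp add: abs_mult[symmetric] mult.commute)
    qed
    ultimately show ?thesis by (simp add: Re_Ln[OF a0])
  qed
  also have "\<dots> = exp ((32 + 2 * cmod \<delta>) * cmod \<delta> + pi * cmod \<delta>) * cmod \<alpha> powr (- Re \<delta>)"
    using a0 by (subst exp_add) (simp add: powr_def)
  finally show ?thesis .
qed

section \<open>Symbols: oscillating functions with controlled logarithmic derivative\<close>

definition rho :: "int \<Rightarrow> real \<Rightarrow> real" where
  "rho k \<tau> = cmod (Complex (of_int k) \<tau>)"

text \<open>\<open>\<nu>\<close> is the coefficient of the phase \<open>\<tau> * ln (rho k \<tau> / 2)\<close> and \<open>- \<eta>\<close> the order of decay; the
  bounds on the logarithmic derivative \<open>M\<close> are what integration by parts needs.\<close>

definition symbol_at ::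
    "real \<Rightarrow> real \<Rightarrow> (int \<Rightarrow> real \<Rightarrow> complex) \<Rightarrow> (int \<Rightarrow> real \<Rightarrow> complex) \<Rightarrow> (int \<Rightarrow> real \<Rightarrow> complex)
      \<Rightarrow> (int \<Rightarrow> real \<Rightarrow> complex) \<Rightarrow> real \<Rightarrow> int \<Rightarrow> real \<Rightarrow> bool" where
  "symbol_at \<nu> \<eta> F M M1 M2 C k \<tau> \<longleftrightarrow>
     (F k has_vector_derivative M k \<tau> * F k \<tau>) (at \<tau>) \<and>
     (M k has_vector_derivative M1 k \<tau>) (at \<tau>) \<and>
     (M1 k has_vector_derivative M2 k \<tau>) (at \<tau>) \<and>
     cmod (M k \<tau> - \<i> * of_real (\<nu> * ln (rho k \<tau> / 2))) \<le> C / rho k \<tau> \<and>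
     cmod (M1 k \<tau>) \<le> C / rho k \<tau> \<and>
     cmod (M2 k \<tau>) \<le> C / (rho k \<tau>)\<^sup>2 \<and>
     cmod (F k \<tau>) \<le> C * rho k \<tau> powr (- \<eta>)"

text \<open>\<open>C\<close> and \<open>R\<close> are chosen before \<open>k\<close>, so the
  estimates are uniform in \<open>k\<close>, which the summation over \<open>k\<close> relies on.
  Continuity is required on the whole line because \<open>symbol_at\<close> is demanded only outside
  radius \<open>R\<close>.\<close>

definition symbol_on :: "int set \<Rightarrow> real \<Rightarrow> real \<Rightarrow> (int \<Rightarrow> real \<Rightarrow> complex) \<Rightarrow> bool" where
  "symbol_on S \<nu> \<eta> F \<longleftrightarrow> (\<forall>k\<in>S. continuous_on UNIV (F k)) \<and>
     (\<exists>M M1 M2 C R. C > 0 \<and> R \<ge> 1 \<and> (\<forall>k\<in>S. \<forall>\<tau>. rho k \<tau> \<ge> R \<longrightarrow> symbol_at \<nu> \<eta> F M M1 M2 C k \<tau>))"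

lemma has_vector_derivative_chain:
  fixes f :: "real \<Rightarrow> complex"
  assumes "(g has_field_derivative g') (at (f x))" "(f has_vector_derivative f') (at x)"
  shows "((\<lambda>x. g (f x)) has_vector_derivative f' * g') (at x)"
  using field_vector_diff_chain_at[OF assms(2,1)] by (simp add: o_def)

text \<open>The sign of the exponent is not known in the application: the summand 1 serves p \<ge>
  0, the other one p < 0.\<close>

lemma powr_comparable:
  fixes x \<rho> p :: real
  assumes "\<rho> / 4 \<le> x" "x \<le> \<rho>" "\<rho> > 0"
  shows "x powr p \<le> (1 + 4 powr (- p)) * \<rho> powr p"
proof (cases "p \<ge> 0")
  case True
  then have "x powr p \<le> \<rho> powr p" using assms by (intro powr_mono2) auto
  also have "\<dots> \<le> (1 + 4 powr (- p)) * \<rho> powr p" by (simp add: distrib_right)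
  finally show ?thesis .
next
  case False
  then have "x powr p \<le> (\<rho> / 4) powr p" using assms by (intro powr_mono2') auto
  also have "\<dots> = 4 powr (- p) * \<rho> powr p" using assms by (simp add: powr_divide powr_minus field_simps)
  also have "\<dots> \<le> (1 + 4 powr (- p)) * \<rho> powr p" by (simp add: distrib_right)
  finally show ?thesis .
qed

text \<open>\<open>Gamma_C\<close> on the imaginary axis, in the form that is good for those
  \<open>k\<close> that put the first argument into the right half plane. The denominator is written
  with the entire function \<open>rGamma\<close>.\<close>

definition Gamma_quot :: "complex \<Rightarrow> complex \<Rightarrow> int \<Rightarrow> real \<Rightarrow> complex" where
  "Gamma_quot u u' k \<tau> = Gamma (u + (of_int k + \<i> * of_real \<tau>) / 2)
      * rGamma (1 - u' + (of_int k - \<i> * of_real \<tau>) / 2)"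

text \<open>The conjugate of the second argument \<open>\<beta>\<close> is
  \<open>\<alpha> + \<delta>\<close> with a constant \<open>\<delta>\<close>. Hence the modulus is a
  quotient of Gamma values at distance |\<delta>|, of order - Re \<delta>, while in the logarithmic
  derivative, \<i>/2 times Digamma \<alpha> + Digamma \<beta>, the imaginary parts of the two
  logarithms nearly cancel and leave \<i> ln |\<alpha>|.\<close>

lemma symbol_Gamma_quot:
  assumes m: "u - u' = of_int m" and e: "Re (u + u') > 0"
  shows "symbol_on {k. m + k \<ge> 0} 1 (1 - Re (u + u')) (Gamma_quot u u')"
proof -
  define \<delta> where "\<delta> = 1 - cnj u' - u"
  define \<alpha> where "\<alpha> k \<tau> = u + (of_int k + \<i> * of_real \<tau>) / 2" for k :: int and \<tau> :: real
  define \<beta> where "\<beta> k \<tau> = 1 - u' + (of_int k - \<i> * of_real \<tau>) / 2" for k :: int and \<tau> :: real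
  define M where "M k \<tau> = \<i> / 2 * (Digamma (\<alpha> k \<tau>) + Digamma (\<beta> k \<tau>))" for k \<tau>
  define M1 where "M1 k \<tau> = \<i> / 2 * (\<i> / 2 * Polygamma 1 (\<alpha> k \<tau>) + (- \<i> / 2) * Polygamma 1 (\<beta> k \<tau>))"
      for k \<tau>
  define M2 where "M2 k \<tau>
      = \<i> / 2 * (\<i> / 2 * (\<i> / 2 * Polygamma 2 (\<alpha> k \<tau>)) + (- \<i> / 2)
          * ((- \<i> / 2) * Polygamma 2 (\<beta> k \<tau>)))" for k \<tau>
  define E where "E = exp ((32 + 2 * cmod \<delta>) * cmod \<delta> + pi * cmod \<delta>)"
  \<comment> \<open>Since |\<alpha>| is at least rho/2 - |u|, this radius gives both |\<alpha>|
    \<ge> rho/4 and the hypothesis |\<alpha>| \<ge> 8 |\<delta>| + 8 of the segment lemmas.\<close>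
  define R where "R = 4 * cmod u + 4 * (8 * cmod \<delta> + 8)"
  \<comment> \<open>The sum of the constants found below for \<open>M\<close>, \<open>M2\<close> and
    the function itself; the 24 needed for \<open>M1\<close> is covered by 192.\<close>
  define C where "C = 192 + 8 * cmod \<delta> + 8 * cmod u + 320 + E * (1 + 4 powr (- (- Re \<delta>)))"
  have E: "E > 0" by (simp add: E_def)
  then have C: "C > 0" unfolding C_def by (intro add_pos_pos add_pos_nonneg mult_pos_pos) auto
  have ER: "E * (1 + 4 powr (- (- Re \<delta>))) > 0" using E by (intro mult_pos_pos add_pos_nonneg) auto
  have R: "R \<ge> 32" by (simp add: R_def)
  \<comment> \<open>Twice this real part is Re (u + u') + (m + k); this is where the restriction to
    m + k \<ge> 0 comes from.\<close>
  have Re\<alpha>: "Re (\<alpha> k \<tau>) > 0" if "m + k \<ge> 0" for k \<tau>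
  proof -
    have "Re u - Re u' = of_int m" using m
        by (metis Re_complex_of_real complex_Re_of_int minus_complex.sel(1))
    then have "2 * Re (\<alpha> k \<tau>) = Re (u + u') + of_int (m + k)" by (simp add: \<alpha>_def)
    moreover have "(of_int (m + k) :: real) \<ge> 0" using that by linarith
    ultimately show ?thesis using e by linarith
  qed
  have \<alpha>nz: "\<alpha> k \<tau> \<notin> \<int>\<^sub>\<le>\<^sub>0" if "m + k \<ge> 0" for k \<tau>
    using Re\<alpha>[OF that, of \<tau>] by (auto elim!: nonpos_Ints_cases')
  have cnj\<beta>: "cnj (\<beta> k \<tau>) = \<alpha> k \<tau> + \<delta>" for k \<tau>
    by (simp add: \<alpha>_def \<beta>_def \<delta>_def field_simps)
  have F: "Gamma_quot u u' k \<tau> = Gamma (\<alpha> k \<tau>) * rGamma (\<beta> k \<tau>)" for k \<tau>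
    by (simp add: Gamma_quot_def \<alpha>_def \<beta>_def)
  have d\<alpha>: "(\<alpha> k has_vector_derivative \<i> / 2) (at \<tau>)" for k \<tau>
    unfolding \<alpha>_def by (auto intro!: derivative_eq_intros simp: field_simps)
  have d\<beta>: "(\<beta> k has_vector_derivative - \<i> / 2) (at \<tau>)" for k \<tau>
    unfolding \<beta>_def by (auto intro!: derivative_eq_intros simp: field_simps)
  have cont: "continuous_on UNIV (Gamma_quot u u' k)" if "m + k \<ge> 0" for k
    unfolding Gamma_quot_def using \<alpha>nz[OF that] unfolding \<alpha>_def
    by (intro continuous_at_imp_continuous_on ballI continuous_intros) auto
  have "symbol_at 1 (1 - Re (u + u')) (Gamma_quot u u') M M1 M2 C k \<tau>"
    if k: "m + k \<ge> 0" and \<rho>R: "rho k \<tau> \<ge> R" for k \<tau>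
  proof -
    let ?a = "\<alpha> k \<tau>" and ?b = "\<beta> k \<tau>" and ?\<rho> = "rho k \<tau>"
    have \<rho>: "?\<rho> \<ge> 32" using R \<rho>R by linarith
    have w: "cmod ((of_int k + \<i> * of_real \<tau>) / 2) = ?\<rho> / 2"
      by (simp add: rho_def norm_divide Complex_eq)
    have a_lo: "cmod ?a \<ge> ?\<rho> / 2 - cmod u"
      using norm_triangle_ineq4[of ?a u] w by (simp add: \<alpha>_def)
    have a_hi: "cmod ?a \<le> ?\<rho> / 2 + cmod u"
      using norm_triangle_ineq[of u "(of_int k + \<i> * of_real \<tau>) / 2"] w by (simp add: \<alpha>_def)
    have a4: "cmod ?a \<ge> ?\<rho> / 4" using a_lo \<rho>R norm_ge_zero[of \<delta>] unfolding R_def by argo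
    have a\<delta>: "cmod ?a \<ge> 8 * cmod \<delta> + 8" using a4 \<rho>R norm_ge_zero[of u] unfolding R_def by argo
    have a\<rho>: "cmod ?a \<le> ?\<rho>" using a_hi \<rho>R norm_ge_zero[of \<delta>] norm_ge_zero[of u] unfolding R_def by argo
    note A = Re\<alpha>[OF k, of \<tau>] a\<delta>
    have ga: "?a \<in> closed_segment ?a (?a + \<delta>)" and gb: "cnj ?b \<in> closed_segment ?a (?a + \<delta>)"
      by (auto simp: cnj\<beta>)
    note fa = segment_far[OF A ga] and fb = segment_far[OF A gb]
    have b8: "cmod ?b \<ge> ?\<rho> / 8" using fb(1) a4 by simp
    have bnz: "?b \<notin> \<int>\<^sub>\<le>\<^sub>0" "?b \<notin> \<real>\<^sub>\<le>\<^sub>0"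
      using fb not_nonpos_Ints_far[of "cmod \<delta>" ?b] not_nonpos_Reals_far[of "cmod \<delta>" ?b]
          norm_ge_zero[of \<delta>] by auto
    note anz = \<alpha>nz[OF k, of \<tau>]
    have pos: "cmod ?a > 0" "cmod ?b > 0" using a4 b8 \<rho> by linarith+
    have 1: "(Gamma_quot u u' k has_vector_derivative M k \<tau> * Gamma_quot u u' k \<tau>) (at \<tau>)"
    proof -
      have "((\<lambda>\<tau>. Gamma (\<alpha> k \<tau>) * rGamma (\<beta> k \<tau>)) has_vector_derivative
         Gamma ?a * (- \<i> / 2 * (- rGamma ?b * Digamma ?b)) + \<i> / 2 * (Gamma ?a * Digamma ?a)
             * rGamma ?b) (at \<tau>)"
        by (intro has_vector_derivative_mult has_vector_derivative_chain[OF _ d\<alpha>]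
            has_vector_derivative_chain[OF _ d\<beta>]
             has_field_derivative_Gamma has_field_derivative_rGamma_no_nonpos_int anz bnz)
      then show ?thesis unfolding F[abs_def] M_def
        by (rule has_vector_derivative_eq_rhs) (simp add: algebra_simps)
    qed
    have 2: "(M k has_vector_derivative M1 k \<tau>) (at \<tau>)"
      unfolding M_def[abs_def] M1_def One_nat_def
      by (intro has_vector_derivative_mult_right has_vector_derivative_add
          has_vector_derivative_chain[OF _ d\<alpha>] has_vector_derivative_chain[OF _ d\<beta>]
           has_field_derivative_Polygamma anz bnz)
    have 3: "(M1 k has_vector_derivative M2 k \<tau>) (at \<tau>)"
      unfolding M1_def[abs_def] M2_def One_nat_def numeral_2_eq_2
      by (intro has_vector_derivative_mult_right has_vector_derivative_add
          has_vector_derivative_chain[OF _ d\<alpha>] has_vector_derivative_chain[OF _ d\<beta>]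
           has_field_derivative_Polygamma anz bnz)
    have inva: "1 / cmod ?a \<le> 4 / ?\<rho>" using a4 pos \<rho> by (simp add: field_simps)
    have invb: "1 / cmod ?b \<le> 8 / ?\<rho>" using b8 pos \<rho> by (simp add: field_simps)
    have sa: "Re ?a \<ge> - cmod \<delta>" "cmod ?a \<ge> 4 * cmod \<delta> + 2" "cmod ?a \<ge> 4 * cmod \<delta>" "cmod ?a \<ge> 1"
      and sb: "Re ?b \<ge> - cmod \<delta>" "cmod ?b \<ge> 4 * cmod \<delta> + 2" "cmod ?b \<ge> 4 * cmod \<delta>" "cmod ?b \<ge> 1"
      using fa(2,3) fb(2,3) norm_ge_zero[of \<delta>] by (auto simp del: norm_ge_zero)
    have Da: "cmod (Digamma ?a - Ln ?a) \<le> 64 / ?\<rho>"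
      using Digamma_Ln_bound[OF norm_ge_zero sa(1,2)] inva by simp
    have Db: "cmod (Digamma ?b - Ln ?b) \<le> 128 / ?\<rho>"
      using Digamma_Ln_bound[OF norm_ge_zero sb(1,2)] invb by simp
    have 4: "cmod (M k \<tau> - \<i> * of_real (1 * ln (?\<rho> / 2))) \<le> (192 + 8 * cmod \<delta> + 8 * cmod u) / ?\<rho>"
    proof -
      \<comment> \<open>Off the branch cut Ln commutes with conjugation, so Ln ?a + Ln ?b equals 2
        ln |?a| up to the variation of Ln on the segment.\<close>
      have Lb: "Ln ?b = cnj (Ln (cnj ?b))" using cnj_Ln[of "cnj ?b"] fb(4) by simp
      have "Ln ?a + cnj (Ln ?a) = of_real (2 * ln (cmod ?a))"
        using pos by (simp add: complex_add_cnj)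
      then have La: "Ln ?a + Ln ?b = of_real (2 * ln (cmod ?a)) + cnj (Ln (cnj ?b) - Ln ?a)"
        unfolding Lb by (simp add: algebra_simps)
      let ?X = "(Digamma ?a - Ln ?a) + (Digamma ?b - Ln ?b)
          + (cnj (Ln (cnj ?b) - Ln ?a) + of_real (2 * (ln (cmod ?a) - ln (?\<rho> / 2))))"
      have key: "x + y = r + c \<Longrightarrow> (d - x) + (e - y) + (c + (r - s))
          = d + e - s" for x y r c d e s :: complex
        by (simp add: algebra_simps)
      have "of_real (2 * (ln (cmod ?a) - ln (?\<rho> / 2)))
          = (of_real (2 * ln (cmod ?a)) - of_real (2 * ln (?\<rho> / 2)) :: complex)"
        by (simp add: algebra_simps)
      then have "?X = Digamma ?a + Digamma ?b - of_real (2 * ln (?\<rho> / 2))"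
        using key[OF La] by (simp only:)
      then have "M k \<tau> - \<i> * of_real (1 * ln (?\<rho> / 2)) = \<i> / 2 * ?X"
        by (simp only:) (simp add: M_def algebra_simps)
      moreover have "cmod (\<i> / 2 * X) = 1 / 2 * cmod X" for X
        by (simp add: norm_mult norm_divide)
      ultimately have "cmod (M k \<tau> - \<i> * of_real (1 * ln (?\<rho> / 2))) = 1 / 2 * cmod ?X"
        by (simp only:)
      also have "\<dots> \<le> 1 / 2 * (64 / ?\<rho> + 128 / ?\<rho> + (8 * cmod \<delta> / ?\<rho> + 8 * cmod u / ?\<rho>))"
      proof (intro mult_left_mono norm_triangle_le add_mono Da Db)
        show "cmod (cnj (Ln (cnj ?b) - Ln ?a)) \<le> 8 * cmod \<delta> / ?\<rho>"
        proof -
          have "cmod (Ln (cnj ?b) - Ln ?a) \<le> 2 * cmod \<delta> / cmod ?a" by (rule Ln_diff_bound[OF A gb])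
          also have "\<dots> = 2 * cmod \<delta> * (1 / cmod ?a)" by simp
          also have "\<dots> \<le> 2 * cmod \<delta> * (4 / ?\<rho>)" by (intro mult_left_mono inva) simp
          finally show ?thesis by (simp del: complex_cnj_diff)
        qed
        \<comment> \<open>Used in both directions for |?a| and rho/2, which differ by at most
          |u|.\<close>
        have ln_le: "ln x - ln y \<le> (x - y) / y" if "x > 0" "y > 0" for x y :: real
          using that ln_le_minus_one[of "x / y"] by (simp add: ln_div field_simps)
        have "\<bar>cmod ?a - ?\<rho> / 2\<bar> \<le> cmod u" using a_lo a_hi by linarith
        have "ln (cmod ?a) - ln (?\<rho> / 2) \<le> (cmod ?a - ?\<rho> / 2) / (?\<rho> / 2)" using pos \<rho>
            by (intro ln_le) auto
        also have "\<dots> \<le> cmod u / (?\<rho> / 2)" using a_hi \<rho> by (intro divide_right_mono) auto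
        also have "\<dots> \<le> 4 * cmod u / ?\<rho>" using \<rho> by (simp add: field_simps)
        finally have l1: "ln (cmod ?a) - ln (?\<rho> / 2) \<le> 4 * cmod u / ?\<rho>" .
        have "ln (?\<rho> / 2) - ln (cmod ?a) \<le> (?\<rho> / 2 - cmod ?a) / cmod ?a" using pos \<rho>
            by (intro ln_le) auto
        also have "\<dots> \<le> cmod u / cmod ?a" using a_lo pos by (intro divide_right_mono) auto
        also have "\<dots> = cmod u * (1 / cmod ?a)" by simp
        also have "\<dots> \<le> cmod u * (4 / ?\<rho>)" by (intro mult_left_mono inva) simp
        finally have l2: "ln (?\<rho> / 2) - ln (cmod ?a) \<le> 4 * cmod u / ?\<rho>" by (simp add: mult.commute)
        have "\<bar>2 * (ln (cmod ?a) - ln (?\<rho> / 2))\<bar> \<le> 8 * cmod u / ?\<rho>"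
          using l1 l2 by (intro abs_leI) auto
        then show "cmod (of_real (2 * (ln (cmod ?a) - ln (?\<rho> / 2)))) \<le> 8 * cmod u / ?\<rho>"
          unfolding norm_of_real .
      qed auto
      also have "\<dots> \<le> (192 + 8 * cmod \<delta> + 8 * cmod u) / ?\<rho>" using \<rho> by (simp add: field_simps)
      finally show ?thesis .
    qed
    have 5: "cmod (M1 k \<tau>) \<le> 24 / ?\<rho>"
    proof -
      have Pa: "cmod (Polygamma 1 ?a) \<le> 32 / ?\<rho>"
        using Polygamma_1_bound[OF sa(1,3) norm_ge_zero sa(4)] inva by simp
      have Pb: "cmod (Polygamma 1 ?b) \<le> 64 / ?\<rho>"
        using Polygamma_1_bound[OF sb(1,3) norm_ge_zero sb(4)] invb by simp
      have "cmod (M1 k \<tau>) = 1 / 2 * cmod (\<i> / 2 * Polygamma 1 ?a + (- \<i> / 2) * Polygamma 1 ?b)"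
        unfolding M1_def by (simp only: norm_mult norm_divide) simp
      also have "\<dots> \<le> 1 / 2 * (1 / 2 * (32 / ?\<rho>) + 1 / 2 * (64 / ?\<rho>))"
        using Pa Pb by (intro mult_left_mono norm_triangle_le add_mono)
            (auto simp: norm_mult norm_divide)
      finally show ?thesis by simp
    qed
    have 6: "cmod (M2 k \<tau>) \<le> 320 / ?\<rho>\<^sup>2"
    proof -
      have "(1 / cmod ?a)\<^sup>2 \<le> (4 / ?\<rho>)\<^sup>2" "(1 / cmod ?b)\<^sup>2 \<le> (8 / ?\<rho>)\<^sup>2"
        using inva invb by (auto intro!: power_mono)
      then have i: "1 / (cmod ?a)\<^sup>2 \<le> 16 / ?\<rho>\<^sup>2" "1 / (cmod ?b)\<^sup>2 \<le> 64 / ?\<rho>\<^sup>2"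
        by (simp_all add: power_divide)
      have Pa: "cmod (Polygamma 2 ?a) \<le> 512 / ?\<rho>\<^sup>2"
        using Polygamma_2_bound[OF sa(1,3) norm_ge_zero sa(4)] i by simp
      have Pb: "cmod (Polygamma 2 ?b) \<le> 2048 / ?\<rho>\<^sup>2"
        using Polygamma_2_bound[OF sb(1,3) norm_ge_zero sb(4)] i by simp
      have "cmod (M2 k \<tau>)
          = 1 / 2 * cmod (\<i> / 2 * (\<i> / 2 * Polygamma 2 ?a) + (- \<i> / 2) * ((- \<i> / 2) * Polygamma 2 ?b))"
        unfolding M2_def by (simp only: norm_mult norm_divide) simp
      also have "\<dots> \<le> 1 / 2 * (1 / 2 * (1 / 2 * (512 / ?\<rho>\<^sup>2)) + 1 / 2 * (1 / 2 * (2048 / ?\<rho>\<^sup>2)))"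
        using Pa Pb by (intro mult_left_mono norm_triangle_le add_mono)
            (auto simp: norm_mult norm_divide)
      finally show ?thesis by simp
    qed
    have 7: "cmod (Gamma_quot u u' k \<tau>) \<le> (E * (1 + 4 powr (- (- Re \<delta>))))
        * ?\<rho> powr (- (1 - Re (u + u')))"
    proof -
      have "cmod (rGamma ?b) = cmod (rGamma (?a + \<delta>))"
        using cnj_rGamma[of ?b] cnj\<beta>[of k \<tau>] by (metis complex_mod_cnj)
      then have "cmod (Gamma_quot u u' k \<tau>) = cmod (Gamma ?a * rGamma (?a + \<delta>))"
        by (simp add: F norm_mult)
      also have "\<dots> \<le> E * cmod ?a powr (- Re \<delta>)"
        unfolding E_def by (rule Gamma_quotient_bound[OF A])
      also have "\<dots> \<le> E * ((1 + 4 powr (- (- Re \<delta>))) * ?\<rho> powr (- Re \<delta>))"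
        using E \<rho> a4 a\<rho> by (intro mult_left_mono powr_comparable) auto
      finally have "cmod (Gamma_quot u u' k \<tau>) \<le> (E * (1 + 4 powr (- (- Re \<delta>)))) * ?\<rho> powr (- Re \<delta>)"
        by (simp only: mult.assoc)
      moreover have "Re \<delta> = 1 - Re (u + u')" by (simp add: \<delta>_def)
      ultimately show ?thesis by (simp only:)
    qed
    have C1: "192 + 8 * cmod \<delta> + 8 * cmod u \<le> C" "24 \<le> C" "320 \<le> C" "E * (1 + 4 powr (- (- Re \<delta>))) \<le> C"
      unfolding C_def using ER norm_ge_zero[of \<delta>] norm_ge_zero[of u] by (auto simp del: norm_ge_zero)
    show ?thesis unfolding symbol_at_def
    proof (intro conjI 1 2 3)
      show "cmod (M k \<tau> - \<i> * of_real (1 * ln (?\<rho> / 2))) \<le> C / ?\<rho>"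
        by (rule order_trans[OF 4 divide_right_mono[OF C1(1)]]) (use \<rho> in simp)
      show "cmod (M1 k \<tau>) \<le> C / ?\<rho>"
        by (rule order_trans[OF 5 divide_right_mono[OF C1(2)]]) (use \<rho> in simp)
      show "cmod (M2 k \<tau>) \<le> C / ?\<rho>\<^sup>2"
        by (rule order_trans[OF 6 divide_right_mono[OF C1(3)]]) simp
      show "cmod (Gamma_quot u u' k \<tau>) \<le> C * ?\<rho> powr (- (1 - Re (u + u')))"
        by (rule order_trans[OF 7 mult_right_mono[OF C1(4)]]) simp
    qed
  qed
  then show ?thesis
    unfolding symbol_on_def using cont C R
    by (intro conjI exI[of _ M] exI[of _ M1] exI[of _ M2] exI[of _ C] exI[of _ R]) auto
qed

lemma rho_minus [simp]: "rho (- k) \<tau> = rho k \<tau>" "rho k (- \<tau>) = rho k \<tau>"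
  by (simp_all add: rho_def cmod_def)

lemma symbol_onI:
  assumes "\<And>k. k \<in> S \<Longrightarrow> continuous_on UNIV (F k)" "C > 0" "R \<ge> 1"
    and "\<And>k \<tau>. k \<in> S \<Longrightarrow> rho k \<tau> \<ge> R \<Longrightarrow> symbol_at \<nu> \<eta> F M M1 M2 C k \<tau>"
  shows "symbol_on S \<nu> \<eta> F"
  unfolding symbol_on_def using assms by blast

lemma symbol_onE:
  assumes "symbol_on S \<nu> \<eta> F"
  obtains M M1 M2 C R where "C > 0" "R \<ge> 1"
    "\<And>k \<tau>. k \<in> S \<Longrightarrow> rho k \<tau> \<ge> R \<Longrightarrow> symbol_at \<nu> \<eta> F M M1 M2 C k \<tau>"
  using assms unfolding symbol_on_def by blast

lemma symbol_atD:
  assumes "symbol_at \<nu> \<eta> F M M1 M2 C k \<tau>"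
  shows "(F k has_vector_derivative M k \<tau> * F k \<tau>) (at \<tau>)"
    and "(M k has_vector_derivative M1 k \<tau>) (at \<tau>)"
    and "(M1 k has_vector_derivative M2 k \<tau>) (at \<tau>)"
    and "cmod (M k \<tau> - \<i> * of_real (\<nu> * ln (rho k \<tau> / 2))) \<le> C / rho k \<tau>"
    and "cmod (M1 k \<tau>) \<le> C / rho k \<tau>"
    and "cmod (M2 k \<tau>) \<le> C / (rho k \<tau>)\<^sup>2"
    and "cmod (F k \<tau>) \<le> C * rho k \<tau> powr (- \<eta>)"
  using assms unfolding symbol_at_def by blast+

lemma symbol_on_continuous: "symbol_on S \<nu> \<eta> F \<Longrightarrow> k \<in> S \<Longrightarrow> continuous_on UNIV (F k)"
  by (simp add: symbol_on_def)

lemma symbol_on_one: "symbol_on S 0 0 (\<lambda>_ _. 1)"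
  by (rule symbol_onI[where M="\<lambda>_ _. 0" and ?M1.0="\<lambda>_ _. 0" and ?M2.0="\<lambda>_ _. 0" and C=1 and R=1])
    (auto simp: symbol_at_def rho_def)

text \<open>Logarithmic derivatives add, so the phase coefficients and the orders of decay add as
  well. In the constant \<open>E\<close> the sum C + D serves the derivatives and the product C * D
  the modulus.\<close>

lemma symbol_on_mult:
  assumes F: "symbol_on S \<nu> \<eta> F" and G: "symbol_on S \<nu>' \<eta>' G"
  shows "symbol_on S (\<nu> + \<nu>') (\<eta> + \<eta>') (\<lambda>k \<tau>. F k \<tau> * G k \<tau>)"
proof -
  obtain M M1 M2 C R where f: "C > 0" "R \<ge> 1"
    "\<And>k \<tau>. k \<in> S \<Longrightarrow> rho k \<tau> \<ge> R \<Longrightarrow> symbol_at \<nu> \<eta> F M M1 M2 C k \<tau>"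
    using F by (rule symbol_onE) blast
  obtain N N1 N2 D Q where g: "D > 0" "Q \<ge> 1"
    "\<And>k \<tau>. k \<in> S \<Longrightarrow> rho k \<tau> \<ge> Q \<Longrightarrow> symbol_at \<nu>' \<eta>' G N N1 N2 D k \<tau>"
    using G by (rule symbol_onE) blast
  define E where "E = C + D + C * D"
  have E: "C + D \<le> E" "C * D \<le> E" "E > 0" using f(1) g(1) by (auto simp: E_def add_pos_pos)
  show ?thesis
  proof (rule symbol_onI[where M="\<lambda>k \<tau>. M k \<tau> + N k \<tau>" and ?M1.0="\<lambda>k \<tau>. M1 k \<tau> + N1 k \<tau>"
          and ?M2.0="\<lambda>k \<tau>. M2 k \<tau> + N2 k \<tau>" and C=E and R="max R Q"])
    fix k assume "k \<in> S"
    then show "continuous_on UNIV (\<lambda>\<tau>. F k \<tau> * G k \<tau>)"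
      using symbol_on_continuous[OF F] symbol_on_continuous[OF G] by (intro continuous_intros) auto
  next
    fix k \<tau> assume k: "k \<in> S" and "max R Q \<le> rho k \<tau>"
    then have r: "R \<le> rho k \<tau>" "Q \<le> rho k \<tau>" by auto
    have \<rho>: "rho k \<tau> > 0" using r f(2) by linarith
    note f' = symbol_atD[OF f(3)[OF k r(1)]] and g' = symbol_atD[OF g(3)[OF k r(2)]]
    show "symbol_at (\<nu> + \<nu>') (\<eta> + \<eta>') (\<lambda>k \<tau>. F k \<tau> * G k \<tau>) (\<lambda>k \<tau>. M k \<tau> + N k \<tau>) (\<lambda>k \<tau>. M1 k \<tau>
        + N1 k \<tau>) (\<lambda>k \<tau>. M2 k \<tau> + N2 k \<tau>) E k \<tau>"
      unfolding symbol_at_def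
    proof (intro conjI)
      show "((\<lambda>\<tau>. F k \<tau> * G k \<tau>) has_vector_derivative (M k \<tau> + N k \<tau>) * (F k \<tau> * G k \<tau>)) (at \<tau>)"
        by (rule has_vector_derivative_eq_rhs[OF has_vector_derivative_mult[OF f'(1) g'(1)]])
            (simp add: algebra_simps)
      show "((\<lambda>\<tau>. M k \<tau> + N k \<tau>) has_vector_derivative M1 k \<tau> + N1 k \<tau>) (at \<tau>)"
        "((\<lambda>\<tau>. M1 k \<tau> + N1 k \<tau>) has_vector_derivative M2 k \<tau> + N2 k \<tau>) (at \<tau>)"
        by (intro has_vector_derivative_add f' g')+
      have le: "C / x + D / x \<le> E / x" if "x > 0" for x
        using that E(1) by (simp add: add_divide_distrib[symmetric] divide_right_mono)
      have "M k \<tau> + N k \<tau> - \<i> * of_real ((\<nu> + \<nu>') * ln (rho k \<tau> / 2)) =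
          (M k \<tau> - \<i> * of_real (\<nu> * ln (rho k \<tau> / 2))) + (N k \<tau> - \<i> * of_real (\<nu>' * ln (rho k \<tau> / 2)))"
        by (simp add: algebra_simps)
      then show "cmod (M k \<tau> + N k \<tau> - \<i> * of_real ((\<nu> + \<nu>') * ln (rho k \<tau> / 2))) \<le> E / rho k \<tau>"
        using norm_triangle_mono[OF f'(4) g'(4)] le[OF \<rho>] by (simp only:)
      show "cmod (M1 k \<tau> + N1 k \<tau>) \<le> E / rho k \<tau>"
        by (rule order_trans[OF norm_triangle_mono[OF f'(5) g'(5)] le[OF \<rho>]])
      show "cmod (M2 k \<tau> + N2 k \<tau>) \<le> E / (rho k \<tau>)\<^sup>2"
        by (rule order_trans[OF norm_triangle_mono[OF f'(6) g'(6)] le]) (use \<rho> in simp)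
      have "cmod (F k \<tau> * G k \<tau>) \<le> (C * rho k \<tau> powr (- \<eta>)) * (D * rho k \<tau> powr (- \<eta>'))"
        unfolding norm_mult using f(1) by (intro mult_mono f' g') auto
      also have "\<dots> = (C * D) * rho k \<tau> powr (- (\<eta> + \<eta>'))"
        using \<rho> by (simp add: powr_add[symmetric])
      also have "\<dots> \<le> E * rho k \<tau> powr (- (\<eta> + \<eta>'))"
        using E by (intro mult_right_mono) auto
      finally show "cmod (F k \<tau> * G k \<tau>) \<le> E * rho k \<tau> powr (- (\<eta> + \<eta>'))" .
    qed
  qed (use f g E in auto)
qed

text \<open>The unimodular \<open>c k\<close> is the sign produced by the reflection formula; being
  constant in \<open>\<tau>\<close>, it leaves the logarithmic derivative unchanged.\<close>

lemma symbol_on_flip: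
  assumes F: "symbol_on S \<nu> \<eta> F" and c: "\<And>k. cmod (c k) = 1"
  shows "symbol_on (uminus ` S) \<nu> \<eta> (\<lambda>k \<tau>. c k * F (- k) \<tau>)"
proof -
  obtain M M1 M2 C R where f: "C > 0" "R \<ge> 1"
    "\<And>k \<tau>. k \<in> S \<Longrightarrow> rho k \<tau> \<ge> R \<Longrightarrow> symbol_at \<nu> \<eta> F M M1 M2 C k \<tau>"
    using F by (rule symbol_onE) blast
  show ?thesis
  proof (rule symbol_onI[where M="\<lambda>k \<tau>. M (- k) \<tau>" and ?M1.0="\<lambda>k \<tau>. M1 (- k) \<tau>" and ?M2.0="\<lambda>k \<tau>. M2
      (- k) \<tau>" and C=C and R=R])
    fix k assume "k \<in> uminus ` S"
    then have "continuous_on UNIV (F (- k))" by (auto intro: symbol_on_continuous[OF F])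
    then show "continuous_on UNIV (\<lambda>\<tau>. c k * F (- k) \<tau>)" by (intro continuous_intros)
  next
    fix k \<tau> assume "k \<in> uminus ` S" "rho k \<tau> \<ge> R"
    then have "- k \<in> S" "rho (- k) \<tau> \<ge> R" by auto
    note f' = symbol_atD[OF f(3)[OF this]]
    show "symbol_at \<nu> \<eta> (\<lambda>k \<tau>. c k * F (- k) \<tau>) (\<lambda>k \<tau>. M (- k) \<tau>) (\<lambda>k \<tau>. M1 (- k) \<tau>)
        (\<lambda>k \<tau>. M2 (- k) \<tau>) C k \<tau>"
      unfolding symbol_at_def
    proof (intro conjI)
      show "((\<lambda>\<tau>. c k * F (- k) \<tau>) has_vector_derivative M (- k) \<tau> * (c k * F (- k) \<tau>)) (at \<tau>)"
        by (rule has_vector_derivative_eq_rhs[OF has_vector_derivative_mult_right[OF f'(1)]]) simp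
      show "(M (- k) has_vector_derivative M1 (- k) \<tau>) (at \<tau>)"
          "(M1 (- k) has_vector_derivative M2 (- k) \<tau>) (at \<tau>)"
        by (rule f')+
      show "cmod (M (- k) \<tau> - \<i> * of_real (\<nu> * ln (rho k \<tau> / 2))) \<le> C / rho k \<tau>"
        "cmod (M1 (- k) \<tau>) \<le> C / rho k \<tau>" "cmod (M2 (- k) \<tau>) \<le> C / (rho k \<tau>)\<^sup>2"
        "cmod (c k * F (- k) \<tau>) \<le> C * rho k \<tau> powr (- \<eta>)"
        using f'(4-) by (simp_all add: norm_mult c)
    qed
  qed (use f in auto)
qed

text \<open>Reversing \<open>\<tau>\<close> reverses the phase. With \<open>k\<close> reversed too,
  this turns the factors belonging to the upper list into those of the lower list; it also reduces
  the left half line to the right one.\<close>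

lemma symbol_on_reflect:
  assumes F: "symbol_on UNIV \<nu> \<eta> F"
  shows "symbol_on UNIV (- \<nu>) \<eta> (\<lambda>k \<tau>. F (- k) (- \<tau>))"
proof -
  obtain M M1 M2 C R where f: "C > 0" "R \<ge> 1"
    "\<And>k \<tau>. k \<in> UNIV \<Longrightarrow> rho k \<tau> \<ge> R \<Longrightarrow> symbol_at \<nu> \<eta> F M M1 M2 C k \<tau>"
    using F by (rule symbol_onE) blast
  have neg: "((\<lambda>\<tau>. h (- \<tau>)) has_vector_derivative - h') (at \<tau>)" if "(h has_vector_derivative h')
      (at (- \<tau>))" for h :: "real \<Rightarrow> complex" and h' \<tau>
  proof -
    have "(h \<circ> uminus has_vector_derivative (-1) *\<^sub>R h') (at \<tau>)"
      by (rule vector_diff_chain_at) (auto intro!: derivative_eq_intros that)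
    then show ?thesis by (simp add: o_def)
  qed
  show ?thesis
  proof (rule symbol_onI[where M="\<lambda>k \<tau>. - M (- k) (- \<tau>)" and ?M1.0="\<lambda>k \<tau>. M1 (- k) (- \<tau>)"
      and ?M2.0="\<lambda>k \<tau>. - M2 (- k) (- \<tau>)" and C=C and R=R])
    fix k :: int
    show "continuous_on UNIV (\<lambda>\<tau>. F (- k) (- \<tau>))"
      by (rule continuous_on_compose2[OF symbol_on_continuous[OF F UNIV_I]])
          (auto intro!: continuous_intros)
  next
    fix k :: int and \<tau> assume "rho k \<tau> \<ge> R"
    then have "rho (- k) (- \<tau>) \<ge> R" by simp
    note f' = symbol_atD[OF f(3)[OF UNIV_I this]]
    show "symbol_at (- \<nu>) \<eta> (\<lambda>k \<tau>. F (- k) (- \<tau>)) (\<lambda>k \<tau>. - M (- k) (- \<tau>)) (\<lambda>k \<tau>. M1 (- k) (- \<tau>))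
        (\<lambda>k \<tau>. - M2 (- k) (- \<tau>)) C k \<tau>"
      unfolding symbol_at_def
    proof (intro conjI)
      show "((\<lambda>\<tau>. F (- k) (- \<tau>)) has_vector_derivative - M (- k) (- \<tau>) * F (- k) (- \<tau>)) (at \<tau>)"
        using neg[OF f'(1)] by simp
      show "((\<lambda>\<tau>. - M (- k) (- \<tau>)) has_vector_derivative M1 (- k) (- \<tau>)) (at \<tau>)"
        using has_vector_derivative_minus[OF neg[OF f'(2)]] by simp
      show "((\<lambda>\<tau>. M1 (- k) (- \<tau>)) has_vector_derivative - M2 (- k) (- \<tau>)) (at \<tau>)"
        by (rule neg[OF f'(3)])
      show "cmod (- M (- k) (- \<tau>) - \<i> * of_real (- \<nu> * ln (rho k \<tau> / 2))) \<le> C / rho k \<tau>"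
        using f'(4) norm_minus_cancel[of "M (- k) (- \<tau>) - \<i> * of_real (\<nu> * ln (rho k \<tau> / 2))"] by simp
      show "cmod (M1 (- k) (- \<tau>)) \<le> C / rho k \<tau>" "cmod (- M2 (- k) (- \<tau>)) \<le> C / (rho k \<tau>)\<^sup>2"
        "cmod (F (- k) (- \<tau>)) \<le> C * rho k \<tau> powr (- \<eta>)"
        using f'(5-) by simp_all
    qed
  qed (use f in auto)
qed

text \<open>Glues two formulas valid for complementary ranges of \<open>k\<close>; each has its own
  logarithmic derivative, but the sum of the constants and the larger radius are common to
  both.\<close>

lemma symbol_on_Un:
  assumes F: "symbol_on S \<nu> \<eta> F" and G: "symbol_on T \<nu> \<eta> G"
    and H: "\<And>k. k \<in> S \<Longrightarrow> H k = F k" "\<And>k. k \<notin> S \<Longrightarrow> k \<in> T" "\<And>k. k \<notin> S \<Longrightarrow> H k = G k"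
  shows "symbol_on UNIV \<nu> \<eta> H"
proof -
  obtain M M1 M2 C R where f: "C > 0" "R \<ge> 1"
    "\<And>k \<tau>. k \<in> S \<Longrightarrow> rho k \<tau> \<ge> R \<Longrightarrow> symbol_at \<nu> \<eta> F M M1 M2 C k \<tau>"
    using F by (rule symbol_onE) blast
  obtain N N1 N2 D Q where g: "D > 0" "Q \<ge> 1"
    "\<And>k \<tau>. k \<in> T \<Longrightarrow> rho k \<tau> \<ge> Q \<Longrightarrow> symbol_at \<nu> \<eta> G N N1 N2 D k \<tau>"
    using G by (rule symbol_onE) blast
  let ?E = "C + D"
  have le: "x \<le> ?E / r" if "x \<le> C / r \<or> x \<le> D / r" "r > 0" for x r
  proof -
    have "C / r \<le> ?E / r" "D / r \<le> ?E / r" using that f(1) g(1) by (auto intro!: divide_right_mono)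
    then show ?thesis using that by linarith
  qed
  have le': "x \<le> ?E * r" if "x \<le> C * r \<or> x \<le> D * r" "r \<ge> 0" for x r
  proof -
    have "C * r \<le> ?E * r" "D * r \<le> ?E * r" using that f(1) g(1) by (auto intro!: mult_right_mono)
    then show ?thesis using that by linarith
  qed
  show ?thesis
  proof (rule symbol_onI[where M="\<lambda>k. if k \<in> S then M k else N k" and ?M1.0="\<lambda>k. if k \<in> S then M1 k
      else N1 k"
       and ?M2.0="\<lambda>k. if k \<in> S then M2 k else N2 k" and C="?E" and R="max R Q"])
    fix k show "continuous_on UNIV (H k)"
      using symbol_on_continuous[OF F, of k] symbol_on_continuous[OF G, of k] H[of k]
          by (cases "k \<in> S") auto
  next
    fix k \<tau> assume "max R Q \<le> rho k \<tau>"
    then have r: "R \<le> rho k \<tau>" "Q \<le> rho k \<tau>" by auto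
    have "rho k \<tau> > 0" "(rho k \<tau>)\<^sup>2 > 0" using r f(2) by auto
    note le1 = le[OF _ this(1)] and le2 = le[OF _ this(2)]
    show "symbol_at \<nu> \<eta> H (\<lambda>k. if k \<in> S then M k else N k) (\<lambda>k. if k \<in> S then M1 k else N1 k)
        (\<lambda>k. if k \<in> S then M2 k else N2 k) ?E k \<tau>"
    proof (cases "k \<in> S")
      case True
      note f' = symbol_atD[OF f(3)[OF True r(1)]]
      show ?thesis using f' H(1)[OF True] True unfolding symbol_at_def
        by (auto intro!: le1 le2 le')
    next
      case False
      note g' = symbol_atD[OF g(3)[OF H(2)[OF False] r(2)]]
      show ?thesis using g' H(3)[OF False] False unfolding symbol_at_def
        by (auto intro!: le1 le2 le')
    qed
  qed (use f g in auto)
qed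

section \<open>The kernel as a symbol\<close>

text \<open>Euler's reflection formula exchanges the two arguments at the cost of the sign (-1)^n,
  written as a cosine to fit the addition theorem. It is applied at nearby points where
  \<open>a + h\<close> is no integer; the right side is analytic at h = 0, so it gives the value at
  the removable singularity.\<close>

lemma Gamma_C_swap:
  assumes n: "a - a' = of_int n" and a': "a' \<notin> \<int>\<^sub>\<le>\<^sub>0"
  shows "Gamma_C (a, a') = cos (of_real pi * of_int n) * (Gamma a' * rGamma (1 - a))"
proof -
  let ?c = "cos (of_real pi * of_int n) :: complex"
  have s0: "sin (of_real pi * of_int n :: complex) = 0"
    unfolding sin_eq_0 by (intro exI[of _ n]) simp
  have ev: "\<forall>\<^sub>F h in at 0. Gamma (a + h) / Gamma (1 - (a' + h))
      = ?c * (Gamma (a' + h) * rGamma (1 - (a + h)))"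
  proof -
    \<comment> \<open>Distinct integers have distance at least 1, and a point outside the closed set
      of integers has a neighbourhood outside it.\<close>
    have "\<forall>\<^sub>F h in at 0. a + h \<notin> \<int>"
    proof (cases "a \<in> \<int>")
      case True
      have "\<forall>\<^sub>F h in at (0::complex). dist h 0 < 1 \<and> h \<noteq> 0"
        by (auto simp: eventually_at intro!: exI[of _ 1])
      then show ?thesis
      proof eventually_elim
        fix h :: complex assume h: "dist h 0 < 1 \<and> h \<noteq> 0"
        show "a + h \<notin> \<int>"
        proof
          assume "a + h \<in> \<int>"
          then have "h \<in> \<int>" using Ints_diff[OF _ True, of "a + h"] by simp
          then obtain j where "h = of_int j" by (elim Ints_cases)
          then show False using h by auto
        qed
      qed
    next
      case False
      have "open (- \<int> :: complex set)" by (simp add: open_Compl)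
      moreover have "((\<lambda>h. a + h) \<longlongrightarrow> a + 0) (at 0)" by (intro tendsto_intros)
      ultimately show ?thesis using False topological_tendstoD[of "\<lambda>h. a + h" a "at 0" "- \<int>"] by simp
    qed
    then show ?thesis
    proof eventually_elim
      fix h assume h: "a + h \<notin> \<int>"
      define x where "x = a + h"
      have y: "a' + h = x - of_int n" using n by (simp add: x_def algebra_simps)
      have xn: "x \<notin> \<int>" using h by (simp add: x_def)
      have "x - of_int n \<notin> \<int>"
      proof
        assume "x - of_int n \<in> \<int>"
        from Ints_add[OF this Ints_of_int[of n]] xn show False by simp
      qed
      then have gy: "Gamma (x - of_int n) * rGamma (x - of_int n) = 1" and gx: "Gamma x * rGamma x = 1"
        using xn nonpos_Ints_Int[of x] nonpos_Ints_Int[of "x - of_int n"]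
        by (auto simp: rGamma_inverse_Gamma Gamma_eq_zero_iff intro!: right_inverse)
      have "of_real pi * (x - of_int n) = of_real pi * x - of_real pi * of_int n"
          by (simp add: algebra_simps)
      then have sin: "sin (of_real pi * (x - of_int n)) = ?c * sin (of_real pi * x)"
        by (simp add: sin_diff s0)
      \<comment> \<open>Inserting Gamma y rGamma y = 1 for y = x - n produces rGamma y rGamma (1 -
        y), a multiple of sin (pi y) = (-1)^n sin (pi x); the reflection formula at \<open>x\<close>
        then turns the sine back.\<close>
      have "Gamma x * rGamma (1 - (x - of_int n)) = Gamma x * Gamma (x - of_int n)
          * (rGamma (x - of_int n) * rGamma (1 - (x - of_int n)))"
        using gy by (simp add: mult_ac)
      also have "\<dots> = ?c * (Gamma x * Gamma (x - of_int n) * (rGamma x * rGamma (1 - x)))"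
        unfolding rGamma_reflection_complex sin by simp
      also have "\<dots> = ?c * (Gamma (x - of_int n) * rGamma (1 - x))"
        using gx by (simp add: mult_ac)
      finally show "Gamma (a + h) / Gamma (1 - (a' + h)) = ?c * (Gamma (a' + h) * rGamma (1 - (a + h)))"
        unfolding y unfolding x_def[symmetric] by (simp add: rGamma_inverse_Gamma field_simps)
    qed
  qed
  have an: "(\<lambda>h. ?c * (Gamma (a' + h) * rGamma (1 - (a + h)))) analytic_on {0}"
    using a' by (auto intro!: analytic_intros analytic_on_compose_gen)
  have "Gamma_C (a, a') = remove_sings (\<lambda>h. ?c * (Gamma (a' + h) * rGamma (1 - (a + h)))) 0"
    unfolding Gamma_C_def using remove_sings_cong[OF ev refl] by simp
  also have "\<dots> = ?c * (Gamma a' * rGamma (1 - a))"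
    using remove_sings_at_analytic[OF an] by simp
  finally show ?thesis .
qed

lemma norm_cos_pi_int: "cmod (cos (of_real pi * of_int n)) = 1"
proof -
  have "sin (of_real pi * of_int n :: complex) = 0"
    unfolding sin_eq_0 by (intro exI[of _ n]) simp
  then have "(cos (of_real pi * of_int n :: complex))\<^sup>2 = 1"
    using sin_cos_squared_add[of "of_real pi * of_int n :: complex"] by simp
  then have "cmod (cos (of_real pi * of_int n)) ^ 2 = 1"
    by (simp flip: norm_power)
  then show ?thesis by (simp add: power2_eq_1_iff) (metis norm_ge_zero neg_0_le_iff_le not_one_le_zero)
qed

text \<open>For every \<open>k\<close> one of the two arguments has positive real part: the first if
  m + k \<ge> 0, the second otherwise. The swapped formula has the same order of decay because that
  order is symmetric in \<open>u\<close> and \<open>u'\<close>.\<close>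

lemma symbol_Gamma_C:
  assumes "(u, u') \<in> Lambda_C" and e: "Re (u + u') > 0"
  shows "symbol_on UNIV 1 (1 - Re (u + u'))
    (\<lambda>k \<tau>. Gamma_C (u + (of_int k + \<i> * of_real \<tau>) / 2, u' + (- of_int k + \<i> * of_real \<tau>) / 2))"
proof -
  from assms(1) obtain m where m: "u - u' = of_int m" by (auto simp: Lambda_C_def elim: Ints_cases)
  have m': "u' - u = of_int (- m)" using m by (metis minus_diff_eq of_int_minus)
  have Rem: "Re u - Re u'
      = of_int m" using m by (metis Re_complex_of_real complex_Re_of_int minus_complex.sel(1))
  have e': "Re (u' + u) > 0" using e by (simp add: add.commute)
  have G: "symbol_on (uminus ` {k. - m + k \<ge> 0}) 1 (1 - Re (u + u'))
     (\<lambda>k \<tau>. cos (of_real pi * of_int (m + k)) * Gamma_quot u' u (- k) \<tau>)"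
    using symbol_on_flip[OF symbol_Gamma_quot[OF m' e'] norm_cos_pi_int, of "\<lambda>k. m + k"]
        by (simp add: add.commute)
  have nonpos: "z \<notin> \<int>\<^sub>\<le>\<^sub>0" if "Re z > 0" for z :: complex
    using that by (auto elim!: nonpos_Ints_cases')
  show ?thesis
  proof (rule symbol_on_Un[OF symbol_Gamma_quot[OF m e] G])
    fix k assume "k \<in> {k. m + k \<ge> 0}"
    then have "(of_int (m + k) :: real) \<ge> 0" by simp
    then have "Re u + of_int k / 2 > 0" using Rem e by simp
    then show "(\<lambda>\<tau>. Gamma_C (u + (of_int k + \<i> * of_real \<tau>) / 2, u'
        + (- of_int k + \<i> * of_real \<tau>) / 2)) = Gamma_quot u u' k"
      by (intro ext, subst Gamma_C_eq, intro nonpos) (auto simp: Gamma_quot_def rGamma_inverse_Gamma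
          field_simps)
  next
    fix k assume k: "k \<notin> {k. m + k \<ge> 0}"
    then show "k \<in> uminus ` {k. - m + k \<ge> 0}" by (intro image_eqI[of _ _ "- k"]) auto
    have "(of_int (m + k) :: real) < 0" using k by simp
    \<comment> \<open>Twice this number is Re (u + u') - (m + k).\<close>
    then have re: "Re u' - of_int k / 2 > 0" using Rem e by simp
    show "(\<lambda>\<tau>. Gamma_C (u + (of_int k + \<i> * of_real \<tau>) / 2, u' + (- of_int k + \<i> * of_real \<tau>) / 2))
       = (\<lambda>\<tau>. cos (of_real pi * of_int (m + k)) * Gamma_quot u' u (- k) \<tau>)"
    proof
      fix \<tau>
      have "(u + (of_int k + \<i> * of_real \<tau>) / 2) - (u' + (- of_int k + \<i> * of_real \<tau>) / 2)
          = of_int (m + k)"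
        using m by (simp add: field_simps)
      from Gamma_C_swap[OF this nonpos] re
      show "Gamma_C (u + (of_int k + \<i> * of_real \<tau>) / 2, u' + (- of_int k + \<i> * of_real \<tau>) / 2)
         = cos (of_real pi * of_int (m + k)) * Gamma_quot u' u (- k) \<tau>"
        by (simp add: Gamma_quot_def algebra_simps add_divide_distrib diff_divide_distrib)
    qed
  qed
qed

lemma symbol_K_C:
  assumes "set a \<subseteq> Lambda_C" "set b \<subseteq> Lambda_C"
    and "\<And>u u'. (u, u') \<in> set a \<Longrightarrow> Re (u + u') > 0"
    and "\<And>u u'. (u, u') \<in> set b \<Longrightarrow> Re (u + u') > 0"
  shows "symbol_on UNIV (real (length a) - real (length b))
    (real (length b + length a) - ((\<Sum>(u, u')\<leftarrow>a. Re (u + u')) + (\<Sum>(u, u')\<leftarrow>b. Re (u + u'))))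
    (\<lambda>k \<tau>. K_C a b k (\<i> * of_real \<tau>))"
proof -
  let ?F = "\<lambda>u u' k \<tau>. Gamma_C (u + (of_int k + \<i> * of_real \<tau>) / 2, u'
      + (- of_int k + \<i> * of_real \<tau>) / 2)"
  let ?A = "\<lambda>a k \<tau>. \<Prod>(u, u')\<leftarrow>a. ?F u u' k \<tau>"
  have A: "symbol_on UNIV (real (length a)) (real (length a) - (\<Sum>(u, u')\<leftarrow>a. Re (u + u'))) (?A a)"
    if "set a \<subseteq> Lambda_C" "\<And>u u'. (u, u') \<in> set a \<Longrightarrow> Re (u + u') > 0" for a
    using that
  proof (induction a)
    case Nil
    then show ?case using symbol_on_one by simp
  next
    case (Cons x a)
    obtain u u' where x: "x = (u, u')" by (cases x)
    have "symbol_on UNIV 1 (1 - Re (u + u')) (?F u u')"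
      using Cons.prems by (intro symbol_Gamma_C) (auto simp: x)
    moreover have "symbol_on UNIV (real (length a)) (real (length a) - (\<Sum>(u, u')\<leftarrow>a. Re (u + u')))
        (?A a)"
      using Cons.prems by (intro Cons.IH) auto
    ultimately have "symbol_on UNIV (1 + real (length a)) ((1 - Re (u + u'))
        + (real (length a) - (\<Sum>(u, u')\<leftarrow>a. Re (u + u')))) (\<lambda>k \<tau>. ?F u u' k \<tau> * ?A a k \<tau>)"
      by (rule symbol_on_mult)
    then show ?case by (simp add: x algebra_simps)
  qed
  \<comment> \<open>The product over \<open>b\<close> is a product of the upper type evaluated at -k
    and -\<tau>, hence the sign of its phase coefficient.\<close>
  have "symbol_on UNIV (real (length a) + - real (length b))
     ((real (length a) - (\<Sum>(u, u')\<leftarrow>a. Re (u + u'))) + (real (length b) - (\<Sum>(u, u')\<leftarrow>b. Re (u + u'))))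
     (\<lambda>k \<tau>. ?A a k \<tau> * ?A b (- k) (- \<tau>))"
    using assms by (intro symbol_on_mult A symbol_on_reflect) auto
  then show ?thesis
    by (simp add: K_C_def algebra_simps)
qed

section \<open>Oscillatory integrals\<close>

text \<open>Completeness is used along the integers, and the same tail bound then carries the limit
  over to real \<open>S\<close>.\<close>

lemma convergent_at_top_of_tail:
  fixes g :: "real \<Rightarrow> complex"
  assumes g: "\<And>S T. A \<le> S \<Longrightarrow> S \<le> T \<Longrightarrow> cmod (g T - g S) \<le> h S" and h: "(h \<longlongrightarrow> 0) at_top"
  shows "\<exists>l. (g \<longlongrightarrow> l) at_top"
proof -
  have "Cauchy (\<lambda>n. g (real n))"
  proof (rule metric_CauchyI)
    fix e :: real assume "e > 0"
    then have "eventually (\<lambda>S. h S < e / 2) at_top" using order_tendstoD(2)[OF h, of "e / 2"] by simp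
    then obtain N where N: "\<And>S. S \<ge> N \<Longrightarrow> h S < e / 2" by (auto simp: eventually_at_top_linorder)
    define M where "M = nat \<lceil>max A N\<rceil>"
    have M: "real M \<ge> A" "real M \<ge> N" unfolding M_def by linarith+
    have *: "cmod (g (real n) - g (real M)) < e / 2" if "n \<ge> M" for n
      using g[of "real M" "real n"] N[of "real M"] M that by simp
    have "dist (g (real m)) (g (real n)) < e" if "m \<ge> M" "n \<ge> M" for m n
      using dist_triangle_half_l[of "g (real m)" "g (real M)" e "g (real n)"] *[OF that(1)] *[OF
          that(2)]
      by (simp add: dist_norm)
    then show "\<exists>M. \<forall>m\<ge>M. \<forall>n\<ge>M. dist (g (real m)) (g (real n)) < e" by blast
  qed
  then obtain l where l: "(\<lambda>n. g (real n)) \<longlonglongrightarrow> l" by (auto simp: Cauchy_convergent_iff convergent_def)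
  have le: "cmod (l - g S) \<le> h S" if "A \<le> S" for S
  proof (rule tendsto_upperbound)
    show "((\<lambda>n. cmod (g (real n) - g S)) \<longlongrightarrow> cmod (l - g S)) sequentially" by (intro tendsto_intros l)
    show "\<forall>\<^sub>F n in sequentially. cmod (g (real n) - g S) \<le> h S"
      using eventually_ge_at_top[of "nat \<lceil>S\<rceil>"]
          by eventually_elim (intro g that, simp add: nat_le_iff ceiling_le_iff)
  qed simp
  have "((\<lambda>S. l - g S) \<longlongrightarrow> 0) at_top"
    by (rule Lim_null_comparison[OF _ h]) (auto intro: eventually_mono[OF eventually_ge_at_top[of
        A]] le)
  then have "((\<lambda>S. l - (l - g S)) \<longlongrightarrow> l - 0) at_top" by (intro tendsto_intros)
  then show ?thesis by auto
qed

text \<open>Links the Henstock-Kurzweil integral in \<open>G_C\<close>, whose two ends move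
  independently, with the symmetric limits used in the Parseval identity.\<close>

lemma has_integral_UNIV_of_limits:
  fixes f :: "real \<Rightarrow> complex"
  assumes c: "continuous_on UNIV f"
    and P: "((\<lambda>T. integral {0..T} f) \<longlongrightarrow> P) at_top" and Q: "((\<lambda>T. integral {-T..0} f) \<longlongrightarrow> Q) at_top"
  shows "(f has_integral (P + Q)) UNIV" and "((\<lambda>T. integral {-T..T} f) \<longlongrightarrow> P + Q) at_top"
proof -
  have i: "f integrable_on {a..b}" for a b
    by (intro integrable_continuous_interval continuous_on_subset[OF c]) auto
  have split: "integral {a..b} f = integral {0..b} f + integral {a..0} f" if "a \<le> 0" "0 \<le> b" for a b
    using Henstock_Kurzweil_Integration.integral_combine[OF that i] by (simp add: add.commute)
  show "((\<lambda>T. integral {-T..T} f) \<longlongrightarrow> P + Q) at_top"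
  proof (rule Lim_transform_eventually[OF tendsto_add[OF P Q]])
    show "\<forall>\<^sub>F T in at_top. integral {0..T} f + integral {- T..0} f = integral {- T..T} f"
      using eventually_ge_at_top[of 0] by eventually_elim (subst split, auto)
  qed
  show "(f has_integral (P + Q)) UNIV"
    unfolding has_integral_alt'
  proof (intro conjI allI impI)
    show "(\<lambda>x. if x \<in> UNIV then f x else 0) integrable_on cbox a b" for a b
      using i by simp
    fix e :: real assume e: "e > 0"
    obtain M where M: "\<And>T. T \<ge> M \<Longrightarrow> cmod (integral {0..T} f - P) < e / 2"
      using tendstoD[OF P, of "e / 2"] e by (auto simp: eventually_at_top_linorder dist_norm)
    obtain N where N: "\<And>T. T \<ge> N \<Longrightarrow> cmod (integral {-T..0} f - Q) < e / 2"
      using tendstoD[OF Q, of "e / 2"] e by (auto simp: eventually_at_top_linorder dist_norm)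
    define B where "B = max 1 (max M N)"
    show "\<exists>B>0. \<forall>a b. ball 0 B \<subseteq> cbox a b \<longrightarrow> cmod
        (integral (cbox a b) (\<lambda>x. if x \<in> UNIV then f x else 0) - (P + Q)) < e"
    proof (intro exI[of _ B] conjI allI impI)
      show "B > 0" by (simp add: B_def)
      fix a b :: real assume sub: "ball 0 B \<subseteq> cbox a b"
      \<comment> \<open>Only an open ball is known to lie in the interval; its closure puts the
        endpoints -B and B inside.\<close>
      have "closure (ball 0 B) \<subseteq> cbox a b" by (intro closure_minimal sub closed_cbox)
      then have "cball 0 B \<subseteq> cbox a b" using \<open>B > 0\<close> by simp
      then have "B \<in> cbox a b" "- B \<in> cbox a b" using \<open>B > 0\<close> by (auto simp: subset_iff)
      then have ab: "a \<le> - B" "B \<le> b" by auto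
      have "cmod ((integral {0..b} f - P) + (integral {- (- a)..0} f - Q)) < e / 2 + e / 2"
        using M[of b] N[of "- a"] ab by (intro norm_triangle_lt add_strict_mono) (auto simp: B_def)
      then show "cmod (integral (cbox a b) (\<lambda>x. if x \<in> UNIV then f x else 0) - (P + Q)) < e"
        using split[of a b] ab \<open>B > 0\<close> by (simp add: algebra_simps)
    qed
  qed
qed

text \<open>The form in which integration by parts is used: \<open>G\<close> collects the boundary
  terms, which decay, and \<open>E\<close> the absolutely integrable remainder.\<close>

lemma integral_tail_bound:
  fixes f G E :: "real \<Rightarrow> complex"
  assumes c: "continuous_on UNIV f"
    and d: "\<And>t. t \<ge> A \<Longrightarrow> (G has_vector_derivative f t - E t) (at t)"
    and G: "\<And>t. t \<ge> A \<Longrightarrow> cmod (G t) \<le> K * t powr (- \<eta>)"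
    and E: "\<And>t. t \<ge> A \<Longrightarrow> cmod (E t) \<le> K' * t powr (- 1 - \<xi>)"
    and A: "A \<ge> 1" and \<eta>: "\<eta> > 0" and \<xi>: "\<xi> > 0" and K: "K \<ge> 0" "K' \<ge> 0" and ST: "A \<le> S" "S \<le> T"
  shows "cmod (integral {S..T} f) \<le> 2 * K * S powr (- \<eta>) + K' / \<xi> * S powr (- \<xi>)"
proof -
  have fi: "f integrable_on {S..T}"
    by (intro integrable_continuous_interval continuous_on_subset[OF c]) auto
  have G': "((\<lambda>t. f t - E t) has_integral (G T - G S)) {S..T}"
    using ST by (intro fundamental_theorem_of_calculus has_vector_derivative_at_within[OF d]) auto
  have "((\<lambda>t. f t - (f t - E t)) has_integral (integral {S..T} f - (G T - G S))) {S..T}"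
    by (intro has_integral_diff G' integrable_integral fi)
  then have E': "(E has_integral (integral {S..T} f - (G T - G S))) {S..T}" by simp
  have w: "((\<lambda>t. K' * t powr (- 1 - \<xi>)) has_integral (- (K' / \<xi>) * T powr (- \<xi>)
      - (- (K' / \<xi>) * S powr (- \<xi>)))) {S..T}"
  proof (rule fundamental_theorem_of_calculus[OF ST(2)])
    fix t assume t: "t \<in> {S..T}"
    then have "t > 0" using ST A by auto
    then show "((\<lambda>t. - (K' / \<xi>) * t powr (- \<xi>)) has_vector_derivative K' * t powr (- 1 - \<xi>))
        (at t within {S..T})"
      unfolding has_real_derivative_iff_has_vector_derivative[symmetric] using \<xi>
      by (auto intro!: derivative_eq_intros simp: powr_diff powr_minus field_simps)
  qed
  have "cmod (integral {S..T} f - (G T - G S)) \<le> - (K' / \<xi>) * T powr (- \<xi>)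
      - (- (K' / \<xi>) * S powr (- \<xi>))"
    unfolding integral_unique[OF E', symmetric] integral_unique[OF w, symmetric]
    by (rule integral_norm_bound_integral) (use E' w E ST in \<open>auto simp: has_integral_iff\<close>)
  also have "\<dots> \<le> K' / \<xi> * S powr (- \<xi>)" using K \<xi> by simp
  finally have 1: "cmod (integral {S..T} f - (G T - G S)) \<le> K' / \<xi> * S powr (- \<xi>)" .
  have "T powr (- \<eta>) \<le> S powr (- \<eta>)" using A ST \<eta> by (intro powr_mono2') auto
  from mult_left_mono[OF this K(1)] have "cmod (G T) \<le> K * S powr (- \<eta>)" using G[of T] ST by linarith
  moreover have "cmod (G S) \<le> K * S powr (- \<eta>)" using G[of S] ST by simp
  moreover have "cmod (integral {S..T} f) \<le> cmod (integral {S..T} f - (G T - G S))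
      + (cmod (G T) + cmod (G S))"
    using norm_triangle_ineq[of "integral {S..T} f - (G T - G S)" "G T
        - G S"] norm_triangle_ineq4[of "G T" "G S"] by simp
  ultimately show ?thesis using 1 by linarith
qed

text \<open>The result of two integrations by parts against the logarithmic derivative \<open>L\<close> of the
    integrand \<open>f\<close>.\<close>

lemma by_parts_twice:
  fixes f L L1 :: "real \<Rightarrow> complex"
  assumes f: "(f has_vector_derivative L t * f t) (at t)" and L: "(L has_vector_derivative L1 t) (at t)"
    and L1: "(L1 has_vector_derivative Ldd) (at t)" and nz: "L t \<noteq> 0"
  shows "((\<lambda>t. f t * inverse (L t) + L1 t * f t * inverse (L t) ^ 3) has_vector_derivative
     f t - f t * (3 * (L1 t)\<^sup>2 * inverse (L t) ^ 4 - Ldd * inverse (L t) ^ 3)) (at t)"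
proof -
  define g where "g = inverse (L t)"
  have i: "((\<lambda>t. inverse (L t)) has_vector_derivative L1 t * (- (g * g))) (at t)"
    unfolding g_def by (rule has_vector_derivative_chain[OF _ L])
        (use nz in \<open>auto intro!: derivative_eq_intros\<close>)
  have i3: "((\<lambda>t. inverse (L t) ^ 3) has_vector_derivative L1 t * (- (g * g)) * (3 * g\<^sup>2)) (at t)"
  proof -
    have "((\<lambda>z. z ^ 3) has_field_derivative (3 * g\<^sup>2)) (at (inverse (L t)))"
      unfolding g_def[symmetric] by (auto intro!: derivative_eq_intros)
    from has_vector_derivative_chain[OF this i] show ?thesis .
  qed
  have Lg: "L t * g = 1" using nz by (simp add: g_def)
  have "((\<lambda>t. f t * inverse (L t) + (L1 t * f t) * inverse (L t) ^ 3) has_vector_derivative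
    (f t * (L1 t * (- (g * g))) + (L t * f t) * inverse (L t)) +
    ((L1 t * f t) * (L1 t * (- (g * g)) * (3 * g\<^sup>2)) + (L1 t * (L t * f t) + Ldd * f t)
        * inverse (L t) ^ 3)) (at t)"
    by (intro has_vector_derivative_add has_vector_derivative_mult f i i3 L1)
  moreover have "(f t * (L1 t * (- (g * g))) + (L t * f t) * inverse (L t)) +
    ((L1 t * f t) * (L1 t * (- (g * g)) * (3 * g\<^sup>2)) + (L1 t * (L t * f t) + Ldd * f t)
        * inverse (L t) ^ 3)
    = f t - f t * (3 * (L1 t)\<^sup>2 * inverse (L t) ^ 4 - Ldd * inverse (L t) ^ 3)"
    unfolding g_def[symmetric] using Lg by algebra
  ultimately show ?thesis by simp
qed

section \<open>Estimates away from stationary points\<close>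

lemma powr_minus_2: "r > 0 \<Longrightarrow> (r::real) powr (- \<eta>) / r\<^sup>2 = r powr (- 2 - \<eta>)"
  by (simp add: powr_diff powr_minus field_simps)

lemma cis_has_vector_derivative: "((\<lambda>t. cis (- (t * x))) has_vector_derivative (- \<i> * of_real x)
    * cis (- (t * x))) (at t)"
proof -
  have "((\<lambda>t. exp (\<i> * of_real (- (t * x)))) has_vector_derivative (- \<i> * of_real x)
      * exp (\<i> * of_real (- (t * x)))) (at t)"
    by (rule has_vector_derivative_chain[THEN has_vector_derivative_eq_rhs, OF DERIV_exp])
      (auto intro!: derivative_eq_intros)
  then show ?thesis by (simp add: cis_conv_exp)
qed

text \<open>Integration by parts costs inverse powers of the lower bound \<open>c\<close> but gains
  two powers of \<open>rho\<close> in the remainder, one from each factor of \<open>M1\<close>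
  squared, or both from \<open>M2\<close>.\<close>

lemma nonstationary:
  assumes s: "symbol_at \<nu> \<eta> F M M1 M2 C k \<tau>" and C: "C > 0" and \<rho>: "rho k \<tau> \<ge> 1"
    and c: "c > 0" "cmod (M k \<tau> - \<i> * of_real x) \<ge> c"
  defines "f \<equiv> \<lambda>t. F k t * cis (- (t * x))" and "L \<equiv> \<lambda>t. M k t - \<i> * of_real x"
  defines "E \<equiv> \<lambda>t. f t * (3 * (M1 k t)\<^sup>2 * inverse (L t) ^ 4 - M2 k t * inverse (L t) ^ 3)"
    and "G \<equiv> \<lambda>t. f t * inverse (L t) + M1 k t * f t * inverse (L t) ^ 3"
  shows "(G has_vector_derivative f \<tau> - E \<tau>) (at \<tau>)"
    and "cmod (G \<tau>) \<le> (C / c + C\<^sup>2 / c ^ 3) * rho k \<tau> powr (- \<eta>)"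
    and "cmod (E \<tau>) \<le> (3 * C ^ 3 / c ^ 4 + C\<^sup>2 / c ^ 3) * rho k \<tau> powr (- 2 - \<eta>)"
proof -
  note s = symbol_atD[OF s]
  let ?r = "rho k \<tau>"
  have nz: "L \<tau> \<noteq> 0" using c by (auto simp: L_def)
  have df: "(f has_vector_derivative L \<tau> * f \<tau>) (at \<tau>)"
    unfolding f_def by (rule has_vector_derivative_mult[OF s(1) cis_has_vector_derivative, THEN
        has_vector_derivative_eq_rhs])
      (simp add: L_def algebra_simps)
  have dL: "(L has_vector_derivative M1 k \<tau>) (at \<tau>)"
    unfolding L_def using has_vector_derivative_diff[OF s(2) has_vector_derivative_const] by simp
  show "(G has_vector_derivative f \<tau> - E \<tau>) (at \<tau>)"
    unfolding G_def E_def by (rule by_parts_twice[OF df dL s(3) nz])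
  have fb: "cmod (f \<tau>) \<le> C * ?r powr (- \<eta>)" using s(7) by (simp add: f_def norm_mult)
  have f0: "C * ?r powr (- \<eta>) \<ge> 0" using C by simp
  have ib: "cmod (inverse (L \<tau>)) \<le> 1 / c"
    using c by (simp add: L_def norm_inverse le_imp_inverse_le divide_inverse)
  have ipow: "cmod (inverse (L \<tau>) ^ n) \<le> 1 / c ^ n" for n
    using power_mono[OF ib, of n] by (simp add: norm_power power_divide)
  have m1: "cmod (M1 k \<tau>) \<le> C / ?r" "cmod (M2 k \<tau>) \<le> C / ?r\<^sup>2" by (rule s)+
  have m1': "cmod (M1 k \<tau>) \<le> C" using m1(1) divide_left_mono[of 1 ?r C] C \<rho> by simp
  have "cmod (G \<tau>) \<le> (C * ?r powr (- \<eta>)) * (1 / c) + C * (C * ?r powr (- \<eta>)) * (1 / c ^ 3)"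
    unfolding G_def using C f0 c
    by (intro norm_triangle_le add_mono) (auto simp only: norm_mult intro!: mult_mono fb ib ipow m1'
        norm_ge_zero mult_nonneg_nonneg)
  then show "cmod (G \<tau>) \<le> (C / c + C\<^sup>2 / c ^ 3) * ?r powr (- \<eta>)"
    by (simp add: algebra_simps power2_eq_square)
  have "(cmod (M1 k \<tau>))\<^sup>2 \<le> C\<^sup>2 / ?r\<^sup>2" using power_mono[OF m1(1), of 2] by (simp add: power_divide)
  then have "cmod (3 * (M1 k \<tau>)\<^sup>2 * inverse (L \<tau>) ^ 4) \<le> 3 * (C\<^sup>2 / ?r\<^sup>2) * (1 / c ^ 4)"
    unfolding norm_mult norm_power[of "M1 k \<tau>"] using C c by (intro mult_mono ipow) auto
  moreover have "cmod (M2 k \<tau> * inverse (L \<tau>) ^ 3) \<le> (C / ?r\<^sup>2) * (1 / c ^ 3)"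
    unfolding norm_mult using C c by (intro mult_mono ipow m1) auto
  ultimately have "cmod (3 * (M1 k \<tau>)\<^sup>2 * inverse (L \<tau>) ^ 4 - M2 k \<tau> * inverse (L \<tau>) ^ 3)
      \<le> 3 * (C\<^sup>2 / ?r\<^sup>2) * (1 / c ^ 4) + (C / ?r\<^sup>2) * (1 / c ^ 3)"
    by (rule order_trans[OF norm_triangle_ineq4 add_mono])
  then have "cmod (E \<tau>) \<le> (C * ?r powr (- \<eta>)) * (3 * (C\<^sup>2 / ?r\<^sup>2) * (1 / c ^ 4) + (C / ?r\<^sup>2)
      * (1 / c ^ 3))"
    unfolding E_def norm_mult[of "f \<tau>"] using f0 by (intro mult_mono fb) auto
  also have "\<dots> = (3 * C ^ 3 / c ^ 4 + C\<^sup>2 / c ^ 3) * (?r powr (- \<eta>) / ?r\<^sup>2)"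
    by (simp add: algebra_simps power2_eq_square power3_eq_cube)
  also have "?r powr (- \<eta>) / ?r\<^sup>2 = ?r powr (- 2 - \<eta>)" using \<rho> by (intro powr_minus_2) auto
  finally show "cmod (E \<tau>) \<le> (3 * C ^ 3 / c ^ 4 + C\<^sup>2 / c ^ 3) * ?r powr (- 2 - \<eta>)" .
qed

text \<open>Two mechanisms: for \<open>\<nu> = 0\<close> the derivative of the kernel's phase dies
  out and the frequency \<open>x\<close> remains; for |\<nu>| \<ge> 1 the logarithm exceeds |x| + C
  + 1 and dominates both \<open>x\<close> and the error C / rho.\<close>

lemma log_derivative_lower_bound:
  assumes s: "symbol_at \<nu> \<eta> F M M1 M2 C k \<tau>" and C: "C > 0" and \<rho>: "rho k \<tau> \<ge> 1"
  shows "\<nu> = 0 \<Longrightarrow> x \<noteq> 0 \<Longrightarrow> rho k \<tau> \<ge> 2 * C / \<bar>x\<bar> \<Longrightarrow> cmod (M k \<tau> - \<i> * of_real x) \<ge> \<bar>x\<bar> / 2"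
    and "\<bar>\<nu>\<bar> \<ge> 1 \<Longrightarrow> rho k \<tau> \<ge> 2 * exp (\<bar>x\<bar> + C + 1) \<Longrightarrow> cmod (M k \<tau> - \<i> * of_real x) \<ge> 1"
proof -
  note m = symbol_atD(4)[OF s]
  have tri: "cmod (M k \<tau> - \<i> * of_real x) \<ge> \<bar>\<nu> * ln (rho k \<tau> / 2) - x\<bar> - C / rho k \<tau>"
  proof -
    have "\<bar>\<nu> * ln (rho k \<tau> / 2) - x\<bar> = cmod (\<i> * of_real (\<nu> * ln (rho k \<tau> / 2) - x))"
        by (simp add: norm_mult del: of_real_diff)
    also have "\<i> * of_real (\<nu> * ln (rho k \<tau> / 2) - x) = (M k \<tau> - \<i> * of_real x)
        - (M k \<tau> - \<i> * of_real (\<nu> * ln (rho k \<tau> / 2)))"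
      by (simp add: algebra_simps)
    also have "cmod \<dots> \<le> cmod (M k \<tau> - \<i> * of_real x) + C / rho k \<tau>"
      by (rule order_trans[OF norm_triangle_ineq4 add_left_mono[OF m]])
    finally show ?thesis by simp
  qed
  show "cmod (M k \<tau> - \<i> * of_real x) \<ge> \<bar>x\<bar> / 2" if "\<nu> = 0" "x \<noteq> 0" "rho k \<tau> \<ge> 2 * C / \<bar>x\<bar>"
  proof -
    have "C / rho k \<tau> \<le> \<bar>x\<bar> / 2" using that \<rho> by (simp add: field_simps)
    then show ?thesis using tri that by simp
  qed
  show "cmod (M k \<tau> - \<i> * of_real x) \<ge> 1" if \<nu>: "\<bar>\<nu>\<bar> \<ge> 1" and r: "rho k \<tau> \<ge> 2 * exp (\<bar>x\<bar> + C + 1)"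
  proof -
    have l: "ln (rho k \<tau> / 2) \<ge> \<bar>x\<bar> + C + 1"
      using r \<rho> by (subst ln_ge_iff) auto
    then have "\<bar>\<nu> * ln (rho k \<tau> / 2)\<bar> \<ge> \<bar>x\<bar> + C + 1"
      using mult_mono[OF \<nu> l] C unfolding abs_mult by auto
    moreover have "C / rho k \<tau> \<le> C" using divide_left_mono[of 1 "rho k \<tau>" C] C \<rho> by simp
    moreover have "\<bar>\<nu> * ln (rho k \<tau> / 2) - x\<bar> \<ge> \<bar>\<nu> * ln (rho k \<tau> / 2)\<bar> - \<bar>x\<bar>" by simp
    ultimately show ?thesis using tri by linarith
  qed
qed

lemma rho_ge: "rho k \<tau> \<ge> \<bar>\<tau>\<bar>" "rho k \<tau> \<ge> \<bar>of_int k\<bar>"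
  using abs_Im_le_cmod[of "Complex (of_int k) \<tau>"] abs_Re_le_cmod[of "Complex (of_int k) \<tau>"]
  by (simp_all add: rho_def)

lemma rho_power2: "(rho k \<tau>)\<^sup>2 = (of_int k)\<^sup>2 + \<tau>\<^sup>2"
  by (simp add: rho_def cmod_power2)

lemma symbol_bounded:
  assumes F: "symbol_on UNIV \<nu> \<eta> F" and \<eta>: "\<eta> > 0"
  obtains B where "B > 0" "\<And>\<tau>. cmod (F k \<tau>) \<le> B"
proof -
  obtain M M1 M2 C R where f: "C > 0" "R \<ge> 1"
    "\<And>k \<tau>. k \<in> UNIV \<Longrightarrow> rho k \<tau> \<ge> R \<Longrightarrow> symbol_at \<nu> \<eta> F M M1 M2 C k \<tau>"
    using F by (rule symbol_onE) blast
  have "compact (F k ` {-R..R})"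
    by (intro compact_continuous_image continuous_on_subset[OF symbol_on_continuous[OF F]]) auto
  then obtain B where B: "\<And>y. y \<in> F k ` {-R..R} \<Longrightarrow> cmod y \<le> B"
    using compact_imp_bounded bounded_iff by metis
  have "cmod (F k \<tau>) \<le> max B C" for \<tau>
  proof (cases "\<tau> \<in> {-R..R}")
    case True
    then show ?thesis using B[of "F k \<tau>"] by auto
  next
    case False
    then have r: "rho k \<tau> \<ge> R" using rho_ge(1)[of \<tau> k] by auto
    have "rho k \<tau> powr (- \<eta>) \<le> 1" using r f(2) \<eta> powr_mono[of "- \<eta>" 0 "rho k \<tau>"] by simp
    then have "C * rho k \<tau> powr (- \<eta>) \<le> C" using f(1) by (simp add: mult_left_le)
    then show ?thesis using symbol_atD(7)[OF f(3)[OF UNIV_I r]] by simp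
  qed
  then show ?thesis using f(1) by (intro that[of "max B C"]) auto
qed

abbreviation wave :: "(int \<Rightarrow> real \<Rightarrow> complex) \<Rightarrow> int \<Rightarrow> real \<Rightarrow> real \<Rightarrow> complex" where
  "wave F k x \<equiv> \<lambda>t. F k t * cis (- (t * x))"

lemma symbol_integrand_continuous:
  assumes "symbol_on UNIV \<nu> \<eta> F"
  shows "continuous_on A (wave F k x)"
  using continuous_on_subset[OF symbol_on_continuous[OF assms, of k], of A]
      by (intro continuous_intros) auto

text \<open>On the ray, rho k t \<ge> t, so the negative powers of \<open>rho\<close> become powers
  of \<open>t\<close>, uniformly in \<open>k\<close>.\<close>

lemma oscillatory_tail:
  assumes F: "symbol_on UNIV \<nu> \<eta> F" and \<eta>: "\<eta> > 0"
    and s: "\<And>\<tau>. rho k \<tau> \<ge> A \<Longrightarrow> symbol_at \<nu> \<eta> F M M1 M2 C k \<tau>" and C: "C > 0" and A: "A \<ge> 1"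
    and c: "c > 0" "\<And>\<tau>. rho k \<tau> \<ge> A \<Longrightarrow> cmod (M k \<tau> - \<i> * of_real x) \<ge> c"
    and ST: "A \<le> S" "S \<le> T"
  shows "cmod (integral {S..T} (wave F k x))
    \<le> 2 * (C / c + C\<^sup>2 / c ^ 3) * S powr (- \<eta>) + (3 * C ^ 3 / c ^ 4 + C\<^sup>2 / c ^ 3) / (1 + \<eta>)
        * S powr (- (1 + \<eta>))"
proof -
  have r: "rho k t \<ge> A" if "t \<ge> A" for t using rho_ge(1)[of t k] that by simp
  have r1: "rho k t \<ge> 1" if "t \<ge> A" for t using r[OF that] A by simp
  note ns = nonstationary[OF s[OF r] C r1 c(1) c(2)[OF r]]
  have dec: "K * rho k t powr p \<le> K * t powr p" if "t \<ge> A" "p \<le> 0" "K \<ge> 0" for t p K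
    using that A rho_ge(1)[of t k] by (intro mult_left_mono powr_mono2') auto
  show ?thesis
  proof (rule integral_tail_bound)
    show "continuous_on UNIV (wave F k x)" by (rule symbol_integrand_continuous[OF F])
    fix t assume t: "t \<ge> A"
    show "((\<lambda>t. F k t * cis (- (t * x)) * inverse (M k t - \<i> * of_real x)
           + M1 k t * (F k t * cis (- (t * x))) * inverse (M k t - \<i> * of_real x) ^ 3)
               has_vector_derivative
        F k t * cis (- (t * x)) - F k t * cis (- (t * x))
            * (3 * (M1 k t)\<^sup>2 * inverse (M k t - \<i> * of_real x) ^ 4 - M2 k t
                * inverse (M k t - \<i> * of_real x) ^ 3)) (at t)"
      by (rule ns(1)[OF t t t])
    show "cmod (F k t * cis (- (t * x)) * inverse (M k t - \<i> * of_real x)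
           + M1 k t * (F k t * cis (- (t * x))) * inverse (M k t - \<i> * of_real x) ^ 3)
               \<le> (C / c + C\<^sup>2 / c ^ 3) * t powr (- \<eta>)"
      by (rule order_trans[OF ns(2)[OF t t t] dec]) (use t \<eta> C c(1) in auto)
    show "cmod (F k t * cis (- (t * x)) * (3 * (M1 k t)\<^sup>2 * inverse (M k t - \<i> * of_real x) ^ 4
        - M2 k t * inverse (M k t - \<i> * of_real x) ^ 3))
       \<le> (3 * C ^ 3 / c ^ 4 + C\<^sup>2 / c ^ 3) * t powr (- 1 - (1 + \<eta>))"
      using order_trans[OF ns(3)[OF t t t] dec[of t "- 2 - \<eta>"]] t \<eta> C c(1) by simp
  qed (use ST A \<eta> C c in auto)
qed

text \<open>For \<open>\<nu> = 0\<close> a single integration by parts against the exponential alone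
  is better near x = 0: it starts at a radius independent of \<open>x\<close> and costs only 1 /
  |x|, whereas the double one would cost higher powers.\<close>

lemma stationary_tail:
  assumes F: "symbol_on UNIV 0 \<eta> F" and \<eta>: "\<eta> > 0"
    and s: "\<And>\<tau>. rho k \<tau> \<ge> R \<Longrightarrow> symbol_at 0 \<eta> F M M1 M2 C k \<tau>" and C: "C > 0" and R: "R \<ge> 1"
    and x: "x \<noteq> 0" and ST: "R \<le> S" "S \<le> T"
  shows "cmod (integral {S..T} (wave F k x)) \<le> (2 * C + C\<^sup>2 / \<eta>) / \<bar>x\<bar> * S powr (- \<eta>)"
proof -
  define f where "f t = F k t * cis (- (t * x))" for t
  have r: "rho k t \<ge> R" if "t \<ge> R" for t using rho_ge(1)[of t k] that by simp
  have "cmod (integral {S..T} f) \<le> 2 * (C / \<bar>x\<bar>) * S powr (- \<eta>) + (C\<^sup>2 / \<bar>x\<bar>) / \<eta> * S powr (- \<eta>)"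
  proof (rule integral_tail_bound)
    show "continuous_on UNIV f" unfolding f_def by (rule symbol_integrand_continuous[OF F])
    fix t assume t: "t \<ge> R"
    note s = symbol_atD[OF s[OF r[OF t]]]
    have t0: "t > 0" using t R by simp
    have fb: "cmod (f t) \<le> C * t powr (- \<eta>)"
    proof -
      have "rho k t powr (- \<eta>) \<le> t powr (- \<eta>)" using t0 \<eta> rho_ge(1)[of t k] by (intro powr_mono2') auto
      then have "C * rho k t powr (- \<eta>) \<le> C * t powr (- \<eta>)" using C by simp
      then show ?thesis using s(7) by (simp add: f_def norm_mult)
    qed
    have "(f has_vector_derivative F k t * (- \<i> * of_real x * cis (- (t * x))) + M k t * F k t
        * cis (- (t * x))) (at t)"
      unfolding f_def by (rule has_vector_derivative_mult[OF s(1) cis_has_vector_derivative])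
    from has_vector_derivative_mult_right[OF this, of "\<i> / of_real x"]
    show "((\<lambda>t. \<i> / of_real x * f t) has_vector_derivative f t
        - (- (\<i> / of_real x) * (M k t * f t))) (at t)"
      by (rule has_vector_derivative_eq_rhs) (use x in \<open>simp add: f_def field_simps\<close>)
    show "cmod (\<i> / of_real x * f t) \<le> C / \<bar>x\<bar> * t powr (- \<eta>)"
      using mult_left_mono[OF fb, of "1 / \<bar>x\<bar>"] by (simp add: norm_mult norm_divide)
    have "cmod (M k t) \<le> C / rho k t" using s(4) by simp
    also have "\<dots> \<le> C / t" using C t0 rho_ge(1)[of t k] by (intro divide_left_mono) auto
    finally have "cmod (M k t * f t) \<le> (C / t) * (C * t powr (- \<eta>))"
      unfolding norm_mult by (intro mult_mono fb) (use C t0 in auto)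
    also have "\<dots> = C\<^sup>2 * t powr (- 1 - \<eta>)" using t0
        by (simp add: powr_diff powr_minus power2_eq_square field_simps)
    finally have "1 / \<bar>x\<bar> * cmod (M k t * f t) \<le> 1 / \<bar>x\<bar> * (C\<^sup>2 * t powr (- 1 - \<eta>))"
      by (intro mult_left_mono) auto
    then show "cmod (- (\<i> / of_real x) * (M k t * f t)) \<le> C\<^sup>2 / \<bar>x\<bar> * t powr (- 1 - \<eta>)"
      unfolding norm_mult[of "- (\<i> / of_real x)"] by (simp add: norm_divide)
  qed (use ST R \<eta> C x in auto)
  also have "\<dots> = (2 * C + C\<^sup>2 / \<eta>) / \<bar>x\<bar> * S powr (- \<eta>)"
    by (simp add: field_simps add_divide_distrib)
  finally show ?thesis unfolding f_def .
qed

lemma integral_bound_by_tail: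
  fixes f :: "real \<Rightarrow> complex"
  assumes c: "continuous_on UNIV f" and B: "\<And>t. cmod (f t) \<le> B" and A: "A \<ge> 0"
    and tail: "\<And>T. T \<ge> A \<Longrightarrow> cmod (integral {A..T} f) \<le> h" and T: "T \<ge> 0" and h: "h \<ge> 0"
  shows "cmod (integral {0..T} f) \<le> B * A + h"
proof -
  have B0: "B \<ge> 0" using B[of 0] norm_ge_zero order_trans by blast
  have i: "f integrable_on {a..b}" for a b
    by (intro integrable_continuous_interval continuous_on_subset[OF c]) auto
  have b: "cmod (integral {0..S} f) \<le> B * S" if "S \<ge> 0" for S
    using integral_bound[OF that continuous_on_subset[OF c]] B by simp
  show ?thesis
  proof (cases "T \<le> A")
    case True
    then have "B * T \<le> B * A" using B0 by (intro mult_left_mono)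
    then show ?thesis using b[OF T] h by simp
  next
    case False
    then have "integral {0..T} f = integral {0..A} f + integral {A..T} f"
      using Henstock_Kurzweil_Integration.integral_combine[of 0 A T f] A i by simp
    then show ?thesis using b[OF A] tail[of T] False norm_triangle_ineq[of "integral {0..A} f"
        "integral {A..T} f"] by simp
  qed
qed

lemma half_line_limit:
  assumes F: "symbol_on UNIV \<nu> \<eta> F" and \<eta>: "\<eta> > 0" and \<nu>: "\<nu> = 0 \<or> \<bar>\<nu>\<bar> \<ge> 1" and x: "x \<noteq> 0"
  shows "\<exists>P. ((\<lambda>T. integral {0..T} (wave F k x)) \<longlongrightarrow> P) at_top"
proof -
  obtain M M1 M2 C R where f: "C > 0" "R \<ge> 1"
    "\<And>k \<tau>. k \<in> UNIV \<Longrightarrow> rho k \<tau> \<ge> R \<Longrightarrow> symbol_at \<nu> \<eta> F M M1 M2 C k \<tau>"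
    using F by (rule symbol_onE) blast
  obtain A c where A: "A \<ge> R" "c > 0" "\<And>\<tau>. rho k \<tau> \<ge> A \<Longrightarrow> cmod (M k \<tau> - \<i> * of_real x) \<ge> c"
  proof (cases "\<nu> = 0")
    case True
    have "cmod (M k \<tau> - \<i> * of_real x) \<ge> \<bar>x\<bar> / 2" if "rho k \<tau> \<ge> max R (2 * C / \<bar>x\<bar>)" for \<tau>
      using that f(2) by (intro log_derivative_lower_bound(1)[OF f(3) f(1) _ True x]) auto
    then show ?thesis using x by (intro that[of "max R (2 * C / \<bar>x\<bar>)" "\<bar>x\<bar> / 2"]) auto
  next
    case False
    have "cmod (M k \<tau> - \<i> * of_real x) \<ge> 1" if "rho k \<tau> \<ge> max R (2 * exp (\<bar>x\<bar> + C + 1))" for \<tau>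
      using that f(2) False \<nu> by (intro log_derivative_lower_bound(2)[OF f(3) f(1)]) auto
    then show ?thesis by (intro that[of "max R (2 * exp (\<bar>x\<bar> + C + 1))" 1]) auto
  qed
  have c: "continuous_on S (wave F k x)" for S by (rule symbol_integrand_continuous[OF F])
  show ?thesis
  proof (rule convergent_at_top_of_tail)
    fix S T assume ST: "A \<le> S" "S \<le> T"
    have "integral {0..T} (wave F k x) - integral {0..S} (wave F k x) = integral {S..T} (wave F k x)"
      using Henstock_Kurzweil_Integration.integral_combine[of 0 S T "\<lambda>t. F k t
          * cis (- (t * x))"] ST A(1) f(2)
        integrable_continuous_interval[OF c] by (simp add: algebra_simps)
    then show "cmod (integral {0..T} (wave F k x) - integral {0..S} (wave F k x))
       \<le> 2 * (C / c + C\<^sup>2 / c ^ 3) * S powr (- \<eta>) + (3 * C ^ 3 / c ^ 4 + C\<^sup>2 / c ^ 3) / (1 + \<eta>)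
           * S powr (- (1 + \<eta>))"
      using oscillatory_tail[OF F \<eta> f(3) f(1) _ A(2,3) ST] A(1) f(2) by simp
  next
    have "((\<lambda>S::real. S powr (- \<eta>)) \<longlongrightarrow> 0) at_top" "((\<lambda>S::real. S powr (- (1 + \<eta>))) \<longlongrightarrow> 0) at_top"
      using \<eta> by (intro tendsto_neg_powr filterlim_ident; simp)+
    from tendsto_add[OF tendsto_mult_right_zero[OF this(1), of "2 * (C / c + C\<^sup>2 / c ^ 3)"]
        tendsto_mult_right_zero[OF this(2), of "(3 * C ^ 3 / c ^ 4 + C\<^sup>2 / c ^ 3) / (1 + \<eta>)"]]
    show "((\<lambda>S. 2 * (C / c + C\<^sup>2 / c ^ 3) * S powr (- \<eta>) + (3 * C ^ 3 / c ^ 4 + C\<^sup>2 / c ^ 3) / (1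
        + \<eta>) * S powr (- (1 + \<eta>))) \<longlongrightarrow> 0) at_top"
      by (simp only: add_0_left)
  qed
qed

text \<open>Source of the majorant \<open>D\<close>: the initial piece is bounded trivially by its
  length, the rest by a tail estimate. The cut depends on \<open>x\<close> and determines the shape
  of the bound.\<close>

lemma half_line_bound:
  assumes F: "symbol_on UNIV \<nu> \<eta> F" and \<eta>: "\<eta> > 0" and \<nu>: "\<nu> = 0 \<or> \<bar>\<nu>\<bar> \<ge> 1"
  shows "\<exists>K\<ge>0. \<forall>x T. x \<noteq> 0 \<longrightarrow> T \<ge> 0 \<longrightarrow>
    cmod (integral {0..T} (wave F k x)) \<le> K * (exp \<bar>x\<bar> + \<bar>x\<bar> powr (- (1 / (1 + \<eta>))))"
proof -
  obtain M M1 M2 C R where f: "C > 0" "R \<ge> 1"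
    "\<And>k \<tau>. k \<in> UNIV \<Longrightarrow> rho k \<tau> \<ge> R \<Longrightarrow> symbol_at \<nu> \<eta> F M M1 M2 C k \<tau>"
    using F by (rule symbol_onE) blast
  obtain B where B: "B > 0" "\<And>\<tau>. cmod (F k \<tau>) \<le> B" by (rule symbol_bounded[OF F \<eta>, where k=k]) blast
  have c: "continuous_on S (wave F k x)" for S x by (rule symbol_integrand_continuous[OF F])
  have B': "cmod (F k t * cis (- (t * x))) \<le> B" for t x using B(2) by (simp add: norm_mult)
  show ?thesis
  proof (cases "\<nu> = 0")
    case True
    \<comment> \<open>This exponent balances the two pieces: cutting at |x| powr (- p), the initial
      piece has that order and the tail the order |x| powr (p * \<eta> - 1), and these
      agree.\<close>
    define p where "p = 1 / (1 + \<eta>)"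
    have p: "p * \<eta> - 1 = - p" using \<eta> by (simp add: p_def field_simps)
    let ?K = "B * R + B + (2 * C + C\<^sup>2 / \<eta>)"
    have "cmod (integral {0..T} (wave F k x)) \<le> ?K * (exp \<bar>x\<bar> + \<bar>x\<bar> powr (- p))"
      if x: "x \<noteq> 0" and T: "T \<ge> 0" for x T
    proof -
      define A where "A = max R (\<bar>x\<bar> powr (- p))"
      have A: "A \<ge> R" "A \<ge> 1" using f(2) by (auto simp: A_def)
      have "A powr (- \<eta>) \<le> (\<bar>x\<bar> powr (- p)) powr (- \<eta>)"
        using x \<eta> by (intro powr_mono2') (auto simp: A_def)
      also have "\<dots> = \<bar>x\<bar> powr (p * \<eta>)" by (simp add: powr_powr)
      finally have "(2 * C + C\<^sup>2 / \<eta>) / \<bar>x\<bar> * A powr (- \<eta>) \<le> (2 * C + C\<^sup>2 / \<eta>) / \<bar>x\<bar> * \<bar>x\<bar> powr (p * \<eta>)"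
        using f(1) \<eta> by (intro mult_left_mono) auto
      also have "\<dots> = (2 * C + C\<^sup>2 / \<eta>) * (\<bar>x\<bar> powr (p * \<eta>) / \<bar>x\<bar> powr 1)" using x by simp
      also have "\<dots> = (2 * C + C\<^sup>2 / \<eta>) * \<bar>x\<bar> powr (- p)" by (simp only: powr_diff[symmetric] p)
      finally have h: "(2 * C + C\<^sup>2 / \<eta>) / \<bar>x\<bar> * A powr (- \<eta>) \<le> (2 * C + C\<^sup>2 / \<eta>) * \<bar>x\<bar> powr (- p)" .
      have "cmod (integral {0..T} (wave F k x)) \<le> B * A + (2 * C + C\<^sup>2 / \<eta>) / \<bar>x\<bar> * A powr (- \<eta>)"
      proof (rule integral_bound_by_tail[OF c B' _ _ T])
        fix T assume "A \<le> T"
        then show "cmod (integral {A..T} (wave F k x)) \<le> (2 * C + C\<^sup>2 / \<eta>) / \<bar>x\<bar> * A powr (- \<eta>)"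
          using F f(3) unfolding True by (intro stationary_tail[OF _ \<eta> _ f(1,2) x A(1)]) auto
      qed (use A f \<eta> in auto)
      also have "\<dots> \<le> B * (R + \<bar>x\<bar> powr (- p)) + (2 * C + C\<^sup>2 / \<eta>) * \<bar>x\<bar> powr (- p)"
        using h B(1) f(2) by (intro add_mono mult_left_mono) (auto simp: A_def max_def)
      also have "\<dots> = (B * R) * 1 + (B + (2 * C + C\<^sup>2 / \<eta>)) * \<bar>x\<bar> powr (- p)"
          by (simp add: algebra_simps)
      also have "\<dots> \<le> ?K * exp \<bar>x\<bar> + ?K * \<bar>x\<bar> powr (- p)"
        using B(1) f \<eta> by (intro add_mono mult_mono) auto
      finally show ?thesis by (simp add: algebra_simps)
    qed
    moreover have "?K \<ge> 0" using B(1) f \<eta> by auto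
    ultimately show ?thesis unfolding p_def by blast
  next
    case False
    then have \<nu>1: "\<bar>\<nu>\<bar> \<ge> 1" using \<nu> by auto
    define h where "h = 2 * (C / 1 + C\<^sup>2 / 1 ^ 3) + (3 * C ^ 3 / 1 ^ 4 + C\<^sup>2 / 1 ^ 3) / (1 + \<eta>)"
    have h0: "h \<ge> 0" using f(1) \<eta> by (auto simp: h_def)
    let ?K = "B * (R + 2 * exp (C + 1)) + h"
    have "cmod (integral {0..T} (wave F k x)) \<le> ?K * (exp \<bar>x\<bar> + \<bar>x\<bar> powr (- (1 / (1 + \<eta>))))"
      if T: "T \<ge> 0" for x T
    proof -
      \<comment> \<open>The radius beyond which the logarithm dominates; it is the origin of the
        factor exp |x|. Beyond it the tail is bounded independently of \<open>x\<close>, with lower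
        bound c = 1.\<close>
      define A where "A = max R (2 * exp (\<bar>x\<bar> + C + 1))"
      have A: "A \<ge> R" "A \<ge> 1" using f(2) by (auto simp: A_def)
      have A1: "A powr (- \<eta>) \<le> 1" "A powr (- (1 + \<eta>)) \<le> 1"
        using A(2) \<eta> powr_mono[of "- \<eta>" 0 A] powr_mono[of "- (1 + \<eta>)" 0 A] by auto
      have "cmod (integral {0..T} (wave F k x)) \<le> B * A + h"
      proof (rule integral_bound_by_tail[OF c B' _ _ T h0])
        fix T assume AT: "A \<le> T"
        have "cmod (integral {A..T} (wave F k x))
          \<le> 2 * (C / 1 + C\<^sup>2 / 1 ^ 3) * A powr (- \<eta>) + (3 * C ^ 3 / 1 ^ 4 + C\<^sup>2 / 1 ^ 3) / (1 + \<eta>)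
              * A powr (- (1 + \<eta>))"
        proof (rule oscillatory_tail[OF F \<eta> _ f(1) A(2) _ _ order_refl AT])
          fix \<tau> assume r: "A \<le> rho k \<tau>"
          then show "symbol_at \<nu> \<eta> F M M1 M2 C k \<tau>" using A by (intro f(3)) auto
          then show "1 \<le> cmod (M k \<tau> - \<i> * of_real x)"
            using r A by (intro log_derivative_lower_bound(2)[OF _ f(1) _ \<nu>1]) (auto simp: A_def)
        qed simp
        also have "\<dots> \<le> 2 * (C / 1 + C\<^sup>2 / 1 ^ 3) * 1 + (3 * C ^ 3 / 1 ^ 4 + C\<^sup>2 / 1 ^ 3) / (1 + \<eta>) * 1"
          using f(1) \<eta> A1 by (intro add_mono mult_left_mono) auto
        finally show "cmod (integral {A..T} (wave F k x)) \<le> h" by (simp add: h_def)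
      qed (use A in auto)
      also have "A \<le> R * exp \<bar>x\<bar> + 2 * exp (C + 1) * exp \<bar>x\<bar>"
      proof -
        have "R * 1 \<le> R * exp \<bar>x\<bar>" using f(2) by (intro mult_left_mono) auto
        moreover have "exp (\<bar>x\<bar> + C + 1) = exp (C + 1) * exp \<bar>x\<bar>" by (simp add: exp_add)
        ultimately show ?thesis using f(2) by (auto simp: A_def intro: add_increasing add_increasing2)
      qed
      then have "B * A \<le> B * (R * exp \<bar>x\<bar> + 2 * exp (C + 1) * exp \<bar>x\<bar>)" using B(1)
          by (intro mult_left_mono) auto
      then have "B * A + h \<le> B * (R * exp \<bar>x\<bar> + 2 * exp (C + 1) * exp \<bar>x\<bar>) + h * exp \<bar>x\<bar>"
        using h0 mult_left_mono[of 1 "exp \<bar>x\<bar>" h] by auto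
      also have "\<dots> = ?K * exp \<bar>x\<bar>" by (simp add: algebra_simps)
      also have "\<dots> \<le> ?K * (exp \<bar>x\<bar> + \<bar>x\<bar> powr (- (1 / (1 + \<eta>))))"
        using B(1) f(2) h0 by (intro mult_left_mono) auto
      finally show ?thesis .
    qed
    moreover have "?K \<ge> 0" using B(1) f h0 by auto
    ultimately show ?thesis by blast
  qed
qed

section \<open>The integrals over the whole line as Fourier coefficients\<close>

text \<open>For the kernel of \<open>G_C\<close> this is \<open>2 * pi\<close> times the coefficient
  of \<open>cis (- (of_int k * \<theta>))\<close> on the circle of radius exp x.\<close>

definition osc_int :: "(int \<Rightarrow> real \<Rightarrow> complex) \<Rightarrow> int \<Rightarrow> real \<Rightarrow> complex" where
  "osc_int F k x = integral UNIV (wave F k x)"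

lemma integral_left_half_line:
  "integral {-T..0} (wave F k x)
      = integral {0..T} (\<lambda>t. (\<lambda>k \<tau>. F (- k) (- \<tau>)) (- k) t * cis (- (t * - x)))"
  for F :: "int \<Rightarrow> real \<Rightarrow> complex"
  using Henstock_Kurzweil_Integration.integral_reflect_real[where a=0 and b=T and f="\<lambda>t. F k (- t)
      * cis (t * x)"]
  by simp

lemma osc_int_tendsto:
  assumes F: "symbol_on UNIV \<nu> \<eta> F" and \<eta>: "\<eta> > 0" and \<nu>: "\<nu> = 0 \<or> \<bar>\<nu>\<bar> \<ge> 1" and x: "x \<noteq> 0"
  shows "((\<lambda>T. integral {-T..T} (wave F k x)) \<longlongrightarrow> osc_int F k x) at_top"
proof -
  obtain P where P: "((\<lambda>T. integral {0..T} (wave F k x)) \<longlongrightarrow> P) at_top"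
    using half_line_limit[OF F \<eta> \<nu> x] by blast
  have "\<exists>Q. ((\<lambda>T. integral {0..T} (\<lambda>t. (\<lambda>k \<tau>. F (- k) (- \<tau>)) (- k) t * cis (- (t * - x)))) \<longlongrightarrow> Q) at_top"
    by (rule half_line_limit[OF symbol_on_reflect[OF F] \<eta>]) (use \<nu> x in auto)
  then obtain Q where Q: "((\<lambda>T. integral {-T..0} (wave F k x)) \<longlongrightarrow> Q) at_top"
    unfolding integral_left_half_line[symmetric] by blast
  note lim = has_integral_UNIV_of_limits[OF symbol_integrand_continuous[OF F] P Q]
  show ?thesis using lim(2) integral_unique[OF lim(1)] by (simp add: osc_int_def)
qed

lemma osc_int_partial_bound:
  assumes F: "symbol_on UNIV \<nu> \<eta> F" and \<eta>: "\<eta> > 0" and \<nu>: "\<nu> = 0 \<or> \<bar>\<nu>\<bar> \<ge> 1"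
  shows "\<exists>K\<ge>0. \<forall>x T. x \<noteq> 0 \<longrightarrow> T \<ge> 0 \<longrightarrow>
    cmod (integral {-T..T} (wave F k x)) \<le> K * (exp \<bar>x\<bar> + \<bar>x\<bar> powr (- (1 / (1 + \<eta>))))"
proof -
  let ?e = "\<lambda>x::real. exp \<bar>x\<bar> + \<bar>x\<bar> powr (- (1 / (1 + \<eta>)))"
  obtain K where K: "K \<ge> 0" "\<And>x T. x \<noteq> 0 \<Longrightarrow> T \<ge> 0 \<Longrightarrow>
    cmod (integral {0..T} (wave F k x)) \<le> K * ?e x"
    using half_line_bound[OF F \<eta> \<nu>, of k] by blast
  have "\<exists>K\<ge>0. \<forall>x T. x \<noteq> 0 \<longrightarrow> T \<ge> 0 \<longrightarrow>
    cmod (integral {0..T} (\<lambda>t. (\<lambda>k \<tau>. F (- k) (- \<tau>)) (- k) t * cis (- (t * x)))) \<le> K * ?e x"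
    by (rule half_line_bound[OF symbol_on_reflect[OF F] \<eta>]) (use \<nu> in auto)
  then obtain K' where K': "K' \<ge> 0" "\<And>x T. x \<noteq> 0 \<Longrightarrow> T \<ge> 0 \<Longrightarrow>
    cmod (integral {0..T} (\<lambda>t. (\<lambda>k \<tau>. F (- k) (- \<tau>)) (- k) t * cis (- (t * x)))) \<le> K' * ?e x" by blast
  have "cmod (integral {-T..T} (wave F k x)) \<le> (K + K') * ?e x" if x: "x \<noteq> 0" and T: "T \<ge> 0" for x T
  proof -
    have "integral {-T..T} (wave F k x) = integral {-T..0} (wave F k x) + integral {0..T} (wave F k x)"
      using T integrable_continuous_interval[OF symbol_integrand_continuous[OF F]]
      by (intro Henstock_Kurzweil_Integration.integral_combine[symmetric]) auto
    moreover have "cmod (integral {-T..0} (wave F k x)) \<le> K' * ?e x"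
      using K'(2)[of "- x" T] x T unfolding integral_left_half_line by simp
    ultimately show ?thesis using K(2)[OF x T]
      by (auto simp: distrib_right intro: norm_triangle_le)
  qed
  then show ?thesis using K(1) K'(1) by (intro exI[of _ "K + K'"]) auto
qed

text \<open>The locale for Parseval speaks of Lebesgue integrals, the estimates here of
  Henstock-Kurzweil integrals; on a bounded interval continuity makes them agree.\<close>

lemma integral_indicator_eq:
  assumes F: "symbol_on UNIV \<nu> \<eta> F"
  shows "(\<integral>t. indicator {-T..T} t *\<^sub>R (F k t * cis (- (t * x))) \<partial>lborel)
      = integral {-T..T} (wave F k x)"
proof -
  have "set_integrable lborel {-T..T} (wave F k x)"
    by (rule borel_integrable_atLeastAtMost') (rule symbol_integrand_continuous[OF F])
  from set_borel_integral_eq_integral(2)[OF this] show ?thesis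
    by (simp add: set_lebesgue_integral_def)
qed

text \<open>exp |x| is at most exp x + exp (- x), and completing the square turns each term into a
  shifted Gaussian times exp (1 / (2 * e)).\<close>

lemma integrable_exp_abs_gauss:
  fixes e :: real
  assumes e: "e > 0"
  shows "integrable lborel (\<lambda>x::real. exp \<bar>x\<bar> * exp (- e * x\<^sup>2 / 2))"
proof (rule Bochner_Integration.integrable_bound)
  let ?g = "\<lambda>s x::real. exp (- e * (- s / e + 1 * x)\<^sup>2 / 2)"
  show "integrable lborel (\<lambda>x. exp (1 / (2 * e)) * ?g 1 x + exp (1 / (2 * e)) * ?g (- 1) x)"
    using e by (intro Bochner_Integration.integrable_add integrable_mult_right gaussian_integral) auto
  have eq: "exp (s * x) * exp (- e * x\<^sup>2 / 2) = exp (1 / (2 * e)) * ?g s x" if "s = 1 \<or> s = - 1" for s x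
    using e that unfolding exp_add[symmetric] by (auto simp: power2_eq_square field_simps)
  show "AE x in lborel. norm (exp \<bar>x\<bar> * exp (- e * x\<^sup>2 / 2))
      \<le> norm (exp (1 / (2 * e)) * ?g 1 x + exp (1 / (2 * e)) * ?g (- 1) x)"
  proof (rule AE_I2)
    fix x :: real
    have "exp \<bar>x\<bar> \<le> exp (1 * x) + exp (- 1 * x)"
        by (cases "x \<ge> 0") (auto simp: add_increasing add_increasing2)
    then have "exp \<bar>x\<bar> * exp (- e * x\<^sup>2 / 2) \<le> (exp (1 * x) + exp (- 1 * x)) * exp (- e * x\<^sup>2 / 2)"
      by (intro mult_right_mono) auto
    also have "\<dots> = exp (1 / (2 * e)) * ?g 1 x + exp (1 / (2 * e)) * ?g (- 1) x"
      unfolding distrib_right using eq[of 1 x] eq[of "- 1" x] by simp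
    finally show "norm (exp \<bar>x\<bar> * exp (- e * x\<^sup>2 / 2))
        \<le> norm (exp (1 / (2 * e)) * ?g 1 x + exp (1 / (2 * e)) * ?g (- 1) x)"
      by simp
  qed
qed measurable

lemma integrable_powr_gauss:
  fixes e p :: real
  assumes e: "e > 0" and p: "p < 1" "p > 0"
  shows "integrable lborel (\<lambda>x::real. \<bar>x\<bar> powr (- p) * exp (- e * x\<^sup>2 / 2))"
proof (rule Bochner_Integration.integrable_bound)
  define h where "h x = (if x \<in> {0..1} then x powr (- p) else 0)" for x :: real
  have [measurable]: "h \<in> borel_measurable borel" unfolding h_def by measurable
  have h0: "h x \<ge> 0" for x by (simp add: h_def)
  have "((\<lambda>x. x powr (- p)) has_integral (1 powr (- p + 1) / (- p + 1))) {0..1}"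
    using p by (intro has_integral_powr_from_0) auto
  then have "(h has_integral (1 powr (- p + 1) / (- p + 1))) UNIV"
    unfolding h_def by (simp only: has_integral_restrict_UNIV)
  then have "integral\<^sup>N lborel h = ennreal (1 powr (- p + 1) / (- p + 1))"
    by (intro nn_integral_has_integral_lborel h0) auto
  then have h: "integrable lborel h"
    by (intro integrableI_nonneg AE_I2 h0) auto
  have h': "integrable lborel (\<lambda>x. h (0 + (-1) * x))"
    by (rule lborel_integrable_real_affine[OF h]) simp
  show "integrable lborel (\<lambda>x. h x + h (0 + (-1) * x) + exp (- e * (0 + 1 * x)\<^sup>2 / 2))"
    using e h h' by (intro Bochner_Integration.integrable_add gaussian_integral) auto
  show "AE x in lborel. norm (\<bar>x\<bar> powr (- p) * exp (- e * x\<^sup>2 / 2))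
      \<le> norm (h x + h (0 + (-1) * x) + exp (- e * (0 + 1 * x)\<^sup>2 / 2))"
  proof (rule AE_I2)
    fix x :: real
    have e1: "exp (- e * x\<^sup>2 / 2) \<le> 1" using e by simp
    have "\<bar>x\<bar> powr (- p) * exp (- e * x\<^sup>2 / 2) \<le> h x + h (0 + (-1) * x) + exp (- e * x\<^sup>2 / 2)"
    proof (cases "\<bar>x\<bar> \<le> 1")
      case True
      have "\<bar>x\<bar> powr (- p) * exp (- e * x\<^sup>2 / 2) \<le> \<bar>x\<bar> powr (- p)"
        using e1 by (intro mult_left_le) auto
      also have "\<dots> \<le> h x + h (0 + (-1) * x)" using True by (auto simp: abs_if h_def)
      finally show ?thesis using exp_ge_zero[of "- e * x\<^sup>2 / 2"] by linarith
    next
      case False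
      then have "\<bar>x\<bar> powr (- p) \<le> \<bar>x\<bar> powr 0" using p by (intro powr_mono) auto
      also have "\<dots> = 1" using False by auto
      finally have "\<bar>x\<bar> powr (- p) * exp (- e * x\<^sup>2 / 2) \<le> exp (- e * x\<^sup>2 / 2)"
        by (intro mult_left_le_one_le) auto
      then show ?thesis using h0[of x] h0[of "0 + (-1) * x"] by linarith
    qed
    then show "norm (\<bar>x\<bar> powr (- p) * exp (- e * x\<^sup>2 / 2))
        \<le> norm (h x + h (0 + (-1) * x) + exp (- e * (0 + 1 * x)\<^sup>2 / 2))"
      by simp
  qed
qed measurable

lemma osc_int_measurable:
  assumes F: "symbol_on UNIV \<nu> \<eta> F" and \<eta>: "\<eta> > 0" and \<nu>: "\<nu> = 0 \<or> \<bar>\<nu>\<bar> \<ge> 1"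
  shows "osc_int F k \<in> borel_measurable borel"
proof (rule borel_measurable_LIMSEQ_metric)
  \<comment> \<open>The partial integrals need not converge at x = 0, so there the sequence is
    constant with the value of the limit function.\<close>
  let ?I = "\<lambda>n x. if x
      = 0 then osc_int F k 0 else (\<integral>t. indicator {- real n..real n} t *\<^sub>R (F k t * cis (- (t * x)))
          \<partial>lborel)"
  have [measurable]: "F k \<in> borel_measurable borel"
    using symbol_on_continuous[OF F, of k] by (intro borel_measurable_continuous_onI) auto
  show "?I n \<in> borel_measurable borel" for n by measurable
  show "(\<lambda>n. ?I n x) \<longlonglongrightarrow> osc_int F k x" for x
  proof (cases "x = 0")
    case False
    then show ?thesis
      using filterlim_compose[OF osc_int_tendsto[OF F \<eta> \<nu> False, of k] filterlim_real_sequentially]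
      unfolding integral_indicator_eq[OF F] by simp
  qed simp
qed

lemma osc_int_improper_fourier:
  assumes F: "symbol_on UNIV \<nu> \<eta> F" and \<eta>: "\<eta> > 0" and \<nu>: "\<nu> = 0 \<or> \<bar>\<nu>\<bar> \<ge> 1"
    and L: "L2 lborel (osc_int F k)"
  shows "\<exists>D B. improper_fourier (F k) (osc_int F k) D B"
proof -
  obtain B where B: "\<And>\<tau>. cmod (F k \<tau>) \<le> B" by (rule symbol_bounded[OF F \<eta>, where k=k]) blast
  define p where "p = 1 / (1 + \<eta>)"
  have p: "p > 0" "p < 1" using \<eta> by (auto simp: p_def)
  obtain K where K: "K \<ge> 0" "\<And>x T. x \<noteq> 0 \<Longrightarrow> T \<ge> 0 \<Longrightarrow>
    cmod (integral {-T..T} (wave F k x)) \<le> K * (exp \<bar>x\<bar> + \<bar>x\<bar> powr (- p))"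
    using osc_int_partial_bound[OF F \<eta> \<nu>, of k] unfolding p_def by blast
  have "improper_fourier (F k) (osc_int F k) (\<lambda>x. K * (exp \<bar>x\<bar> + \<bar>x\<bar> powr (- p))) B"
  proof (unfold_locales, goal_cases)
    case 1
    show ?case by (rule symbol_on_continuous[OF F UNIV_I])
  next
    case 2
    show ?case by (rule B)
  next
    case (3 x)
    then show ?case unfolding integral_indicator_eq[OF F] by (rule osc_int_tendsto[OF F \<eta> \<nu>])
  next
    case (4 x T)
    then show ?case unfolding integral_indicator_eq[OF F] by (rule K)
  next
    case (5 e)
    from integrable_mult_right[OF Bochner_Integration.integrable_add[OF integrable_exp_abs_gauss[OF
        5] integrable_powr_gauss[OF 5 p(2,1)]], of K]
    show ?case by (simp add: algebra_simps)
  next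
    case 6
    show ?case by (rule L)
  qed
  then show ?thesis by blast
qed

section \<open>Decay in the discrete variable\<close>

lemma integral_inverse_rho_square:
  assumes k: "k \<noteq> 0" and T: "T \<ge> 0"
  shows "(\<lambda>t. 1 / (rho k t)\<^sup>2) integrable_on {-T..T}" and "integral {-T..T} (\<lambda>t. 1 / (rho k t)\<^sup>2)
      \<le> pi / \<bar>of_int k\<bar>"
proof -
  define r where "r = \<bar>real_of_int k\<bar>"
  have r: "r > 0" using k by (simp add: r_def)
  have i: "((\<lambda>t. 1 / (rho k t)\<^sup>2) has_integral (arctan (T / r) / r - arctan (- T / r) / r)) {-T..T}"
  proof (rule fundamental_theorem_of_calculus)
    fix t assume "t \<in> {-T..T}"
    have "r\<^sup>2 + t\<^sup>2 > 0" using r by (intro add_pos_nonneg) auto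
    then have eq: "1 / r * inverse (1 + (t / r)\<^sup>2) / r = 1 / (r\<^sup>2 + t\<^sup>2)"
    proof -
      have "1 + (t / r)\<^sup>2 = (r\<^sup>2 + t\<^sup>2) / r\<^sup>2" using r by (simp add: power_divide add_divide_distrib)
      then show ?thesis using r by (simp add: power2_eq_square)
    qed
    have "((\<lambda>t. arctan (t / r) / r) has_real_derivative 1 / r * inverse (1 + (t / r)\<^sup>2) / r)
        (at t within {-T..T})"
      using r by (auto intro!: derivative_eq_intros)
    moreover have "(rho k t)\<^sup>2 = r\<^sup>2 + t\<^sup>2" by (simp add: rho_power2 r_def)
    ultimately have "((\<lambda>t. arctan (t / r) / r) has_real_derivative 1 / (rho k t)\<^sup>2)
        (at t within {-T..T})"
      by (simp only: eq)
    then show "((\<lambda>t. arctan (t / r) / r) has_vector_derivative 1 / (rho k t)\<^sup>2) (at t within {-T..T})"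
      by (simp add: has_real_derivative_iff_has_vector_derivative)
  qed (use T in auto)
  show "(\<lambda>t. 1 / (rho k t)\<^sup>2) integrable_on {-T..T}" using i by blast
  have "arctan (T / r) / r - arctan (- T / r) / r = (arctan (T / r) - arctan (- T / r)) / r"
      by (simp add: diff_divide_distrib)
  also have "\<dots> \<le> pi / r" using arctan_bounded[of "T / r"] arctan_bounded[of "- T / r"] r
      by (intro divide_right_mono) auto
  finally show "integral {-T..T} (\<lambda>t. 1 / (rho k t)\<^sup>2) \<le> pi / \<bar>of_int k\<bar>"
    using integral_unique[OF i] by (simp add: r_def)
qed

text \<open>Once |k| exceeds the threshold, \<open>rho k \<tau>\<close> does so for every
  \<open>\<tau>\<close>, and integration by parts works on the entire line. The boundary terms
  vanish at infinity; of the remainder rho powr (-2 - \<eta>), the factor rho powr (- \<eta>) is at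
  most |k| powr (- \<eta>) and the integral of rho^(-2) supplies pi / |k|.\<close>

lemma osc_int_decay:
  assumes F: "symbol_on UNIV \<nu> \<eta> F" and \<eta>: "\<eta> > 0" and \<nu>: "\<nu> = 0 \<or> \<bar>\<nu>\<bar> \<ge> 1" and x: "x \<noteq> 0"
  shows "\<exists>A K. A \<ge> 1 \<and> (\<forall>k. \<bar>real_of_int k\<bar> \<ge> A \<longrightarrow> cmod (osc_int F k x) \<le> K * \<bar>of_int k\<bar> powr (- 1 - \<eta>))"
proof -
  obtain M M1 M2 C R where f: "C > 0" "R \<ge> 1"
    "\<And>k \<tau>. k \<in> UNIV \<Longrightarrow> rho k \<tau> \<ge> R \<Longrightarrow> symbol_at \<nu> \<eta> F M M1 M2 C k \<tau>"
    using F by (rule symbol_onE) blast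
  obtain A c where A: "A \<ge> R" "c > 0" "\<And>k \<tau>. rho k \<tau> \<ge> A \<Longrightarrow> cmod (M k \<tau> - \<i> * of_real x) \<ge> c"
  proof (cases "\<nu> = 0")
    case True
    have "cmod (M k \<tau> - \<i> * of_real x) \<ge> \<bar>x\<bar> / 2" if "rho k \<tau> \<ge> max R (2 * C / \<bar>x\<bar>)" for k \<tau>
      using that f(2) by (intro log_derivative_lower_bound(1)[OF f(3) f(1) _ True x]) auto
    then show ?thesis using x by (intro that[of "max R (2 * C / \<bar>x\<bar>)" "\<bar>x\<bar> / 2"]) auto
  next
    case False
    have "cmod (M k \<tau> - \<i> * of_real x) \<ge> 1" if "rho k \<tau> \<ge> max R (2 * exp (\<bar>x\<bar> + C + 1))" for k \<tau>
      using that f(2) False \<nu> by (intro log_derivative_lower_bound(2)[OF f(3) f(1)]) auto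
    then show ?thesis by (intro that[of "max R (2 * exp (\<bar>x\<bar> + C + 1))" 1]) auto
  qed
  define K1 where "K1 = C / c + C\<^sup>2 / c ^ 3"
  define K2 where "K2 = 3 * C ^ 3 / c ^ 4 + C\<^sup>2 / c ^ 3"
  have K: "K1 \<ge> 0" "K2 \<ge> 0" using f(1) A(2) by (auto simp: K1_def K2_def)
  have "cmod (osc_int F k x) \<le> (K2 * pi) * \<bar>of_int k\<bar> powr (- 1 - \<eta>)" if k: "\<bar>of_int k\<bar> \<ge> A" for k
      :: int
  proof -
    define f where "f t = F k t * cis (- (t * x))" for t
    define L where "L t = M k t - \<i> * of_real x" for t
    define E where "E t = f t * (3 * (M1 k t)\<^sup>2 * inverse (L t) ^ 4 - M2 k t * inverse (L t) ^ 3)" for t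
    define G where "G t = f t * inverse (L t) + M1 k t * f t * inverse (L t) ^ 3" for t
    define r where "r = \<bar>real_of_int k\<bar>"
    have r1: "r \<ge> 1" and r0: "r > 0" and kz: "k \<noteq> 0" using k A(1) f(2) by (auto simp: r_def)
    have rho: "rho k t \<ge> A" "rho k t \<ge> 1" "rho k t \<ge> r" for t
      using rho_ge(2)[of k t] k A(1) f(2) by (auto simp: r_def)
    have s: "symbol_at \<nu> \<eta> F M M1 M2 C k t" for t using rho(1)[of t] A(1) by (intro f(3)) auto
    note ns = nonstationary[OF s f(1) rho(2) A(2) A(3)[OF rho(1)], folded f_def L_def, folded E_def
        G_def, folded K1_def K2_def]
    have Ec: "cmod (E t) \<le> (K2 * r powr (- \<eta>)) * (1 / (rho k t)\<^sup>2)" for t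
    proof -
      have "cmod (E t) \<le> K2 * (rho k t powr (- \<eta>) / (rho k t)\<^sup>2)"
        using ns(3)[of t] powr_minus_2[of "rho k t" \<eta>] rho(2)[of t] by simp
      also have "\<dots> \<le> K2 * (r powr (- \<eta>) / (rho k t)\<^sup>2)"
        using K r0 rho(3)[of t] \<eta> by (intro mult_left_mono divide_right_mono powr_mono2') auto
      finally show ?thesis by simp
    qed
    have b: "cmod (integral {-T..T} f) \<le> 2 * K1 * T powr (- \<eta>) + (K2 * pi)
        * r powr (- 1 - \<eta>)" if T: "T > 0" for T
    proof -
      have fi: "f integrable_on {-T..T}" unfolding f_def
        by (intro integrable_continuous_interval symbol_integrand_continuous[OF F])
      have G': "((\<lambda>t. f t - E t) has_integral (G T - G (- T))) {-T..T}"
        using T by (intro fundamental_theorem_of_calculus has_vector_derivative_at_within[OF ns(1)])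
            auto
      have "((\<lambda>t. f t - (f t - E t)) has_integral (integral {-T..T} f - (G T - G (- T)))) {-T..T}"
        by (intro has_integral_diff G' integrable_integral fi)
      then have E': "(E has_integral (integral {-T..T} f - (G T - G (- T)))) {-T..T}" by simp
      have "cmod (integral {-T..T} E) \<le> integral {-T..T} (\<lambda>t. (K2 * r powr (- \<eta>)) * (1 / (rho k t)\<^sup>2))"
        using E' Ec integral_inverse_rho_square(1)[OF kz, of T] T
        by (intro integral_norm_bound_integral integrable_on_mult_right) auto
      also have "\<dots> = (K2 * r powr (- \<eta>)) * integral {-T..T} (\<lambda>t. 1 / (rho k t)\<^sup>2)"
        by (rule integral_mult_right)
      also have "\<dots> \<le> (K2 * r powr (- \<eta>)) * (pi / r)"
        using integral_inverse_rho_square(2)[OF kz, of T] T K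
            by (intro mult_left_mono) (auto simp: r_def)
      also have "\<dots> = (K2 * pi) * (r powr (- 1 - \<eta>))"
        using r0 by (simp add: powr_diff powr_minus field_simps)
      finally have 1: "cmod (integral {-T..T} f - (G T - G (- T))) \<le> (K2 * pi) * (r powr (- 1 - \<eta>))"
        using integral_unique[OF E'] by simp
      have "rho k t powr (- \<eta>) \<le> T powr (- \<eta>)" if "\<bar>t\<bar> = T" for t
        using T rho_ge(1)[of t k] that \<eta> by (intro powr_mono2') auto
      then have "cmod (G t) \<le> K1 * T powr (- \<eta>)" if "\<bar>t\<bar> = T" for t
        using order_trans[OF ns(2) mult_left_mono[OF _ K(1)]] that by blast
      from this[of T] this[of "- T"] T have "cmod (G T - G (- T)) \<le> 2 * K1 * T powr (- \<eta>)"
        using norm_triangle_ineq4[of "G T" "G (- T)"] by simp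
      with 1 show ?thesis
        using norm_triangle_ineq[of "integral {-T..T} f - (G T - G (- T))" "G T - G (- T)"] by simp
    qed
    have "((\<lambda>T::real. T powr (- \<eta>)) \<longlongrightarrow> 0) at_top"
      using \<eta> by (intro tendsto_neg_powr filterlim_ident) auto
    from tendsto_add[OF tendsto_mult_right_zero[OF this, of "2 * K1"] tendsto_const[of "(K2 * pi)
        * r powr (- 1 - \<eta>)"]]
    have "((\<lambda>T. 2 * K1 * T powr (- \<eta>) + (K2 * pi) * r powr (- 1 - \<eta>))
        \<longlongrightarrow> (K2 * pi) * r powr (- 1 - \<eta>)) at_top" by (simp only: add_0_left)
    moreover have "((\<lambda>T. cmod (integral {-T..T} f)) \<longlongrightarrow> cmod (osc_int F k x)) at_top"
      unfolding f_def by (intro tendsto_norm osc_int_tendsto[OF F \<eta> \<nu> x])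
    moreover have "\<forall>\<^sub>F T in at_top. cmod (integral {-T..T} f) \<le> 2 * K1 * T powr (- \<eta>) + (K2 * pi)
        * r powr (- 1 - \<eta>)"
      using eventually_gt_at_top[of 0] by eventually_elim (rule b)
    ultimately show ?thesis
      unfolding r_def by (intro tendsto_le[OF trivial_limit_at_top_linorder])
  qed
  then show ?thesis using A(1) f(2) by (intro exI[of _ A] exI[of _ "K2 * pi"]) auto
qed

lemma summable_on_int_powr:
  assumes "s < - 1"
  shows "(\<lambda>k::int. \<bar>of_int k\<bar> powr s :: real) summable_on UNIV"
proof -
  have "summable (\<lambda>n. norm (real n powr s))" using assms by (simp add: summable_real_powr_iff)
  then have n: "(\<lambda>n::nat. real n powr s) summable_on UNIV"
    by (rule norm_summable_imp_summable_on)
  have "(\<lambda>k::int. \<bar>of_int k\<bar> powr s :: real) summable_on range int"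
    by (subst summable_on_reindex) (use n in \<open>auto simp: o_def inj_on_def\<close>)
  moreover have "(\<lambda>k::int. \<bar>of_int k\<bar> powr s :: real) summable_on range (\<lambda>n. - int n)"
    by (subst summable_on_reindex) (use n in \<open>auto simp: o_def inj_on_def\<close>)
  ultimately have "(\<lambda>k::int. \<bar>of_int k\<bar> powr s :: real) summable_on (range int \<union> range (\<lambda>n. - int n))"
    by (rule summable_on_union)
  moreover have "range int \<union> range (\<lambda>n. - int n) = UNIV"
    by (auto simp: image_iff) (metis int_cases2)
  ultimately show ?thesis by simp
qed

lemma osc_int_abs_summable:
  assumes F: "symbol_on UNIV \<nu> \<eta> F" and \<eta>: "\<eta> > 0" and \<nu>: "\<nu> = 0 \<or> \<bar>\<nu>\<bar> \<ge> 1" and x: "x \<noteq> 0"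
  shows "(\<lambda>k. cmod (osc_int F k x)) summable_on UNIV"
proof -
  obtain A K where A: "A \<ge> 1" "\<And>k. \<bar>real_of_int k\<bar> \<ge> A \<Longrightarrow> cmod (osc_int F k x)
      \<le> K * \<bar>of_int k\<bar> powr (- 1 - \<eta>)"
    using osc_int_decay[OF F \<eta> \<nu> x] by blast
  let ?S = "{k::int. \<bar>real_of_int k\<bar> \<ge> A}"
  have "(\<lambda>k::int. K * (\<bar>of_int k\<bar> powr (- 1 - \<eta>))) summable_on UNIV"
    using \<eta> by (intro summable_on_cmult_right summable_on_int_powr) simp
  then have "(\<lambda>k::int. K * (\<bar>of_int k\<bar> powr (- 1 - \<eta>))) summable_on ?S"
    by (rule summable_on_subset_banach) simp
  then have 1: "(\<lambda>k. cmod (osc_int F k x)) summable_on ?S"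
    by (rule summable_on_comparison_test) (use A in auto)
  have "- ?S \<subseteq> {- \<lceil>A\<rceil>..\<lceil>A\<rceil>}" by (auto simp: abs_less_iff) linarith+
  then have "finite (- ?S)" by (rule finite_subset) simp
  then have "(\<lambda>k. cmod (osc_int F k x)) summable_on - ?S" by (rule summable_on_finite)
  from summable_on_union[OF 1 this] show ?thesis by simp
qed

section \<open>Fourier series on the circle\<close>

text \<open>Summation over \<open>k\<close> written as an integral, so that Fubini and L2 arguments
  cover the discrete variable.\<close>

abbreviation int_measure :: "int measure" where
  "int_measure \<equiv> count_space UNIV"

lemma integral_count_space_eq_infsum:
  fixes f :: "int \<Rightarrow> complex"
  assumes "integrable int_measure f"
  shows "infsum f UNIV = (\<integral>k. f k \<partial>int_measure)"
  using infsetsum_infsum[of f UNIV] assms by (simp add: abs_summable_on_def infsetsum_def)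

lemma summable_imp_integrable_count_space:
  fixes f :: "int \<Rightarrow> complex"
  assumes "(\<lambda>k. cmod (f k)) summable_on UNIV"
  shows "integrable int_measure f"
  using abs_summable_equivalent[of f UNIV] assms by (simp add: abs_summable_on_def)

section \<open>The function G_C in polar coordinates\<close>

text \<open>The characters of the multiplicative group become products of exponentials in the angle
  and in the logarithm of the modulus.\<close>

lemma cpower_exp:
  "cpower (exp (Complex x \<theta>)) ((- of_int k - \<i> * of_real \<tau>) / 2, (of_int k - \<i> * of_real \<tau>) / 2)
    = cis (- (of_int k * \<theta>)) * cis (- (\<tau> * x))"
proof -
  have n: "cmod (exp (Complex x \<theta>)) = exp x" by simp
  have q: "exp (Complex x \<theta>) / of_real (exp x) = cis \<theta>"
    by (simp add: exp_eq_polar exp_of_real)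
  have fl: "\<lfloor>Re ((- of_int k - \<i> * of_real \<tau>) / 2 - (of_int k - \<i> * of_real \<tau>) / 2)\<rfloor> = - k"
  proof -
    have "Re ((- of_int k - \<i> * of_real \<tau>) / 2 - (of_int k - \<i> * of_real \<tau>) / 2) = of_int (- k)" by simp
    then show ?thesis by (simp only: floor_of_int)
  qed
  have s: "(- of_int k - \<i> * of_real \<tau>) / 2 + (of_int k - \<i> * of_real \<tau>) / 2 = - (\<i> * of_real \<tau>)"
    by (simp add: field_simps)
  have p: "of_real (exp x) powr (- (\<i> * of_real \<tau>)) = cis (- (\<tau> * x))"
    by (simp add: powr_def cis_conv_exp Ln_of_real mult_ac)
  show ?thesis
    unfolding cpower_def case_prod_conv n q fl s p cis_power_int by simp
qed

text \<open>The factor \<i> from d\<sigma> = \<i> d\<tau> cancels the one in 1 / (2 pi \<i>). A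
  constant factor passes through the Henstock-Kurzweil integral and through \<open>infsum\<close>
  even when they do not converge, so the identity holds on the unit circle as well.\<close>

lemma G_C_polar:
  "G_C a b (exp (Complex x \<theta>)) = of_real (1 / (2 * pi)) *
     (\<Sum>\<^sub>\<infinity>k\<in>UNIV. osc_int (\<lambda>k \<tau>. K_C a b k (\<i> * of_real \<tau>)) k x * cis (- (of_int k * \<theta>)))"
proof -
  have "integral UNIV (\<lambda>\<tau>. let \<sigma> = \<i> * of_real \<tau> in
        K_C a b k \<sigma> * cpower (exp (Complex x \<theta>)) ((- of_int k - \<sigma>) / 2, (of_int k - \<sigma>) / 2) * \<i>)
     = \<i> * (osc_int (\<lambda>k \<tau>. K_C a b k (\<i> * of_real \<tau>)) k x * cis (- (of_int k * \<theta>)))" for k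
  proof -
    have "integral UNIV (\<lambda>\<tau>. let \<sigma> = \<i> * of_real \<tau> in
        K_C a b k \<sigma> * cpower (exp (Complex x \<theta>)) ((- of_int k - \<sigma>) / 2, (of_int k - \<sigma>) / 2) * \<i>)
      = integral UNIV (\<lambda>\<tau>. (\<i> * cis (- (of_int k * \<theta>)))
          * (K_C a b k (\<i> * of_real \<tau>) * cis (- (\<tau> * x))))"
      unfolding Let_def cpower_exp by (simp add: mult_ac)
    also have "\<dots> = (\<i> * cis (- (of_int k * \<theta>))) * integral UNIV (\<lambda>\<tau>. K_C a b k (\<i> * of_real \<tau>)
        * cis (- (\<tau> * x)))"
      by (rule integral_mult_right)
    finally show ?thesis by (simp add: osc_int_def)
  qed
  then show ?thesis unfolding G_C_def by (simp add: infsum_cmult_right')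
qed

lemma cis_circle_integral:
  "(\<integral>\<theta>. cis (of_int n * \<theta>) \<partial>circle_measure) = (if n = 0 then of_real (2 * pi) else 0)"
proof -
  have i: "(\<integral>\<theta>. cis (of_int n * \<theta>) \<partial>circle_measure)
      = (\<integral>\<theta>. indicator {-pi/2<..<3*pi/2} \<theta> *\<^sub>R cis (of_int n * \<theta>) \<partial>lborel)"
    unfolding circle_measure_def by (subst integral_restrict_space) auto
  also have "\<dots> = (\<integral>\<theta>. indicator {-pi/2..3*pi/2} \<theta> *\<^sub>R cis (of_int n * \<theta>) \<partial>lborel)"
  proof (rule integral_cong_AE)
    have "AE \<theta> in lborel. \<theta> \<noteq> -pi/2" "AE \<theta> in lborel. \<theta> \<noteq> 3*pi/2" by (rule AE_lborel_singleton)+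
    then show "AE \<theta> in lborel. indicator {-pi/2<..<3*pi/2} \<theta> *\<^sub>R cis (of_int n * \<theta>)
        = indicator {-pi/2..3*pi/2} \<theta> *\<^sub>R cis (of_int n * \<theta>)"
      by eventually_elim (auto simp: indicator_def)
  qed measurable
  also have "\<dots> = integral {-pi/2..3*pi/2} (\<lambda>\<theta>. cis (of_int n * \<theta>))"
  proof -
    have "set_integrable lborel {-pi/2..3*pi/2} (\<lambda>\<theta>. cis (of_int n * \<theta>))"
      by (rule borel_integrable_atLeastAtMost') (intro continuous_intros)
    from set_borel_integral_eq_integral(2)[OF this] show ?thesis
        by (simp add: set_lebesgue_integral_def)
  qed
  also have "\<dots> = (if n = 0 then of_real (2 * pi) else 0)"
  proof (cases "n = 0")
    case True
    then show ?thesis by (simp add: scaleR_conv_of_real)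
  next
    case False
    let ?f = "\<lambda>\<theta>. cis (of_int n * \<theta>) / (\<i> * of_int n)"
    have "((\<lambda>\<theta>. cis (of_int n * \<theta>)) has_integral (?f (3*pi/2) - ?f (-pi/2))) {-pi/2..3*pi/2}"
    proof (rule fundamental_theorem_of_calculus)
      fix \<theta> :: real
      have "((\<lambda>t. cis (- (t * - of_int n))) has_vector_derivative (- \<i> * of_real (- of_int n))
          * cis (- (\<theta> * - of_int n))) (at \<theta>)"
        by (rule cis_has_vector_derivative)
      from has_vector_derivative_mult_right[OF this, of "1 / (\<i> * of_int n)"]
      have "((\<lambda>\<theta>. 1 / (\<i> * of_int n) * cis (of_int n * \<theta>)) has_vector_derivative cis (of_int n * \<theta>))
          (at \<theta>)"
        using False by (simp add: mult.commute[of _ "real_of_int n"])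
      then show "(?f has_vector_derivative cis (of_int n * \<theta>)) (at \<theta> within {-pi/2..3*pi/2})"
        using has_vector_derivative_at_within by (simp add: has_vector_derivative_at_within)
    qed simp
    moreover have "cis (of_int n * (3*pi/2)) = cis (of_int n * (-pi/2))"
    proof -
      have "of_int n * (3*pi/2) = of_int n * (-pi/2) + 2 * pi * of_int n" by (simp add: algebra_simps)
      then have "cis (of_int n * (3*pi/2)) = cis (of_int n * (-pi/2) + 2 * pi * of_int n)"
          by (simp only:)
      also have "\<dots> = cis (of_int n * (-pi/2)) * cis (2 * pi * of_int n)" by (rule cis_mult[symmetric])
      also have "cis (2 * pi * of_int n) = 1" by (rule cis_multiple_2pi) simp
      finally show ?thesis by (simp only: mult_1_right)
    qed
    ultimately show ?thesis using False by (simp only: integral_unique diff_self if_False)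
  qed
  finally show ?thesis .
qed

text \<open>Both series converge absolutely, so Fubini applies on circle times double sum and
  orthogonality keeps the diagonal. The opposite signs of the frequencies make the pairing bilinear,
  as it arises from \<open>z\<close> and \<open>t / z\<close>.\<close>

lemma fourier_series_parseval:
  fixes \<alpha> \<beta> :: "int \<Rightarrow> complex"
  assumes \<alpha>: "integrable int_measure \<alpha>" and \<beta>: "integrable int_measure \<beta>"
  shows "integrable circle_measure (\<lambda>\<theta>. (\<integral>j. \<alpha> j * cis (- (of_int j * \<theta>)) \<partial>int_measure)
      * (\<integral>k. \<beta> k * cis (of_int k * \<theta>) \<partial>int_measure))"
    and "(\<integral>\<theta>. (\<integral>j. \<alpha> j * cis (- (of_int j * \<theta>)) \<partial>int_measure)
        * (\<integral>k. \<beta> k * cis (of_int k * \<theta>) \<partial>int_measure) \<partial>circle_measure)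
      = of_real (2 * pi) * (\<integral>k. \<alpha> k * \<beta> k \<partial>int_measure)"
    and "integrable int_measure (\<lambda>k. \<alpha> k * \<beta> k)"
proof -
  interpret C: finite_measure circle_measure by (rule finite_circle_measure)
  interpret Z: sigma_finite_measure int_measure by (rule sigma_finite_measure_count_space)
  interpret ZZ: pair_sigma_finite int_measure int_measure ..
  let ?P = "int_measure \<Otimes>\<^sub>M int_measure"
  interpret CP: pair_sigma_finite circle_measure ?P ..
  define H where "H \<theta> p = (\<alpha> (fst p) * \<beta> (snd p)) * cis (of_int (snd p - fst p) * \<theta>)" for \<theta> p
  have ab: "integrable ?P (\<lambda>(j, k). \<alpha> j * \<beta> k)"
    by (intro integrable_times_pair Z.sigma_finite_measure_axioms \<alpha> \<beta>)
  have [measurable]: "(\<lambda>z. real_of_int (snd (snd z) - fst (snd z)) * fst z)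
      \<in> borel_measurable (circle_measure \<Otimes>\<^sub>M ?P)"
  proof -
    have [measurable]: "fst \<in> circle_measure \<Otimes>\<^sub>M ?P \<rightarrow>\<^sub>M borel"
      by (rule measurable_compose[OF measurable_fst measurable_circle_measure])
    have [measurable]: "(\<lambda>z. real_of_int (snd (snd z) - fst (snd z)))
        \<in> borel_measurable (circle_measure \<Otimes>\<^sub>M ?P)"
      by (rule measurable_compose[OF measurable_snd, of "\<lambda>p. real_of_int (snd p - fst p)"])
        (simp add: pair_measure_countable)
    show ?thesis by measurable
  qed
  have H: "integrable (circle_measure \<Otimes>\<^sub>M ?P) (\<lambda>(\<theta>, p). H \<theta> p)"
  proof -
    have "integrable (circle_measure \<Otimes>\<^sub>M ?P) (\<lambda>(\<theta>, p). 1 * (case p of (j, k) \<Rightarrow> \<alpha> j * \<beta> k))"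
      by (intro integrable_times_pair C.sigma_finite_measure_axioms ZZ.sigma_finite_measure_axioms
          ab) simp
    then have "integrable (circle_measure \<Otimes>\<^sub>M ?P)
        (\<lambda>z. (case z of (\<theta>, p) \<Rightarrow> 1 * (case p of (j, k) \<Rightarrow> \<alpha> j * \<beta> k))
            * cis (real_of_int (snd (snd z) - fst (snd z)) * fst z))"
      by (rule integrable_times_cis) measurable
    also have "(\<lambda>z. (case z of (\<theta>, p) \<Rightarrow> 1 * (case p of (j, k) \<Rightarrow> \<alpha> j * \<beta> k))
        * cis (real_of_int (snd (snd z) - fst (snd z)) * fst z)) = (\<lambda>(\<theta>, p). H \<theta> p)"
      by (auto simp: H_def fun_eq_iff)
    finally show ?thesis .
  qed
  have inner: "(\<integral>p. H \<theta> p \<partial>?P) = (\<integral>j. \<alpha> j * cis (- (of_int j * \<theta>)) \<partial>int_measure)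
      * (\<integral>k. \<beta> k * cis (of_int k * \<theta>) \<partial>int_measure)" for \<theta>
  proof -
    have i1: "integrable int_measure (\<lambda>j. \<alpha> j * cis (- (of_int j * \<theta>)))"
        and i2: "integrable int_measure (\<lambda>k. \<beta> k * cis (of_int k * \<theta>))"
      by (intro integrable_times_cis \<alpha> \<beta>; simp)+
    have "H \<theta> p = (case p of (j, k) \<Rightarrow> (\<alpha> j * cis (- (of_int j * \<theta>))) * (\<beta> k * cis (of_int k * \<theta>)))"
        for p
    proof -
      have "cis (of_int (snd p - fst p) * \<theta>) = cis (- (of_int (fst p) * \<theta>)) * cis (of_int (snd p) * \<theta>)"
        by (simp add: cis_mult algebra_simps)
      then show ?thesis by (simp add: H_def case_prod_beta' mult_ac)
    qed
    then have "(\<integral>p. H \<theta> p \<partial>?P)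
        = (\<integral>p. (case p of (j, k) \<Rightarrow> (\<alpha> j * cis (- (of_int j * \<theta>))) * (\<beta> k * cis (of_int k * \<theta>))) \<partial>?P)"
      by simp
    also have "\<dots> = (\<integral>j. \<integral>k. (\<alpha> j * cis (- (of_int j * \<theta>))) * (\<beta> k * cis (of_int k * \<theta>)) \<partial>int_measure
        \<partial>int_measure)"
      using ZZ.integral_fst'[OF integrable_times_pair[OF Z.sigma_finite_measure_axioms
          Z.sigma_finite_measure_axioms i1 i2]] by simp
    finally show ?thesis by (simp only: integral_mult_right_zero integral_mult_left_zero)
  qed
  show "integrable circle_measure (\<lambda>\<theta>. (\<integral>j. \<alpha> j * cis (- (of_int j * \<theta>)) \<partial>int_measure)
      * (\<integral>k. \<beta> k * cis (of_int k * \<theta>) \<partial>int_measure))"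
    using CP.integrable_fst[OF H] by (simp only: inner)
  have diag: "integrable ?P (\<lambda>p. (\<alpha> (fst p) * \<beta> (snd p)) * (if snd p - fst p
      = 0 then of_real (2 * pi) else 0))"
    using CP.integrable_snd[OF H] unfolding H_def
        by (simp only: integral_mult_right_zero cis_circle_integral)
  have delta: "(\<integral>k. (\<alpha> j * \<beta> k) * (if k - j = 0 then of_real (2 * pi) else 0) \<partial>int_measure)
      = of_real (2 * pi) * (\<alpha> j * \<beta> j)" for j
  proof -
    have "(\<integral>k. (\<alpha> j * \<beta> k) * (if k - j = 0 then of_real (2 * pi) else 0) \<partial>int_measure)
       = (\<integral>k. indicator {j} k *\<^sub>R (of_real (2 * pi) * (\<alpha> j * \<beta> j)) \<partial>int_measure)"
      by (intro Bochner_Integration.integral_cong) (auto simp: indicator_def)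
    also have "\<dots> = of_real (2 * pi) * (\<alpha> j * \<beta> j)"
      by (subst integral_scaleR_left) (auto simp: integrable_indicator_iff)
    finally show ?thesis .
  qed
  have "integrable int_measure (\<lambda>j. of_real (2 * pi) * (\<alpha> j * \<beta> j))"
    using ZZ.integrable_fst'[OF diag] by (simp only: fst_conv snd_conv delta)
  from integrable_mult_right[OF this, of "of_real (1 / (2 * pi))"]
  show "integrable int_measure (\<lambda>k. \<alpha> k * \<beta> k)" by simp
  have "(\<integral>\<theta>. (\<integral>j. \<alpha> j * cis (- (of_int j * \<theta>)) \<partial>int_measure)
      * (\<integral>k. \<beta> k * cis (of_int k * \<theta>) \<partial>int_measure) \<partial>circle_measure)
     = (\<integral>\<theta>. \<integral>p. H \<theta> p \<partial>?P \<partial>circle_measure)"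
    by (simp only: inner)
  also have "\<dots> = (\<integral>p. \<integral>\<theta>. H \<theta> p \<partial>circle_measure \<partial>?P)"
    by (rule CP.Fubini_integral[OF H, symmetric])
  also have "\<dots> = (\<integral>p. (\<alpha> (fst p) * \<beta> (snd p)) * (if snd p - fst p = 0 then of_real (2 * pi) else 0)
      \<partial>?P)"
    unfolding H_def by (simp only: integral_mult_right_zero cis_circle_integral)
  also have "\<dots> = (\<integral>j. \<integral>k. (\<alpha> j * \<beta> k) * (if k - j = 0 then of_real (2 * pi) else 0) \<partial>int_measure
      \<partial>int_measure)"
    using ZZ.integral_fst'[OF diag] by simp
  also have "\<dots> = (\<integral>j. of_real (2 * pi) * (\<alpha> j * \<beta> j) \<partial>int_measure)"
    by (simp only: delta)
  finally show "(\<integral>\<theta>. (\<integral>j. \<alpha> j * cis (- (of_int j * \<theta>)) \<partial>int_measure)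
      * (\<integral>k. \<beta> k * cis (of_int k * \<theta>) \<partial>int_measure) \<partial>circle_measure)
      = of_real (2 * pi) * (\<integral>k. \<alpha> k * \<beta> k \<partial>int_measure)"
    by simp
qed

lemma nn_integral_norm_square:
  fixes T :: "'a \<Rightarrow> complex"
  assumes i: "integrable M (\<lambda>x. T x * cnj (T x))"
  shows "(\<integral>\<^sup>+x. ennreal ((cmod (T x))\<^sup>2) \<partial>M) = ennreal (Re (\<integral>x. T x * cnj (T x) \<partial>M))"
proof -
  have sq: "T x * cnj (T x) = of_real ((cmod (T x))\<^sup>2)" for x by (simp only: complex_norm_square)
  have "integrable M (\<lambda>x. (cmod (T x))\<^sup>2)" using integrable_Re[OF i] unfolding sq by simp
  then show ?thesis unfolding sq integral_complex_of_real Re_complex_of_real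
    by (intro nn_integral_eq_integral) auto
qed

text \<open>The bilinear Parseval identity with one sequence the conjugate of the other. Both signs
  of the frequency occur, the second one after reflecting the angle. No square summability is
  assumed, since integrability of the product is part of the identity.\<close>

lemma fourier_series_norm:
  fixes \<alpha> :: "int \<Rightarrow> complex"
  assumes \<alpha>: "integrable int_measure \<alpha>"
  shows "(\<integral>\<^sup>+\<theta>. ennreal ((cmod (\<integral>j. \<alpha> j * cis (- (of_int j * \<theta>)) \<partial>int_measure))\<^sup>2) \<partial>circle_measure)
      = ennreal (2 * pi) * (\<integral>\<^sup>+k. ennreal ((cmod (\<alpha> k))\<^sup>2) \<partial>int_measure)" (is "?A = ?C")
    and "(\<integral>\<^sup>+\<theta>. ennreal ((cmod (\<integral>j. \<alpha> j * cis (of_int j * \<theta>) \<partial>int_measure))\<^sup>2) \<partial>circle_measure)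
      = ennreal (2 * pi) * (\<integral>\<^sup>+k. ennreal ((cmod (\<alpha> k))\<^sup>2) \<partial>int_measure)" (is "?B = ?C")
proof -
  have \<alpha>': "integrable int_measure (\<lambda>k. cnj (\<alpha> k))" using \<alpha> by simp
  have c: "(\<integral>k. cnj (\<alpha> k) * cis (of_int k * \<theta>) \<partial>int_measure)
      = cnj (\<integral>j. \<alpha> j * cis (- (of_int j * \<theta>)) \<partial>int_measure)"
    "(\<integral>k. cnj (\<alpha> k) * cis (- (of_int k * \<theta>)) \<partial>int_measure)
        = cnj (\<integral>j. \<alpha> j * cis (of_int j * \<theta>) \<partial>int_measure)" for \<theta>
    by (simp_all only: Bochner_Integration.integral_cnj[symmetric] complex_cnj_mult cis_cnj minus_minus)
  note P1 = fourier_series_parseval[OF \<alpha> \<alpha>', unfolded c]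
    and P2 = fourier_series_parseval[OF \<alpha>' \<alpha>, unfolded c, unfolded mult.commute[of "cnj _"]]
  have R: "ennreal (Re (of_real (2 * pi) * (\<integral>k. \<alpha> k * cnj (\<alpha> k) \<partial>int_measure))) = ?C"
    by (subst nn_integral_norm_square[OF P1(3)]) (simp add: ennreal_mult')
  show "?A = ?C"
    unfolding nn_integral_norm_square[OF P1(1)] P1(2) by (rule R)
  show "?B = ?C"
    unfolding nn_integral_norm_square[OF P2(1)] P2(2) by (rule R)
qed

lemma snd_circle_measurable [measurable]: "snd
    \<in> borel_measurable ((lborel :: real measure) \<Otimes>\<^sub>M circle_measure)"
  by (rule measurable_compose[OF measurable_snd measurable_circle_measure])

lemma polar_measurable [measurable]:
  "(\<lambda>(x, \<theta>). exp (Complex x \<theta>)) \<in> borel_measurable (lborel \<Otimes>\<^sub>M circle_measure)"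
  unfolding case_prod_beta' by measurable

text \<open>All that the convolution formula uses about \<open>G_C\<close>: a symbol, the Fourier
  series on circles, and square integrability.\<close>

locale mellin_symbol =
  fixes F :: "int \<Rightarrow> real \<Rightarrow> complex" and \<nu> \<eta> :: real and G :: "complex \<Rightarrow> complex"
  assumes F: "symbol_on UNIV \<nu> \<eta> F" and \<eta>: "\<eta> > 0" and \<nu>: "\<nu> = 0 \<or> \<bar>\<nu>\<bar> \<ge> 1"
    and G: "G (exp (Complex x \<theta>))
        = of_real (1 / (2 * pi)) * (\<Sum>\<^sub>\<infinity>k\<in>UNIV. osc_int F k x * cis (- (of_int k * \<theta>)))"
    and L2G: "L2 mult_measure G"
begin

lemma coeff_integrable: "x \<noteq> 0 \<Longrightarrow> integrable int_measure (\<lambda>k. osc_int F k x)"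
  by (intro summable_imp_integrable_count_space osc_int_abs_summable[OF F \<eta> \<nu>])

lemma G_eq:
  assumes "x \<noteq> 0"
  shows "G (exp (Complex x \<theta>))
      = of_real (1 / (2 * pi)) * (\<integral>k. osc_int F k x * cis (- (of_int k * \<theta>)) \<partial>int_measure)"
  unfolding G by (subst integral_count_space_eq_infsum) (intro integrable_times_cis coeff_integrable
      assms, simp_all)

lemma G_measurable [measurable]: "G \<in> borel_measurable borel"
  using L2G by (simp add: L2_def mult_measure_def)

text \<open>The second statement concerns the reflected angle that \<open>t / z\<close> requires:
  the shift by \<open>\<phi>\<close> multiplies the coefficients by unimodular numbers and the
  reflection reverses the frequencies, neither of which affects the norm.\<close>

lemma G_circle_norm:
  assumes "x \<noteq> 0"
  shows "(\<integral>\<^sup>+\<theta>. ennreal ((cmod (G (exp (Complex x \<theta>))))\<^sup>2) \<partial>circle_measure)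
      = ennreal (1 / (2 * pi)) * (\<integral>\<^sup>+k. ennreal ((cmod (osc_int F k x))\<^sup>2) \<partial>int_measure)"
    and "(\<integral>\<^sup>+\<theta>. ennreal ((cmod (G (exp (Complex x (\<phi> - \<theta>)))))\<^sup>2) \<partial>circle_measure)
      = ennreal (1 / (2 * pi)) * (\<integral>\<^sup>+k. ennreal ((cmod (osc_int F k x))\<^sup>2) \<partial>int_measure)"
proof -
  have const: "ennreal ((1 / (2 * pi))\<^sup>2) * (ennreal (2 * pi) * X) = ennreal (1 / (2 * pi)) * X" for X
    by (simp add: mult.assoc[symmetric] ennreal_mult'[symmetric] power2_eq_square)
  have sc: "(\<integral>\<^sup>+\<theta>. ennreal ((cmod (of_real (1 / (2 * pi)) * T \<theta>))\<^sup>2) \<partial>circle_measure)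
      = ennreal ((1 / (2 * pi))\<^sup>2) * (\<integral>\<^sup>+\<theta>. ennreal ((cmod (T \<theta>))\<^sup>2) \<partial>circle_measure)"
    if [measurable]: "T \<in> borel_measurable circle_measure" for T :: "real \<Rightarrow> complex"
    by (subst nn_integral_cmult[symmetric])
      (simp_all add: norm_mult norm_divide power_mult_distrib ennreal_mult'[symmetric] power_divide)
  have m: "(\<lambda>\<theta>. \<integral>k. \<alpha> k * cis (of_int k * s * \<theta>) \<partial>int_measure)
      \<in> borel_measurable circle_measure" for s \<alpha>
  proof -
    interpret sigma_finite_measure int_measure by (rule sigma_finite_measure_count_space)
    have [measurable]: "(\<lambda>(\<theta>, k). \<alpha> k * cis (of_int k * s * \<theta>))
        \<in> borel_measurable (borel \<Otimes>\<^sub>M int_measure)"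
      by measurable
    have "(\<lambda>\<theta>. \<integral>k. \<alpha> k * cis (of_int k * s * \<theta>) \<partial>int_measure) \<in> borel_measurable borel"
      by (rule borel_measurable_lebesgue_integral) measurable
    from measurable_compose[OF measurable_circle_measure this] show ?thesis .
  qed
  note i = coeff_integrable[OF assms]
  have i': "integrable int_measure (\<lambda>k. osc_int F k x * cis (- (of_int k * \<phi>)))"
    by (intro integrable_times_cis i) simp
  show "(\<integral>\<^sup>+\<theta>. ennreal ((cmod (G (exp (Complex x \<theta>))))\<^sup>2) \<partial>circle_measure)
      = ennreal (1 / (2 * pi)) * (\<integral>\<^sup>+k. ennreal ((cmod (osc_int F k x))\<^sup>2) \<partial>int_measure)"
    using m[of "\<lambda>k. osc_int F k x" "- 1"]
    unfolding G_eq[OF assms] by (subst sc) (simp_all add: fourier_series_norm[OF i] const)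
  have shift: "osc_int F k x * cis (- (of_int k * (\<phi> - \<theta>)))
      = (osc_int F k x * cis (- (of_int k * \<phi>))) * cis (of_int k * \<theta>)" for k \<theta>
    by (simp add: mult.assoc cis_mult algebra_simps)
  show "(\<integral>\<^sup>+\<theta>. ennreal ((cmod (G (exp (Complex x (\<phi> - \<theta>)))))\<^sup>2) \<partial>circle_measure)
      = ennreal (1 / (2 * pi)) * (\<integral>\<^sup>+k. ennreal ((cmod (osc_int F k x))\<^sup>2) \<partial>int_measure)"
    using m[of "\<lambda>k. osc_int F k x * cis (- (of_int k * \<phi>))" 1]
    unfolding G_eq[OF assms] shift
        by (subst sc) (simp_all add: fourier_series_norm[OF i'] const norm_mult)
qed

lemma coeff_measurable [measurable]: "(\<lambda>(k, x). osc_int F k x)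
    \<in> borel_measurable (int_measure \<Otimes>\<^sub>M borel)"
  by (rule measurable_pair_measure_countable1) (auto intro: osc_int_measurable[OF F \<eta> \<nu>])

lemma coeff_norm_measurable [measurable]:
  "(\<lambda>x. \<integral>\<^sup>+k. ennreal ((cmod (osc_int F k x))\<^sup>2) \<partial>int_measure) \<in> borel_measurable borel"
proof -
  interpret sigma_finite_measure int_measure by (rule sigma_finite_measure_count_space)
  have [measurable]: "(\<lambda>(x, k). osc_int F k x) \<in> borel_measurable (borel \<Otimes>\<^sub>M int_measure)"
    using measurable_pair_swap[OF coeff_measurable] by (simp add: case_prod_beta')
  show ?thesis by measurable
qed

lemma L2_polar: "L2 (lborel \<Otimes>\<^sub>M circle_measure) (\<lambda>(x, \<theta>). G (exp (Complex x \<theta>)))"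
  using L2G unfolding L2_def mult_measure_polar
  by (subst (asm) integrable_distr_eq) (auto simp: case_prod_beta')

text \<open>Here the hypothesis on \<open>G_C\<close> enters: by Tonelli in polar coordinates its
  squared norm is, up to 1 / (2 pi), the sum over \<open>k\<close> of the squared norms of the
  coefficients.\<close>

lemma coeff_L2_norm: "(\<integral>\<^sup>+x. (\<integral>\<^sup>+k. ennreal ((cmod (osc_int F k x))\<^sup>2) \<partial>int_measure) \<partial>lborel) < \<infinity>"
proof -
  interpret C: finite_measure circle_measure by (rule finite_circle_measure)
  interpret sigma_finite_measure int_measure by (rule sigma_finite_measure_count_space)
  interpret P: pair_sigma_finite int_measure "lborel :: real measure" ..
  let ?N = "\<lambda>x. \<integral>\<^sup>+k. ennreal ((cmod (osc_int F k x))\<^sup>2) \<partial>int_measure"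
  have "ennreal (1 / (2 * pi)) * (\<integral>\<^sup>+x. ?N x \<partial>lborel) = (\<integral>\<^sup>+x. ennreal (1 / (2 * pi)) * ?N x \<partial>lborel)"
    by (rule nn_integral_cmult[symmetric]) measurable
  also have "\<dots> = (\<integral>\<^sup>+x. \<integral>\<^sup>+\<theta>. ennreal ((cmod (G (exp (Complex x \<theta>))))\<^sup>2) \<partial>circle_measure \<partial>lborel)"
    using AE_lborel_singleton[of "0::real"]
    by (intro nn_integral_cong_AE) (auto simp: G_circle_norm(1) elim!: eventually_mono)
  also have "\<dots> = (\<integral>\<^sup>+p. ennreal ((cmod (case p of (x, \<theta>) \<Rightarrow> G (exp (Complex x \<theta>))))\<^sup>2)
      \<partial>(lborel \<Otimes>\<^sub>M circle_measure))"
    using L2_polar by (subst C.nn_integral_fst[symmetric]) (auto simp: L2_def)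
  also have "\<dots> < \<infinity>"
    using L2_polar by (auto simp: L2_def nn_integral_eq_integral)
  finally show ?thesis
    by (auto simp: ennreal_mult_less_top)
qed

lemma coeff_L2_pair:
  assumes s: "s = 1 \<or> s = (-1 :: real)"
  shows "L2 (int_measure \<Otimes>\<^sub>M lborel) (\<lambda>(k, x). osc_int F k (c + s * x))"
proof -
  interpret sigma_finite_measure int_measure by (rule sigma_finite_measure_count_space)
  interpret P: pair_sigma_finite int_measure "lborel :: real measure" ..
  let ?N = "\<lambda>x. \<integral>\<^sup>+k. ennreal ((cmod (osc_int F k x))\<^sup>2) \<partial>int_measure"
  have [measurable]: "(\<lambda>(k, x). osc_int F k (c + s * x)) \<in> borel_measurable (int_measure \<Otimes>\<^sub>M lborel)"
    using osc_int_measurable[OF F \<eta> \<nu>] by (intro measurable_pair_measure_countable1) auto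
  have "(\<integral>\<^sup>+p. ennreal ((cmod (case p of (k, x) \<Rightarrow> osc_int F k (c + s * x)))\<^sup>2)
      \<partial>(int_measure \<Otimes>\<^sub>M lborel)) = (\<integral>\<^sup>+x. ?N (c + s * x) \<partial>lborel)"
    by (subst P.nn_integral_snd[symmetric]) auto
  also have "\<dots> = (\<integral>\<^sup>+x. ?N x \<partial>lborel)"
    using s by (subst (2) nn_integral_real_affine[where c=s and t=c]) auto
  also have "\<dots> < \<infinity>" by (rule coeff_L2_norm)
  finally show ?thesis
    by (auto simp: L2_def intro!: integrableI_bounded)
qed

text \<open>Fubini gives this for almost every \<open>k\<close>, and for counting measure that means
  every \<open>k\<close>.\<close>

lemma coeff_L2: "L2 lborel (osc_int F k)"
proof -
  interpret sigma_finite_measure int_measure by (rule sigma_finite_measure_count_space)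
  interpret P: pair_sigma_finite int_measure "lborel :: real measure" ..
  have "integrable (int_measure \<Otimes>\<^sub>M lborel) (\<lambda>(k, x). (cmod (osc_int F k x))\<^sup>2)"
    using coeff_L2_pair[of 1 0] by (simp add: L2_def case_prod_beta')
  from P.AE_integrable_fst[OF this] have "integrable lborel (\<lambda>x. (cmod (osc_int F k x))\<^sup>2)"
    by (simp add: AE_count_space)
  then show ?thesis using osc_int_measurable[OF F \<eta> \<nu>] by (simp add: L2_def)
qed

text \<open>The chosen interval of angles is not invariant under reflection, so the claim is read
  off from the coefficients, which do not see the change, and not obtained by a change of
  variables.\<close>

lemma L2_polar_reflected: "L2 (lborel \<Otimes>\<^sub>M circle_measure) (\<lambda>(x, \<theta>). G (exp (Complex (y - x) (\<phi> - \<theta>))))"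
proof -
  interpret C: finite_measure circle_measure by (rule finite_circle_measure)
  interpret sigma_finite_measure int_measure by (rule sigma_finite_measure_count_space)
  interpret P: pair_sigma_finite int_measure "lborel :: real measure" ..
  let ?N = "\<lambda>x. \<integral>\<^sup>+k. ennreal ((cmod (osc_int F k x))\<^sup>2) \<partial>int_measure"
  have [measurable]: "(\<lambda>(x, \<theta>). G (exp (Complex (y - x) (\<phi> - \<theta>))))
      \<in> borel_measurable (lborel \<Otimes>\<^sub>M circle_measure)"
    unfolding case_prod_beta' by measurable
  have "(\<integral>\<^sup>+p. ennreal ((cmod (case p of (x, \<theta>) \<Rightarrow> G (exp (Complex (y - x) (\<phi> - \<theta>)))))\<^sup>2)
      \<partial>(lborel \<Otimes>\<^sub>M circle_measure))
     = (\<integral>\<^sup>+x. \<integral>\<^sup>+\<theta>. ennreal ((cmod (G (exp (Complex (y - x) (\<phi> - \<theta>)))))\<^sup>2) \<partial>circle_measure \<partial>lborel)"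
    by (subst C.nn_integral_fst[symmetric]) auto
  also have "\<dots> = (\<integral>\<^sup>+x. ennreal (1 / (2 * pi)) * ?N (y - x) \<partial>lborel)"
    using AE_lborel_singleton[of y]
    by (intro nn_integral_cong_AE) (auto simp: G_circle_norm(2) elim!: eventually_mono)
  also have "\<dots> = ennreal (1 / (2 * pi)) * (\<integral>\<^sup>+x. ?N (y - x) \<partial>lborel)"
    by (rule nn_integral_cmult) measurable
  also have "(\<integral>\<^sup>+x. ?N (y - x) \<partial>lborel) = (\<integral>\<^sup>+x. ?N x \<partial>lborel)"
    by (subst (2) nn_integral_real_affine[where c="-1" and t=y]) auto
  also have "ennreal (1 / (2 * pi)) * \<dots> < \<infinity>"
    using coeff_L2_norm by (auto simp: ennreal_mult_less_top)
  finally show ?thesis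
    by (auto simp: L2_def intro!: integrableI_bounded)
qed

end

section \<open>The convolution formula\<close>

text \<open>At a fixed radius the angular integral is Parseval on the circle; exchanging the radial
  integral with the sum leaves, for each \<open>k\<close>, a convolution on the line, which is
  Parseval for improper integrals.\<close>

lemma mellin_convolution:
  assumes 1: "mellin_symbol F1 \<nu>1 \<eta>1 G1" and 2: "mellin_symbol F2 \<nu>2 \<eta>2 G2"
  shows "(\<integral>z. G1 z * G2 (exp (Complex y \<phi>) / z) \<partial>mult_measure)
    = (\<Sum>\<^sub>\<infinity>k\<in>UNIV. osc_int (\<lambda>k \<tau>. F1 k \<tau> * F2 k \<tau>) k y * cis (- (of_int k * \<phi>)))"
proof -
  interpret A: mellin_symbol F1 \<nu>1 \<eta>1 G1 by fact
  interpret B: mellin_symbol F2 \<nu>2 \<eta>2 G2 by fact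
  interpret C: finite_measure circle_measure by (rule finite_circle_measure)
  interpret LC: pair_sigma_finite "lborel :: real measure" circle_measure ..
  interpret Z: sigma_finite_measure int_measure by (rule sigma_finite_measure_count_space)
  interpret P: pair_sigma_finite int_measure "lborel :: real measure" ..
  note [measurable] = A.G_measurable B.G_measurable
  define c where "c k = cis (- (of_int k * \<phi>))" for k :: int
  define W where "W k x = osc_int F1 k x * (osc_int F2 k (y - x) * c k)" for k x
  have quot: "exp (Complex y \<phi>) / exp (Complex x \<theta>) = exp (Complex (y - x) (\<phi> - \<theta>))" for x \<theta>
    by (simp add: exp_diff[symmetric] complex_diff)
  \<comment> \<open>Cauchy-Schwarz on integers times reals; this is where the summability of the
    squared norms over all \<open>k\<close> is needed.\<close>
  have W: "integrable (int_measure \<Otimes>\<^sub>M lborel) (\<lambda>(k, x). W k x)"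
  proof -
    have a: "L2 (int_measure \<Otimes>\<^sub>M lborel) (\<lambda>p. osc_int F1 (fst p) (snd p))"
      using A.coeff_L2_pair[of 1 0] by (simp add: case_prod_beta')
    have b: "L2 (int_measure \<Otimes>\<^sub>M lborel) (\<lambda>p. osc_int F2 (fst p) (y - snd p))"
      using B.coeff_L2_pair[of "-1" y] by (simp add: case_prod_beta')
    have m: "(\<lambda>p. - (real_of_int (fst p) * \<phi>)) \<in> borel_measurable (int_measure \<Otimes>\<^sub>M lborel)"
      by measurable
    from integrable_times_cis[OF L2_mult(1)[OF a b] m]
    show ?thesis by (simp add: W_def c_def case_prod_beta' mult.assoc)
  qed
  have uv: "integrable (lborel \<Otimes>\<^sub>M circle_measure) (\<lambda>(x, \<theta>). G1 (exp (Complex x \<theta>))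
      * G2 (exp (Complex (y - x) (\<phi> - \<theta>))))"
    using L2_mult(1)[OF A.L2_polar B.L2_polar_reflected[of y \<phi>]] by (simp add: case_prod_beta')
  have circle: "(\<integral>\<theta>. G1 (exp (Complex x \<theta>)) * G2 (exp (Complex (y - x) (\<phi> - \<theta>))) \<partial>circle_measure)
      = of_real (1 / (2 * pi)) * (\<integral>k. W k x \<partial>int_measure)" if x: "x \<noteq> 0" "y - x \<noteq> 0" for x
  proof -
    have i2: "integrable int_measure (\<lambda>k. osc_int F2 k (y - x) * c k)"
      unfolding c_def by (intro integrable_times_cis B.coeff_integrable x) simp
    have shift: "osc_int F2 k (y - x) * cis (- (of_int k * (\<phi> - \<theta>))) = (osc_int F2 k (y - x) * c k)
        * cis (of_int k * \<theta>)" for k \<theta>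
      by (simp add: c_def mult.assoc cis_mult algebra_simps)
    have "G1 (exp (Complex x \<theta>)) * G2 (exp (Complex (y - x) (\<phi> - \<theta>))) = (of_real (1 / (2 * pi)))\<^sup>2 *
       ((\<integral>j. osc_int F1 j x * cis (- (of_int j * \<theta>)) \<partial>int_measure)
           * (\<integral>k. (osc_int F2 k (y - x) * c k) * cis (of_int k * \<theta>) \<partial>int_measure))" for \<theta>
      unfolding A.G_eq[OF x(1)] B.G_eq[OF x(2)] shift by (simp add: power2_eq_square)
    then have "(\<integral>\<theta>. G1 (exp (Complex x \<theta>)) * G2 (exp (Complex (y - x) (\<phi> - \<theta>))) \<partial>circle_measure)
      = (of_real (1 / (2 * pi)))\<^sup>2 * (of_real (2 * pi) * (\<integral>k. W k x \<partial>int_measure))"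
      by (simp only: integral_mult_right_zero fourier_series_parseval(2)[OF A.coeff_integrable[OF
          x(1)] i2] W_def)
    then show ?thesis by (simp add: power2_eq_square)
  qed
  have inner: "(\<integral>x. W k x \<partial>lborel)
      = of_real (2 * pi) * (osc_int (\<lambda>k \<tau>. F1 k \<tau> * F2 k \<tau>) k y * c k)" for k
  proof -
    obtain D1 B1 where f1: "improper_fourier (F1 k) (osc_int F1 k) D1 B1"
      using osc_int_improper_fourier[OF A.F A.\<eta> A.\<nu> A.coeff_L2] by blast
    obtain D2 B2 where f2: "improper_fourier (F2 k) (osc_int F2 k) D2 B2"
      using osc_int_improper_fourier[OF B.F B.\<eta> B.\<nu> B.coeff_L2] by blast
    note pars = parseval_improper_fourier[OF f1 f2]
    have "integrable lborel (\<lambda>t. F1 k t * F2 k t * cis (- (t * y)))"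
      by (rule integrable_times_cis[OF pars(1)]) simp
    then have "((\<lambda>t. F1 k t * F2 k t * cis (- (t * y))) has_integral (\<integral>t. F1 k t * F2 k t
        * cis (- (t * y)) \<partial>lborel)) UNIV"
      by (rule has_integral_integral_lborel)
    then have o: "osc_int (\<lambda>k \<tau>. F1 k \<tau> * F2 k \<tau>) k y = (\<integral>t. F1 k t * F2 k t * cis (- (t * y)) \<partial>lborel)"
      unfolding osc_int_def by (rule integral_unique)
    have "(\<integral>x. W k x \<partial>lborel) = (\<integral>x. osc_int F1 k x * osc_int F2 k (y - x) \<partial>lborel) * c k"
      unfolding W_def by (simp add: mult.assoc[symmetric])
    then show ?thesis unfolding pars(2) o by simp
  qed
  have "(\<integral>z. G1 z * G2 (exp (Complex y \<phi>) / z) \<partial>mult_measure)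
    = (\<integral>p. (case p of (x, \<theta>) \<Rightarrow> G1 (exp (Complex x \<theta>)) * G2 (exp (Complex (y - x) (\<phi> - \<theta>))))
        \<partial>(lborel \<Otimes>\<^sub>M circle_measure))"
    unfolding mult_measure_polar by (subst integral_distr) (auto simp: case_prod_beta' quot)
  also have "\<dots> = (\<integral>x. \<integral>\<theta>. G1 (exp (Complex x \<theta>))
      * G2 (exp (Complex (y - x) (\<phi> - \<theta>))) \<partial>circle_measure \<partial>lborel)"
    using LC.integral_fst'[OF uv] by simp
  also have "\<dots> = (\<integral>x. of_real (1 / (2 * pi)) * (\<integral>k. W k x \<partial>int_measure) \<partial>lborel)"
  proof (rule integral_cong_AE)
    show "(\<lambda>x. \<integral>\<theta>. G1 (exp (Complex x \<theta>)) * G2 (exp (Complex (y - x) (\<phi> - \<theta>))) \<partial>circle_measure)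
        \<in> borel_measurable lborel"
      using LC.integrable_fst[OF uv] by (rule borel_measurable_integrable)
    show "(\<lambda>x. of_real (1 / (2 * pi)) * (\<integral>k. W k x \<partial>int_measure)) \<in> borel_measurable lborel"
      by (intro borel_measurable_integrable integrable_mult_right P.integrable_snd[OF W])
    show "AE x in lborel. (\<integral>\<theta>. G1 (exp (Complex x \<theta>))
        * G2 (exp (Complex (y - x) (\<phi> - \<theta>))) \<partial>circle_measure)
       = of_real (1 / (2 * pi)) * (\<integral>k. W k x \<partial>int_measure)"
      \<comment> \<open>The exceptional radii are those with |z| = 1 or |t / z| = 1, that is x = 0
        and x = y.\<close>
      using AE_lborel_singleton[of 0] AE_lborel_singleton[of y] by eventually_elim (rule circle, auto)
  qed
  also have "\<dots> = of_real (1 / (2 * pi)) * (\<integral>x. \<integral>k. W k x \<partial>int_measure \<partial>lborel)"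
    by (rule integral_mult_right_zero)
  also have "(\<integral>x. \<integral>k. W k x \<partial>int_measure \<partial>lborel) = (\<integral>k. \<integral>x. W k x \<partial>lborel \<partial>int_measure)"
    by (rule P.Fubini_integral[OF W])
  also have "\<dots> = of_real (2 * pi) * (\<integral>k. osc_int (\<lambda>k \<tau>. F1 k \<tau> * F2 k \<tau>) k y * c k \<partial>int_measure)"
    unfolding inner by (rule integral_mult_right_zero)
  also have "(\<integral>k. osc_int (\<lambda>k \<tau>. F1 k \<tau> * F2 k \<tau>) k y * c k \<partial>int_measure)
    = (\<Sum>\<^sub>\<infinity>k\<in>UNIV. osc_int (\<lambda>k \<tau>. F1 k \<tau> * F2 k \<tau>) k y * c k)"
  proof (rule integral_count_space_eq_infsum[symmetric])
    \<comment> \<open>Absolute summability of the product's coefficients is obtained from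
      \<open>W\<close> and not from the decay estimate. It therefore holds at y = 0 too, so that |t|
      = 1 is no exception on the right.\<close>
    have "integrable int_measure (\<lambda>k. of_real (1 / (2 * pi)) * (\<integral>x. W k x \<partial>lborel))"
      by (rule integrable_mult_right) (rule P.integrable_fst[OF W])
    then show "integrable int_measure (\<lambda>k. osc_int (\<lambda>k \<tau>. F1 k \<tau> * F2 k \<tau>) k y * c k)"
      unfolding inner by simp
  qed
  finally show ?thesis by (simp add: c_def)
qed

theorem theorem1p7:
  fixes p q r s :: nat
    and a b c d :: "(complex \<times> complex) list"
    and t :: complex
  assumes "length a = q" "length b = p" "length c = s" "length d = r"
    and "set a \<subseteq> Lambda_C" "set b \<subseteq> Lambda_C" "set c \<subseteq> Lambda_C" "set d \<subseteq> Lambda_C"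
    and "\<And>u u'. (u, u') \<in> set a \<Longrightarrow> Re (u + u') > 0"
    and "\<And>u u'. (u, u') \<in> set b \<Longrightarrow> Re (u + u') > 0"
    and "\<And>u u'. (u, u') \<in> set c \<Longrightarrow> Re (u + u') > 0"
    and "\<And>u u'. (u, u') \<in> set d \<Longrightarrow> Re (u + u') > 0"
    and "(\<Sum>(u, u')\<leftarrow>a. Re (u + u')) + (\<Sum>(u, u')\<leftarrow>b. Re (u + u')) < real (p + q)"
    and "(\<Sum>(u, u')\<leftarrow>c. Re (u + u')) + (\<Sum>(u, u')\<leftarrow>d. Re (u + u')) < real (r + s)"
    and "L2 mult_measure (G_C a b)"
    and "L2 mult_measure (G_C c d)"
    and "t \<noteq> 0"
  shows "1 / (2 * of_real pi) * (\<integral>z. G_C a b z * G_C c d (t / z) \<partial>mult_measure)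
         = G_C (a @ c) (b @ d) t"
proof -
  \<comment> \<open>The phase coefficient is a difference of list lengths; being an integer, it is
    never small without being zero.\<close>
  have diff: "real m - real n = 0 \<or> \<bar>real m - real n\<bar> \<ge> 1" for m n :: nat
    by (cases m n rule: linorder_cases) auto
  have sym: "mellin_symbol (\<lambda>k \<tau>. K_C a b k (\<i> * of_real \<tau>)) (real (length a) - real (length b))
      (real (length b + length a) - ((\<Sum>(u, u')\<leftarrow>a. Re (u + u')) + (\<Sum>(u, u')\<leftarrow>b. Re (u + u')))) (G_C a b)"
    if "set a \<subseteq> Lambda_C" "set b \<subseteq> Lambda_C" "\<And>u u'. (u, u') \<in> set a \<Longrightarrow> Re (u + u') > 0"
      "\<And>u u'. (u, u') \<in> set b \<Longrightarrow> Re (u + u') > 0"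
      "(\<Sum>(u, u')\<leftarrow>a. Re (u + u')) + (\<Sum>(u, u')\<leftarrow>b. Re (u + u')) < real (length b + length a)"
      "L2 mult_measure (G_C a b)" for a b
  proof unfold_locales
    show "symbol_on UNIV (real (length a) - real (length b))
      (real (length b + length a) - ((\<Sum>(u, u')\<leftarrow>a. Re (u + u')) + (\<Sum>(u, u')\<leftarrow>b. Re (u + u'))))
      (\<lambda>k \<tau>. K_C a b k (\<i> * of_real \<tau>))"
      by (rule symbol_K_C[OF that(1-4)])
    show "G_C a b (exp (Complex x \<theta>)) = of_real (1 / (2 * pi)) *
      (\<Sum>\<^sub>\<infinity>k\<in>UNIV. osc_int (\<lambda>k \<tau>. K_C a b k (\<i> * of_real \<tau>)) k x * cis (- (of_int k * \<theta>)))" for x \<theta>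
      by (rule G_C_polar)
  qed (use that diff[of "length a" "length b"] in simp_all)
  have "Complex (ln (cmod t)) (Arg t)
      = Ln t" by (rule complex_eqI) (use \<open>t \<noteq> 0\<close> in \<open>simp_all add: Re_Ln Arg_def\<close>)
  then have t: "t = exp (Complex (ln (cmod t)) (Arg t))" using \<open>t \<noteq> 0\<close> by simp
  \<comment> \<open>Concatenating parameter lists multiplies the kernels, so the product of symbols
    on the right is again the kernel of a function of the same type.\<close>
  have K: "K_C (a @ c) (b @ d) k \<sigma> = K_C a b k \<sigma> * K_C c d k \<sigma>" for k \<sigma>
    by (simp add: K_C_def)
  have "(\<integral>z. G_C a b z * G_C c d (exp (Complex (ln (cmod t)) (Arg t)) / z) \<partial>mult_measure)
    = (\<Sum>\<^sub>\<infinity>k\<in>UNIV. osc_int (\<lambda>k \<tau>. K_C (a @ c) (b @ d) k (\<i> * of_real \<tau>)) k (ln (cmod t))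
        * cis (- (of_int k * Arg t)))"
    unfolding K by (rule mellin_convolution) (rule sym; use assms in simp)+
  then show ?thesis
    using G_C_polar[of "a @ c" "b @ d" "ln (cmod t)" "Arg t"] unfolding t[symmetric] by simp
qed

end
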